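(* Let $n\ge p\ge 2$, let $\mathbf{X}\in\mathbb{R}^{n\times p}$ be a Gaussian random matrix with mean $\mathbf{M}=(\mathbf{m}_1\ \mathbf{M}_2)$ and mutually independent rows with positive definite covariance matrix $\boldsymbol{\Sigma}\in\mathbb{R}^{p\times p}$. Let $\boldsymbol{\Omega}=\boldsymbol{\Sigma}^{-1}\mathbf{M}'\mathbf{M}$, and let $\tilde{\mathbf{m}}_1$, $u$, $\lambda$, $\nu$, $\rho$ be as defined in the context. Suppose that $\mathbf{m}_1\neq\mathbf{0}$, $\mathbf{M}_2\neq\mathbf{0}$, $\tilde{\mathbf{m}}_1\neq\mathbf{0}$, and $\operatorname{rank}\mathbf{M}=\operatorname{rank}\boldsymbol{\Omega}=1$. Put $\tau=\operatorname{tr}[\boldsymbol{\Sigma}_{22}^{-1}\mathbf{M}_2'\mathbf{M}_2]$. Then $u$ has the noncentral beta distribution $Beta(\nu/2,(p-1)/2,\tau)$, i.e. $u$ has the p.d.f. $$h(u)=e^{-\tau/2}\sum_{l=0}^\infty\frac{(\tau/2)^l}{l!}\,\frac{u^{\nu/2-1}(1-u)^{(p-1)/2+l-1}}{B(\nu/2,(p-1)/2+l)},\qquad 0<u<1.$$ Moreover, the moment-generating function $M_\rho(\theta)=\mathbb{E}[e^{\theta\rho}]$ of the scaled scalar Schur complement $\rho$ satisfies, for $\theta<1/2$, $$M_\rho(\theta)=(1-2\theta)^{-\nu/2}e^{-\tau/2}\sum_{l=0}^\infty\frac{(\tau/2)^l}{l!}\,{}_1F_1\!\left(\frac{\nu}{2};\frac{n}{2}+l;\frac{\lambda\theta}{1-2\theta}\right)=(1-2\theta)^{-\nu/2}e^{-\tau/2}\,\Phi_2\!\left(\frac{\nu}{2},\frac{n}{2};\frac{n}{2};\frac{\lambda\theta}{1-2\theta},\frac{\tau}{2}\right);$$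 the corresponding mixture weights $\beta_k$, $k=0,1,2,\ldots$, are $$\beta_k=e^{-\tau/2}\frac{(\lambda/2)^k}{k!}\sum_{l=0}^\infty\frac{(\tau/2)^l}{l!}\frac{(\nu/2)_k}{(n/2+l)_k}\,{}_1F_1\!\left(\frac{\nu}{2}+k;\frac{n}{2}+k+l;-\frac{\lambda}{2}\right)=e^{-\tau/2}\frac{(\lambda/2)^k}{k!}\frac{(\nu/2)_k}{(n/2)_k}\,\Phi_2\!\left(\frac{\nu}{2}+k,\frac{n}{2};\frac{n}{2}+k;-\frac{\lambda}{2},\frac{\tau}{2}\right);$$ and their probability-generating function $G(s)=\sum_{k=0}^\infty s^k\beta_k$ is $$G(s)=e^{-\tau/2}\sum_{l=0}^\infty\frac{(\tau/2)^l}{l!}\,{}_1F_1\!\left(\frac{\nu}{2};\frac{n}{2}+l;\frac{\lambda}{2}(s-1)\right)=e^{-\tau/2}\,\Phi_2\!\left(\frac{\nu}{2},\frac{n}{2};\frac{n}{2};\frac{\lambda}{2}(s-1),\frac{\tau}{2}\right).$$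
   Context: Partition into first column and remaining columns: $\mathbf{X}=(\mathbf{x}_1\ \mathbf{X}_2)$, $\mathbf{M}=(\mathbf{m}_1\ \mathbf{M}_2)$, with $\mathbf{x}_1,\mathbf{m}_1\in\mathbb{R}^n$ and $\mathbf{X}_2,\mathbf{M}_2\in\mathbb{R}^{n\times(p-1)}$, and $$\boldsymbol{\Sigma}=\begin{pmatrix}\sigma_{11}&\boldsymbol{\sigma}_{21}'\\ \boldsymbol{\sigma}_{21}&\boldsymbol{\Sigma}_{22}\end{pmatrix},\qquad \sigma_{11\cdot 2}=\sigma_{11}-\boldsymbol{\sigma}_{21}'\boldsymbol{\Sigma}_{22}^{-1}\boldsymbol{\sigma}_{21}.$$ A prime denotes transpose. With $\mathbf{W}=\mathbf{X}'\mathbf{X}=\begin{pmatrix}w_{11}&\mathbf{w}_{21}'\\ \mathbf{w}_{21}&\mathbf{W}_{22}\end{pmatrix}$ partitioned analogously, the scalar Schur complement of $\mathbf{W}_{22}$ in $\mathbf{W}$ is $$w_{11\cdot 2}=w_{11}-\mathbf{w}_{21}'\mathbf{W}_{22}^{-1}\mathbf{w}_{21}=\mathbf{x}_1'\mathbf{Q}_2\mathbf{x}_1,\qquad \mathbf{Q}_2=\mathbf{I}_n-\mathbf{X}_2(\mathbf{X}_2'\mathbf{X}_2)^{-1}\mathbf{X}_2',$$ and the scaled scalar Schur complement is $\rho=w_{11\cdot 2}/\sigma_{11\cdot 2}$. Define $$\tilde{\mathbf{m}}_1=\mathbf{m}_1-\mathbf{M}_2\boldsymbol{\Sigma}_{22}^{-1}\boldsymbol{\sigma}_{21},\quad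 u=\frac{\tilde{\mathbf{m}}_1'\mathbf{Q}_2\tilde{\mathbf{m}}_1}{\|\tilde{\mathbf{m}}_1\|^2}\in[0,1],\quad \lambda=\frac{\|\tilde{\mathbf{m}}_1\|^2}{\sigma_{11\cdot 2}},\quad \nu=n-p+1.$$ The mixture weights are $\beta_k=\frac{(\lambda/2)^k}{k!}\int_0^1u^ke^{-\lambda u/2}h(u)\,du$, where $h$ is the p.d.f. of $u$; they are the weights in the representation of the p.d.f. of $\rho$ as $\sum_{k\ge 0}\beta_k g_{\nu+2k}(w)$, with $g_m(w)=\frac{1}{2^{m/2}\Gamma(m/2)}w^{m/2-1}e^{-w/2}$, $w>0$, the central chi-square p.d.f. with $m$ degrees of freedom. Special functions: $B(k,l)=\int_0^1t^{k-1}(1-t)^{l-1}dt$ is the beta function; $(x)_0=1$ and $(x)_n=x(x+1)\cdots(x+n-1)$ for $n\ge1$; ${}_1F_1(b;c;w)=\sum_{l=0}^\infty\frac{(b)_l}{(c)_l}\frac{w^l}{l!}$; and the confluent Appell function is $$\Phi_2(b,b';c;w,z)=\sum_{l=0}^\infty\sum_{m=0}^\infty\frac{(b)_l(b')_m}{(c)_{l+m}}\frac{w^lz^m}{l!\,m!}.$$ *)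

theory Defs
  imports "HOL-Probability.Probability"
begin

definition positive_definite :: "real^'k^'k \<Rightarrow> bool" where
  "positive_definite A \<longleftrightarrow> transpose A = A \<and> (\<forall>x. x \<noteq> 0 \<longrightarrow> 0 < x \<bullet> (A *v x))"

definition multivariate_normal_density :: "real^'k \<Rightarrow> real^'k^'k \<Rightarrow> real^'k \<Rightarrow> real" where
  "multivariate_normal_density m S x =
     exp (- (1/2) * ((x - m) \<bullet> (matrix_inv S *v (x - m)))) / sqrt ((2 * pi) ^ CARD('k) * det S)"

definition gaussian_matrix ::
    "'w measure \<Rightarrow> ('w \<Rightarrow> real^'k^'n) \<Rightarrow> real^'k^'n \<Rightarrow> real^'k^'k \<Rightarrow> bool" where
  "gaussian_matrix P X M S \<longleftrightarrow>
     prob_space.indep_vars P (\<lambda>_. borel) (\<lambda>i \<omega>. row i (X \<omega>)) UNIV \<and>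
     (\<forall>i. distributed P lborel (\<lambda>\<omega>. row i (X \<omega>))
            (\<lambda>x. ennreal (multivariate_normal_density (row i M) S x)))"

text \<open>
  Partitioned matrices: an index set of size \<open>p \<ge> 2\<close> with a distinguished first element is
  rendered as the type \<open>'q option\<close>, where \<open>None\<close> is the first index and
  \<open>Some j\<close> are the remaining \<open>p - 1\<close> ones (there is at least one, as types are nonempty).
\<close>

definition first_col :: "real^('q::finite) option^'n \<Rightarrow> real^'n" where
  "first_col X = column None X"

definition rest_cols :: "real^('q::finite) option^'n \<Rightarrow> real^'q^'n" where
  "rest_cols X = (\<chi> i j. X $ i $ Some j)"

definition block11 :: "real^('q::finite) option^'q option \<Rightarrow> real" where
  "block11 S = S $ None $ None"

definition block21 :: "real^('q::finite) option^'q option \<Rightarrow> real^'q" where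
  "block21 S = (\<chi> i. S $ Some i $ None)"

definition block22 :: "real^('q::finite) option^'q option \<Rightarrow> real^'q^'q" where
  "block22 S = (\<chi> i j. S $ Some i $ Some j)"

definition schur_complement :: "real^('q::finite) option^'q option \<Rightarrow> real" where
  "schur_complement S = block11 S - block21 S \<bullet> (matrix_inv (block22 S) *v block21 S)"

definition residual_projection :: "real^'q^'n \<Rightarrow> real^'n^'n" where
  "residual_projection A = mat 1 - A ** matrix_inv (transpose A ** A) ** transpose A"

definition has_pdf :: "'w measure \<Rightarrow> ('w \<Rightarrow> real) \<Rightarrow> (real \<Rightarrow> real) \<Rightarrow> bool" where
  "has_pdf P Y h \<longleftrightarrow> (\<forall>x. 0 \<le> h x) \<and> distributed P lborel Y (\<lambda>x. ennreal (h x))"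

definition mgf :: "'w measure \<Rightarrow> ('w \<Rightarrow> real) \<Rightarrow> real \<Rightarrow> real" where
  "mgf P Y \<theta> = prob_space.expectation P (\<lambda>\<omega>. exp (\<theta> * Y \<omega>))"

definition hyp1F1 :: "real \<Rightarrow> real \<Rightarrow> real \<Rightarrow> real" where
  "hyp1F1 b c w = (\<Sum>l. pochhammer b l / pochhammer c l * (w ^ l / fact l))"

definition appell_Phi2 :: "real \<Rightarrow> real \<Rightarrow> real \<Rightarrow> real \<Rightarrow> real \<Rightarrow> real" where
  "appell_Phi2 b b' c w z =
     (\<Sum>l. \<Sum>m. pochhammer b l * pochhammer b' m / pochhammer c (l + m) *
       (w ^ l * z ^ m / (fact l * fact m)))"

text \<open>
  The noncentrality enters through the second shape parameter:
  \<open>noncentral_beta_density a b t\<close> is the Poisson(\<open>t/2\<close>) mixture over \<open>l\<close> of the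
  Beta(\<open>a\<close>, \<open>b + l\<close>) densities.
\<close>

definition noncentral_beta_density :: "real \<Rightarrow> real \<Rightarrow> real \<Rightarrow> real \<Rightarrow> real" where
  "noncentral_beta_density a b t x =
     (if 0 < x \<and> x < 1
      then exp (- t / 2) * (\<Sum>l. (t / 2) ^ l / fact l *
             (x powr (a - 1) * (1 - x) powr (b + real l - 1) / Beta a (b + real l)))
      else 0)"

text \<open>
  The weights \<open>\<beta>\<^sub>k\<close> for which the density of the scaled Schur complement is
  \<open>\<Sum>k. \<beta>\<^sub>k g\<^bsub>\<nu>+2k\<^esub>\<close>, with \<open>g\<^sub>m\<close> the central chi-square
  density with \<open>m\<close> degrees of freedom; \<open>h\<close> is the density of the variable \<open>u\<close>.
\<close>

definition mixture_weight :: "real \<Rightarrow> (real \<Rightarrow> real) \<Rightarrow> nat \<Rightarrow> real" where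
  "mixture_weight lam h k =
     (lam / 2) ^ k / fact k * (LBINT x:{0..1}. x ^ k * exp (- lam * x / 2) * h x)"

end

theory Submission
  imports Defs
begin

text \<open>
  Write \<open>q = p - 1\<close> and \<open>\<gamma> = \<Sigma>\<^sub>2\<^sub>2\<^sup>-\<^sup>1 \<sigma>\<^sub>2\<^sub>1\<close>. A block triangular square root of \<open>\<Sigma>\<close> turns the Gaussian matrix into
  a standard Gaussian vector \<open>z\<close> and an independent standard Gaussian \<open>n \<times> q\<close> matrix \<open>Z\<close>
  (\<open>partitioned_gaussian_matrix\<close>). Since \<open>M\<close> has rank one, the columns of \<open>M\<^sub>2\<close> are multiples of the unit vector
  \<open>a\<close> in the direction of the mean residual, and the column space of \<open>X\<^sub>2\<close> is that of
  \<open>Y = Z + a c'\<close> with \<open>c \<bullet> c = \<tau>\<close>. So \<open>u = a' Q a\<close>, where \<open>Q\<close> is the projection onto the orthogonal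
  complement of the columns of \<open>Y\<close>; and \<open>x\<^sub>1\<close> is a combination of the columns of \<open>X\<^sub>2\<close> plus a
  Gaussian vector independent of \<open>X\<^sub>2\<close>, so that given \<open>X\<^sub>2\<close> the variable \<open>\<rho>\<close> is noncentral
  chi-square with \<open>\<nu> = n - q\<close> degrees of freedom and noncentrality \<open>\<lambda> u\<close>
  (\<open>nn_integral_exp_residual_form\<close>).

  The law of \<open>u\<close> is found from its moments. Shifting the Gaussian measure by \<open>a c'\<close> costs the factor
  \<open>exp (a \<bullet> Z c - \<tau> / 2)\<close>; expanding the exponential reduces the moments of \<open>u\<close> to the mixed moments
  \<open>E [(a \<bullet> Q a)\<^sup>j (a \<bullet> Z c)\<^sup>2\<^sup>k]\<close> for the central matrix \<open>Z\<close>. By rotation invariance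
  such a moment is the same for all unit vectors \<open>a\<close>, and its integrand is homogeneous of degree \<open>2 (j + k)\<close>
  in \<open>a\<close>. So \<open>a\<close> may be replaced by a Gaussian vector \<open>g\<close> that is independent of \<open>Z\<close>, at the price
  of the factor \<open>E |g|\<^sup>2\<^sup>j\<^sup>+\<^sup>2\<^sup>k\<close>. Given \<open>Z\<close> the variables \<open>g \<bullet> Q g\<close> and
  \<open>g \<bullet> Z c\<close> are independent, because \<open>Q Z = 0\<close>: one is chi-square, the other one normal. This evaluates
  the mixed moment (\<open>nn_integral_residual_mixed_moment\<close>) and gives
  \<open>E u\<^sup>j = exp (- \<tau> / 2) \<Sum>\<^sub>l (\<tau> / 2)\<^sup>l / l! (\<nu> / 2)\<^sub>j / (n / 2 + l)\<^sub>j\<close>. The noncentral beta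
  distribution has the same moments, and a distribution on the unit interval is determined by its moments.

  All remaining formulas express \<open>E [u\<^sup>k exp (v u)]\<close> through these moments: expanding the
  exponential gives a double series over the power of \<open>v\<close> and the Poisson index \<open>l\<close>. Summed in one order it is
  the confluent Appell function, in the other one the series of \<open>\<^sub>1F\<^sub>1\<close> values
  (\<open>exp_moment_hyp1F1\<close>, \<open>exp_moment_Phi2\<close>).
\<close>

section \<open>Translation-invariant measures\<close>

text \<open>
  Both sides are the integral of \<open>indicator E x * indicator F (x + y)\<close> with respect to the product of the two
  measures: integrating over \<open>y\<close> first uses the invariance of Lebesgue measure, integrating over \<open>x\<close>
  first uses that of \<open>M\<close> and, to pass from \<open>E - y\<close> to \<open>E\<close>, the reflection symmetry of Lebesgue measure.
  This is the uniqueness of Haar measure in a form without normalization; it serves to find the image of Lebesgue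
  measure under linear bijections between arbitrary Euclidean spaces.
\<close>

lemma translation_invariant_measure_unique:
  fixes M :: "'a::euclidean_space measure"
  assumes sig: "sigma_finite_measure M" and sets[measurable_cong, simp]: "sets M = sets borel"
    and inv: "\<And>c. distr M borel (\<lambda>x. x + c) = M"
    and E[measurable]: "E \<in> sets borel" and F[measurable]: "F \<in> sets borel"
  shows "emeasure M E * emeasure lborel F = emeasure lborel E * emeasure M F"
proof -
  interpret M: sigma_finite_measure M by (rule sig)
  interpret pair_sigma_finite lborel M by standard
  have neg: "(\<integral>\<^sup>+y. f y \<partial>lborel) = (\<integral>\<^sup>+y. f (c - y) \<partial>lborel)"
    if [measurable]: "f \<in> borel_measurable borel" for f :: "'a \<Rightarrow> ennreal" and c
  proof -
    have "lborel = distr lborel borel (\<lambda>y. c - y)"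
      using lborel_affine[of "-1" c] by (simp add: density_1)
    then have "(\<integral>\<^sup>+y. f y \<partial>lborel) = (\<integral>\<^sup>+y. f y \<partial>distr lborel borel (\<lambda>y. c - y))"
      by simp
    then show ?thesis by (simp add: nn_integral_distr)
  qed
  have tr: "(\<integral>\<^sup>+y. f y \<partial>lborel) = (\<integral>\<^sup>+y. f (c + y) \<partial>lborel)"
    if [measurable]: "f \<in> borel_measurable borel" for f :: "'a \<Rightarrow> ennreal" and c
    by (subst lborel_distr_plus[of c, symmetric]) (simp add: nn_integral_distr)
  have trM: "(\<integral>\<^sup>+x. f x \<partial>M) = (\<integral>\<^sup>+x. f (x + c) \<partial>M)"
    if [measurable]: "f \<in> borel_measurable borel" for f :: "'a \<Rightarrow> ennreal" and c
    by (subst inv[of c, symmetric]) (simp add: nn_integral_distr)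
  have "emeasure M E * emeasure lborel F
      = (\<integral>\<^sup>+x. indicator E x * (\<integral>\<^sup>+y. indicator F y \<partial>lborel) \<partial>M)"
    by (simp add: nn_integral_multc mult.commute)
  also have "\<dots> = (\<integral>\<^sup>+x. indicator E x * (\<integral>\<^sup>+y. indicator F (x + y) \<partial>lborel) \<partial>M)"
    using tr[of "indicator F"] by simp
  also have "\<dots> = (\<integral>\<^sup>+x. (\<integral>\<^sup>+y. indicator E x * indicator F (x + y) \<partial>lborel) \<partial>M)"
    by (simp add: nn_integral_cmult)
  also have "\<dots> = (\<integral>\<^sup>+y. (\<integral>\<^sup>+x. indicator E x * indicator F (x + y) \<partial>M) \<partial>lborel)"
    by (rule Fubini') measurable
  also have "\<dots> = (\<integral>\<^sup>+y. (\<integral>\<^sup>+x. indicator E (x - y) * indicator F x \<partial>M) \<partial>lborel)"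
  proof (rule nn_integral_cong)
    fix y
    show "(\<integral>\<^sup>+x. indicator E x * indicator F (x + y) \<partial>M) = (\<integral>\<^sup>+x. indicator E (x - y) * indicator F x \<partial>M)"
      by (subst (2) trM[of _ y]) simp_all
  qed
  also have "\<dots> = (\<integral>\<^sup>+x. (\<integral>\<^sup>+y. indicator E (x - y) * indicator F x \<partial>lborel) \<partial>M)"
    by (rule Fubini'[symmetric]) measurable
  also have "\<dots> = (\<integral>\<^sup>+x. (\<integral>\<^sup>+y. indicator E (x - y) \<partial>lborel) * indicator F x \<partial>M)"
    by (simp add: nn_integral_multc)
  also have "\<dots> = (\<integral>\<^sup>+x. (\<integral>\<^sup>+y. indicator E y \<partial>lborel) * indicator F x \<partial>M)"
    by (subst neg[symmetric]) simp_all
  also have "\<dots> = emeasure lborel E * emeasure M F"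
    by (simp add: nn_integral_cmult)
  finally show ?thesis .
qed

lemma linear_measurable [measurable]:
  fixes T :: "'a::euclidean_space \<Rightarrow> 'b::euclidean_space"
  shows "linear T \<Longrightarrow> T \<in> borel_measurable borel"
  by (intro borel_measurable_continuous_onI linear_continuous_on) (simp add: linear_conv_bounded_linear)

lemma distr_lborel_linear_proportional:
  fixes T :: "'a::euclidean_space \<Rightarrow> 'b::euclidean_space"
  assumes T: "linear T" "bij T" and E: "E \<in> sets borel" and F: "F \<in> sets borel"
  shows "emeasure (distr lborel borel T) E * emeasure lborel F
    = emeasure lborel E * emeasure (distr lborel borel T) F"
proof (rule translation_invariant_measure_unique[OF _ _ _ E F])
  have [measurable]: "T \<in> borel_measurable borel" using T by measurable
  obtain S where S: "linear S" "\<And>x. S (T x) = x"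
    using linear_injective_left_inverse[OF T(1)] T(2) by (auto simp: bij_is_inj fun_eq_iff)
  then have TS: "T (S x) = x" for x
    using T(2) by (metis bij_pointE)
  have [measurable]: "S \<in> borel_measurable borel" using S(1) by measurable
  show "sets (distr lborel borel T) = sets borel" by simp
  show "distr (distr lborel borel T) borel (\<lambda>x. x + c) = distr lborel borel T" for c
  proof -
    have "distr (distr lborel borel T) borel (\<lambda>x. x + c) = distr lborel borel (\<lambda>x. T (S c + x))"
      by (subst distr_distr) (simp_all add: o_def linear_add[OF T(1)] TS add.commute)
    also have "\<dots> = distr (distr lborel borel ((+) (S c))) borel T"
      by (subst distr_distr) (simp_all add: o_def)
    finally show ?thesis by (simp add: lborel_distr_plus)
  qed
  show "sigma_finite_measure (distr lborel borel T)"
  proof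
    \<comment> \<open>sigma-finiteness: the sets \<open>S -` box (- n) n\<close> have boxes as their preimages under \<open>T\<close>\<close>
    let ?A = "\<lambda>n::nat. S -` box (- real n *\<^sub>R One) (real n *\<^sub>R One)"
    have A: "?A n \<in> sets borel" for n
      using measurable_sets[of S borel borel "box (- real n *\<^sub>R One) (real n *\<^sub>R One)"] by simp
    have "emeasure (distr lborel borel T) (?A n) \<noteq> \<infinity>" for n
    proof -
      have "T -` ?A n = box (- real n *\<^sub>R One) (real n *\<^sub>R One)" using S by auto
      then show ?thesis
        using A[of n] by (subst emeasure_distr) (auto simp: emeasure_lborel_box_eq)
    qed
    moreover have "(\<Union>n. ?A n) = UNIV" by (simp add: UN_box_eq_UNIV flip: vimage_UN)
    ultimately show "\<exists>A. countable A \<and> A \<subseteq> sets (distr lborel borel T) \<and>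
        \<Union>A = space (distr lborel borel T) \<and> (\<forall>a\<in>A. emeasure (distr lborel borel T) a \<noteq> \<infinity>)"
      by (intro exI[of _ "range ?A"]) (use A in auto)
  qed
qed

section \<open>The standard Gaussian measure on a Euclidean space\<close>

definition std_gauss :: "'a::euclidean_space measure" where
  "std_gauss = density lborel (\<lambda>x. ennreal (exp (- (x \<bullet> x) / 2) / sqrt (2 * pi) ^ DIM('a)))"

lemma sets_std_gauss [simp, measurable_cong]: "sets std_gauss = sets borel"
  by (simp add: std_gauss_def)

lemma measurable_std_gauss [simp]: "measurable std_gauss N = measurable borel N"
  by (rule measurable_cong_sets) simp_all

lemma space_std_gauss [simp]: "space std_gauss = UNIV"
  by (simp add: std_gauss_def)

lemma nn_integral_std_gauss:
  fixes f :: "'a::euclidean_space \<Rightarrow> ennreal"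
  assumes "f \<in> borel_measurable borel"
  shows "(\<integral>\<^sup>+x. f x \<partial>std_gauss)
    = (\<integral>\<^sup>+x. ennreal (exp (- (x \<bullet> x) / 2) / sqrt (2 * pi) ^ DIM('a)) * f x \<partial>lborel)"
  unfolding std_gauss_def using assms by (subst nn_integral_density) simp_all

lemma std_gauss_density_eq_prod:
  fixes x :: "'a::euclidean_space"
  shows "exp (- (x \<bullet> x) / 2) / sqrt (2 * pi) ^ DIM('a) = (\<Prod>b\<in>Basis. std_normal_density (x \<bullet> b))"
proof -
  have "x \<bullet> x = (\<Sum>b\<in>Basis. (x \<bullet> b)\<^sup>2)"
    by (subst euclidean_inner) (simp add: power2_eq_square)
  then show ?thesis
    by (simp add: std_normal_density_def prod.distrib exp_sum[symmetric] sum_divide_distrib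
        sum_negf power_divide prod_dividef)
qed

lemma std_gauss_real: "(std_gauss :: real measure) = density lborel (\<lambda>t. ennreal (std_normal_density t))"
  unfolding std_gauss_def by (simp add: std_normal_density_def power2_eq_square)

lemma nn_integral_std_gauss_prod:
  fixes h :: "'a::euclidean_space \<Rightarrow> real \<Rightarrow> ennreal"
  assumes h[measurable]: "\<And>b. b \<in> Basis \<Longrightarrow> h b \<in> borel_measurable borel"
  shows "(\<integral>\<^sup>+x. (\<Prod>b\<in>Basis. h b (x \<bullet> b)) \<partial>std_gauss) = (\<Prod>b\<in>Basis. \<integral>\<^sup>+t. h b t \<partial>std_gauss)"
proof -
  have "(\<integral>\<^sup>+x. (\<Prod>b\<in>Basis. h b (x \<bullet> b)) \<partial>std_gauss)
      = (\<integral>\<^sup>+x. (\<Prod>b\<in>Basis. ennreal (std_normal_density (x \<bullet> b)) * h b (x \<bullet> b)) \<partial>lborel)"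
    by (subst nn_integral_std_gauss)
      (simp_all only: std_gauss_density_eq_prod, simp_all add: prod.distrib prod_ennreal)
  also have "\<dots> = (\<Prod>b\<in>Basis. \<integral>\<^sup>+t. ennreal (std_normal_density t) * h b t \<partial>lborel)"
    by (intro nn_integral_lborel_prod) simp_all
  also have "\<dots> = (\<Prod>b\<in>Basis. \<integral>\<^sup>+t. h b t \<partial>std_gauss)"
    by (intro prod.cong refl) (simp add: std_gauss_real nn_integral_density)
  finally show ?thesis .
qed

lemma prob_space_std_gauss: "prob_space (std_gauss :: 'a::euclidean_space measure)"
proof
  have 1: "emeasure (std_gauss::real measure) UNIV = 1"
    using prob_space.emeasure_space_1[OF prob_space_normal_density[of 1 0]]
    by (simp add: std_gauss_real)
  show "emeasure (std_gauss :: 'a measure) (space std_gauss) = 1"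
    using nn_integral_std_gauss_prod[of "\<lambda>_::'a. \<lambda>_. 1"] 1 by simp
qed

lemma std_gauss_absolutely_continuous:
  "AE x in lborel. P x \<Longrightarrow> AE x in std_gauss. P x"
  unfolding std_gauss_def by (subst AE_density) auto

text \<open>
  The image measure is proportional to Lebesgue measure, and the unit ball, whose preimage is the unit ball of the
  other space, shows that the constant is 1. Domain and range may be different types, so the lemma covers rotations as
  well as mere regroupings of coordinates.
\<close>

lemma distr_lborel_isometry:
  fixes T :: "'a::euclidean_space \<Rightarrow> 'b::euclidean_space"
  assumes T: "linear T" "bij T" and norm: "\<And>x. norm (T x) = norm x"
  shows "distr lborel borel T = lborel"
proof (rule measure_eqI)
  have [measurable]: "T \<in> borel_measurable borel" using T by measurable
  have dim: "DIM('a) = DIM('b)"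
    using dim_image_eq[OF T(1), of UNIV] T by (simp add: bij_is_inj bij_is_surj dim_UNIV)
  fix E assume "E \<in> sets (distr lborel borel T)"
  then have E: "E \<in> sets borel" by simp
  have "T -` ball 0 1 = ball 0 1" by (auto simp: norm)
  then have b: "emeasure (distr lborel borel T) (ball 0 1) = emeasure lborel (ball (0::'b) 1)"
    by (simp add: emeasure_distr emeasure_ball dim)
  define c where "c = emeasure lborel (ball (0::'b) 1)"
  have c: "c \<noteq> 0" "c \<noteq> \<top>"
    using unit_ball_vol_pos[of "real DIM('b)"] by (simp_all add: c_def emeasure_ball del: unit_ball_vol_pos)
  have "emeasure (distr lborel borel T) E * c = emeasure lborel E * c"
    using distr_lborel_linear_proportional[OF T E, of "ball 0 1", unfolded b] by (simp add: c_def)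
  then show "emeasure (distr lborel borel T) E = emeasure lborel E"
    using mult_divide_eq_ennreal[OF c] by metis
qed simp

lemma distr_std_gauss_isometry:
  fixes T :: "'a::euclidean_space \<Rightarrow> 'b::euclidean_space"
  assumes T: "linear T" "bij T" and norm: "\<And>x. norm (T x) = norm x"
  shows "distr std_gauss borel T = std_gauss"
proof (rule measure_eqI)
  have [measurable]: "T \<in> borel_measurable borel" using T by measurable
  have dim: "DIM('a) = DIM('b)"
    using dim_image_eq[OF T(1), of UNIV] T by (simp add: bij_is_inj bij_is_surj dim_UNIV)
  have ip: "T x \<bullet> T x = x \<bullet> x" for x using norm[of x] by (simp add: norm_eq_sqrt_inner)
  fix E assume "E \<in> sets (distr std_gauss borel T)"
  then have E[measurable]: "E \<in> sets borel" by simp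
  have "emeasure (distr std_gauss borel T) E = (\<integral>\<^sup>+x. indicator E (T x) \<partial>std_gauss)"
    using nn_integral_distr[of T std_gauss borel "indicator E"]
    by (simp only: nn_integral_indicator measurable_std_gauss sets_distr) measurable
  also have "\<dots> = (\<integral>\<^sup>+y. ennreal (exp (- (y \<bullet> y) / 2) / sqrt (2 * pi) ^ DIM('b)) * indicator E y
        \<partial>distr lborel borel T)"
    by (subst nn_integral_std_gauss) (simp_all add: nn_integral_distr ip dim)
  also have "\<dots> = emeasure std_gauss E"
    by (simp add: distr_lborel_isometry[OF assms] nn_integral_std_gauss flip: nn_integral_indicator)
  finally show "emeasure (distr std_gauss borel T) E = emeasure std_gauss E" .
qed simp

lemma nn_integral_std_gauss_isometry:
  fixes T :: "'a::euclidean_space \<Rightarrow> 'b::euclidean_space"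
  assumes "linear T" "bij T" "\<And>x. norm (T x) = norm x" and "f \<in> borel_measurable borel"
  shows "(\<integral>\<^sup>+x. f (T x) \<partial>std_gauss) = (\<integral>\<^sup>+y. f y \<partial>std_gauss)"
  using nn_integral_distr[of T std_gauss borel f] linear_measurable[OF assms(1)] assms(4)
  by (simp add: distr_std_gauss_isometry[OF assms(1-3)])

lemma std_gauss_pair:
  "(std_gauss :: 'a::euclidean_space measure) \<Otimes>\<^sub>M (std_gauss :: 'b::euclidean_space measure) = std_gauss"
proof -
  interpret prob_space "std_gauss :: 'b measure" by (rule prob_space_std_gauss)
  have "sigma_finite_measure (std_gauss :: 'b measure)" ..
  then show ?thesis
    unfolding std_gauss_def
    by (subst pair_measure_density)
       (auto simp: sigma_finite_lborel lborel_prod fun_eq_iff inner_Pair mult_exp_exp power_add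
          field_simps simp flip: ennreal_mult intro!: arg_cong2[where f=density] arg_cong[where f=ennreal])
qed

text \<open>
  The Cameron--Martin formula: the quotient of the densities at \<open>x - c\<close> and \<open>x\<close> is
  \<open>exp (c \<bullet> x - c \<bullet> c / 2)\<close>.
\<close>

lemma nn_integral_std_gauss_shift:
  fixes c :: "'a::euclidean_space"
  assumes [measurable]: "f \<in> borel_measurable borel"
  shows "(\<integral>\<^sup>+x. f (x + c) \<partial>std_gauss) = (\<integral>\<^sup>+x. f x * ennreal (exp (c \<bullet> x - c \<bullet> c / 2)) \<partial>std_gauss)"
proof -
  let ?d = "\<lambda>x::'a. ennreal (exp (- (x \<bullet> x) / 2) / sqrt (2 * pi) ^ DIM('a))"
  have "(\<integral>\<^sup>+x. f (x + c) \<partial>std_gauss) = (\<integral>\<^sup>+x. ?d (c + x - c) * f (c + x) \<partial>lborel)"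
    by (subst nn_integral_std_gauss) (simp_all add: add.commute)
  also have "\<dots> = (\<integral>\<^sup>+x. ?d (x - c) * f x \<partial>distr lborel borel ((+) c))"
    by (subst nn_integral_distr) simp_all
  also have "\<dots> = (\<integral>\<^sup>+x. ?d x * (f x * ennreal (exp (c \<bullet> x - c \<bullet> c / 2))) \<partial>lborel)"
    unfolding lborel_distr_plus
  proof (intro nn_integral_cong)
    fix x
    have "exp (- ((x - c) \<bullet> (x - c)) / 2) = exp (- (x \<bullet> x) / 2) * exp (c \<bullet> x - c \<bullet> c / 2)"
      by (simp add: mult_exp_exp inner_diff inner_commute field_simps)
    then have "?d (x - c) = ?d x * ennreal (exp (c \<bullet> x - c \<bullet> c / 2))"
      by (simp flip: ennreal_mult)
    then show "?d (x - c) * f x = ?d x * (f x * ennreal (exp (c \<bullet> x - c \<bullet> c / 2)))"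
      by (simp add: mult_ac)
  qed
  also have "\<dots> = (\<integral>\<^sup>+x. f x * ennreal (exp (c \<bullet> x - c \<bullet> c / 2)) \<partial>std_gauss)"
    by (subst nn_integral_std_gauss) simp_all
  finally show ?thesis .
qed

lemma linear_isometry_bij:
  fixes T :: "'a::euclidean_space \<Rightarrow> 'a"
  assumes "linear T" "\<And>x. norm (T x) = norm x"
  shows "bij T"
proof -
  have "inj T" using assms by (metis linear_injective_0 norm_eq_zero)
  then show ?thesis using assms(1) linear_injective_imp_surjective by (auto simp: bij_def)
qed

lemma orthonormal_basis_extension:
  fixes B :: "'a::euclidean_space set"
  assumes B: "pairwise orthogonal B" "\<And>b. b \<in> B \<Longrightarrow> norm b = 1"
  obtains C where "B \<subseteq> C" "finite C" "pairwise orthogonal C" "\<And>b. b \<in> C \<Longrightarrow> norm b = 1"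
    "card C = DIM('a)" "span C = UNIV"
proof -
  define S where "S = {y \<in> UNIV. \<forall>x \<in> span B. orthogonal x y}"
  have "subspace S" unfolding S_def
    by (auto simp: subspace_def orthogonal_clauses)
  then obtain D where D: "D \<subseteq> S" "pairwise orthogonal D" "\<And>x. x \<in> D \<Longrightarrow> norm x = 1"
    "independent D" "card D = dim S" "span D = S"
    using orthonormal_basis_subspace by metis
  have BD: "orthogonal b d" "orthogonal d b" if "b \<in> B" "d \<in> D" for b d
    using that D(1) span_base[of b B] by (auto simp: S_def orthogonal_commute)
  have 0: "0 \<notin> B" using B(2) by force
  have indB: "independent B" by (intro pairwise_orthogonal_independent B 0)
  have disj: "B \<inter> D = {}"
    using BD B(2) by (force simp: orthogonal_def)
  have fin: "finite B" "finite D" using indB D(4) by (auto intro: independent_imp_finite)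
  have "dim S + dim (span B) = dim (UNIV::'a set)"
    unfolding S_def by (rule dim_subspace_orthogonal_to_vectors) auto
  then have card: "card (B \<union> D) = DIM('a)"
    using disj fin D(5) dim_eq_card_independent[OF indB] by (simp add: card_Un_disjoint)
  have orth: "pairwise orthogonal (B \<union> D)"
    using B D(2) BD unfolding pairwise_def by auto
  have nrm: "norm b = 1" if "b \<in> B \<union> D" for b using that B(2) D(3) by auto
  have "independent (B \<union> D)"
    using orth nrm by (intro pairwise_orthogonal_independent) force+
  then have "span (B \<union> D) = UNIV"
    using card card_eq_dim[of "B \<union> D" UNIV] fin by auto
  with that[of "B \<union> D"] fin orth nrm card show ?thesis by blast
qed

text \<open>
  The coordinates of a standard Gaussian vector along any orthonormal set are independent standard normal variables.
  The set is completed to an orthonormal basis, which a rotation \<open>T\<close> maps to the standard basis; the vectors added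
  receive the constant function 1.
\<close>

lemma nn_integral_std_gauss_orthonormal:
  fixes B :: "'a::euclidean_space set" and h :: "'a \<Rightarrow> real \<Rightarrow> ennreal"
  assumes B: "pairwise orthogonal B" "\<And>b. b \<in> B \<Longrightarrow> norm b = 1"
    and h[measurable]: "\<And>b. b \<in> B \<Longrightarrow> h b \<in> borel_measurable borel"
  shows "(\<integral>\<^sup>+x. (\<Prod>b\<in>B. h b (b \<bullet> x)) \<partial>std_gauss) = (\<Prod>b\<in>B. \<integral>\<^sup>+t. h b t \<partial>std_gauss)"
proof -
  obtain C where C: "B \<subseteq> C" "finite C" "pairwise orthogonal C" "\<And>b. b \<in> C \<Longrightarrow> norm b = 1"
    "card C = DIM('a)" "span C = UNIV"
    using orthonormal_basis_extension[OF B] by metis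
  obtain \<phi> where \<phi>: "bij_betw \<phi> (Basis::'a set) C"
    using finite_same_card_bij[of "Basis::'a set" C] C by auto
  define T where "T x = (\<Sum>b\<in>Basis. (x \<bullet> \<phi> b) *\<^sub>R b)" for x
  have Tb: "T x \<bullet> b = x \<bullet> \<phi> b" if "b \<in> Basis" for x b
    using that by (simp add: T_def inner_sum_left_Basis)
  have lin: "linear T" unfolding T_def
    by (rule linearI) (simp_all add: inner_add_left scaleR_add_left sum.distrib scaleR_sum_right)
  have nrm: "norm (T x) = norm x" for x
  proof -
    have x: "(\<Sum>i\<in>C. (x \<bullet> i) *\<^sub>R i) = x"
      using orthonormal_basis_expand[OF C(3,4), of x] C(2,6) by auto
    have "T x \<bullet> T x = (\<Sum>b\<in>Basis. (x \<bullet> \<phi> b) * (x \<bullet> \<phi> b))"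
      by (subst euclidean_inner) (simp add: Tb)
    also have "\<dots> = (\<Sum>c\<in>C. (x \<bullet> c) * (x \<bullet> c))"
      using \<phi> by (rule sum.reindex_bij_betw)
    also have "\<dots> = x \<bullet> (\<Sum>i\<in>C. (x \<bullet> i) *\<^sub>R i)" by (simp add: inner_sum_right)
    finally show ?thesis by (simp add: x norm_eq_sqrt_inner)
  qed
  have "bij T" by (rule linear_isometry_bij[OF lin nrm])
  define h' where "h' b = (if b \<in> B then h b else (\<lambda>_. 1))" for b
  have [measurable]: "h' b \<in> borel_measurable borel" for b by (simp add: h'_def)
  have one: "(\<integral>\<^sup>+t. (1::ennreal) \<partial>(std_gauss :: real measure)) = 1"
    using prob_space.emeasure_space_1[OF prob_space_std_gauss] by simp
  have "(\<integral>\<^sup>+x. (\<Prod>b\<in>B. h b (b \<bullet> x)) \<partial>std_gauss) = (\<integral>\<^sup>+x. (\<Prod>c\<in>C. h' c (x \<bullet> c)) \<partial>std_gauss)"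
  proof (rule nn_integral_cong)
    fix x
    show "(\<Prod>b\<in>B. h b (b \<bullet> x)) = (\<Prod>c\<in>C. h' c (x \<bullet> c))"
      by (rule prod.mono_neutral_cong_left) (use C in \<open>auto simp: h'_def inner_commute\<close>)
  qed
  also have "\<dots> = (\<integral>\<^sup>+x. (\<Prod>b\<in>Basis. h' (\<phi> b) (T x \<bullet> b)) \<partial>std_gauss)"
    by (simp add: Tb prod.reindex_bij_betw[OF \<phi>, of "\<lambda>c. h' c (_ \<bullet> c)"])
  also have "\<dots> = (\<integral>\<^sup>+y. (\<Prod>b\<in>Basis. h' (\<phi> b) (y \<bullet> b)) \<partial>std_gauss)"
    by (rule nn_integral_std_gauss_isometry[OF lin \<open>bij T\<close> nrm]) measurable
  also have "\<dots> = (\<Prod>b\<in>Basis. \<integral>\<^sup>+t. h' (\<phi> b) t \<partial>std_gauss)"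
    by (rule nn_integral_std_gauss_prod) simp
  also have "\<dots> = (\<Prod>c\<in>C. \<integral>\<^sup>+t. h' c t \<partial>std_gauss)"
    using \<phi> by (rule prod.reindex_bij_betw)
  also have "\<dots> = (\<Prod>b\<in>B. \<integral>\<^sup>+t. h b t \<partial>std_gauss)"
    by (rule prod.mono_neutral_cong_right) (use C one in \<open>auto simp: h'_def\<close>)
  finally show ?thesis .
qed

section \<open>Gaussian moments\<close>

text \<open>
  Gaussian moments are read off from exponential integrals by comparing coefficients of power series.
\<close>

lemma powser_coeff_unique:
  fixes a b :: "nat \<Rightarrow> real"
  assumes r: "0 < r"
    and a: "\<And>t. \<bar>t\<bar> < r \<Longrightarrow> (\<lambda>m. a m * t ^ m) sums f t"
    and b: "\<And>t. \<bar>t\<bar> < r \<Longrightarrow> (\<lambda>m. b m * t ^ m) sums f t"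
  shows "a m = b m"
proof -
  have c0: "c 0 = (0::real)" if "\<And>t. t \<noteq> 0 \<Longrightarrow> \<bar>t\<bar> < r \<Longrightarrow> (\<lambda>m. c m * t ^ m) sums 0" for c
  proof -
    have "((\<lambda>x. 0) \<longlongrightarrow> c 0) (at (0::real))"
      using that by (intro powser_limit_0_strong[OF r]) auto
    then show ?thesis by (simp add: tendsto_const_iff)
  qed
  have *: "(\<And>t. t \<noteq> 0 \<Longrightarrow> \<bar>t\<bar> < r \<Longrightarrow> (\<lambda>m. c m * t ^ m) sums 0) \<Longrightarrow> c m = (0::real)" for c m
  proof (induction m arbitrary: c)
    case 0
    then show ?case by (rule c0)
  next
    case (Suc m)
    have "(\<lambda>m. c (Suc m) * t ^ m) sums 0" if "t \<noteq> 0" "\<bar>t\<bar> < r" for t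
    proof -
      have "(\<lambda>m. c (Suc m) * t ^ Suc m) sums 0"
        using Suc.prems[OF that] sums_Suc_iff[of "\<lambda>m. c m * t ^ m" 0] c0[OF Suc.prems] by simp
      from sums_mult[OF this, of "1 / t"] show ?thesis using that by (simp add: field_simps)
    qed
    from Suc.IH[of "\<lambda>m. c (Suc m)", OF this] show ?case by simp
  qed
  have "a m - b m = 0"
  proof (rule *[of "\<lambda>m. a m - b m"])
    fix t :: real assume "\<bar>t\<bar> < r"
    from sums_diff[OF a[OF this] b[OF this]] show "(\<lambda>m. (a m - b m) * t ^ m) sums 0"
      by (simp add: algebra_simps)
  qed
  then show ?thesis by simp
qed

text \<open>
  The exponential series may be integrated termwise, with the integrable function
  \<open>\<bar>\<phi>\<bar> * exp \<bar>\<psi>\<bar>\<close> dominating all partial sums.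
\<close>

lemma
  fixes \<phi> \<psi> :: "'x \<Rightarrow> real"
  assumes [measurable]: "\<phi> \<in> borel_measurable M" "\<psi> \<in> borel_measurable M"
    and int: "integrable M (\<lambda>x. \<phi> x * exp \<bar>\<psi> x\<bar>)"
  shows integrable_mult_power_of_exp: "integrable M (\<lambda>x. \<phi> x * \<psi> x ^ m)"
    and integral_mult_exp_sums: "(\<lambda>m. (\<integral>x. \<phi> x * \<psi> x ^ m \<partial>M) / fact m) sums (\<integral>x. \<phi> x * exp (\<psi> x) \<partial>M)"
proof -
  have abs: "integrable M (\<lambda>x. \<bar>\<phi> x\<bar> * exp \<bar>\<psi> x\<bar>)"
    using integrable_abs[OF int] by (simp add: abs_mult)
  have pe: "y ^ m / fact m \<le> exp y" if "0 \<le> y" for y :: real and m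
  proof -
    have "(\<Sum>k\<in>{m}. y ^ k /\<^sub>R fact k) \<le> (\<Sum>k. y ^ k /\<^sub>R fact k)"
      using that by (intro sum_le_suminf summable_exp_generic) auto
    then show ?thesis by (simp add: exp_def field_simps)
  qed
  have i: "integrable M (\<lambda>x. \<phi> x * \<psi> x ^ m / fact m)" for m
  proof (rule Bochner_Integration.integrable_bound[OF abs])
    show "AE x in M. norm (\<phi> x * \<psi> x ^ m / fact m) \<le> norm (\<bar>\<phi> x\<bar> * exp \<bar>\<psi> x\<bar>)"
      using pe[of "\<bar>\<psi> _\<bar>" m] by (intro AE_I2) (simp add: abs_mult power_abs mult_left_mono flip: times_divide_eq_right)
  qed simp
  from integrable_mult_right[OF this[of m], of "fact m"]
  show "integrable M (\<lambda>x. \<phi> x * \<psi> x ^ m)" by simp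
  have ex: "(\<lambda>m. \<phi> x * \<psi> x ^ m / fact m) sums (\<phi> x * exp (\<psi> x))" for x
    using sums_mult[OF exp_converges[of "\<psi> x"], of "\<phi> x"] by (simp add: field_simps)
  have exa: "(\<lambda>m. norm (\<phi> x * \<psi> x ^ m / fact m)) sums (\<bar>\<phi> x\<bar> * exp \<bar>\<psi> x\<bar>)" for x
    using sums_mult[OF exp_converges[of "\<bar>\<psi> x\<bar>"], of "\<bar>\<phi> x\<bar>"]
    by (simp add: abs_mult power_abs field_simps)
  have summ: "summable (\<lambda>m. \<integral>x. norm (\<phi> x * \<psi> x ^ m / fact m) \<partial>M)"
  proof (rule summableI_nonneg_bounded)
    fix N
    have "(\<Sum>m<N. \<integral>x. norm (\<phi> x * \<psi> x ^ m / fact m) \<partial>M) = (\<integral>x. (\<Sum>m<N. norm (\<phi> x * \<psi> x ^ m / fact m)) \<partial>M)"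
      by (rule Bochner_Integration.integral_sum[symmetric]) (rule integrable_norm[OF i])
    also have "\<dots> \<le> (\<integral>x. \<bar>\<phi> x\<bar> * exp \<bar>\<psi> x\<bar> \<partial>M)"
    proof (rule integral_mono)
      show "(\<Sum>m<N. norm (\<phi> x * \<psi> x ^ m / fact m)) \<le> \<bar>\<phi> x\<bar> * exp \<bar>\<psi> x\<bar>" for x
        unfolding sums_unique[OF exa] using exa[of x] by (intro sum_le_suminf) (auto simp: sums_iff)
    qed (intro Bochner_Integration.integrable_sum integrable_norm[OF i] abs)+
    finally show "(\<Sum>m<N. \<integral>x. norm (\<phi> x * \<psi> x ^ m / fact m) \<partial>M) \<le> (\<integral>x. \<bar>\<phi> x\<bar> * exp \<bar>\<psi> x\<bar> \<partial>M)" .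
  qed simp
  have "(\<lambda>m. \<integral>x. \<phi> x * \<psi> x ^ m / fact m \<partial>M) sums (\<integral>x. (\<Sum>m. \<phi> x * \<psi> x ^ m / fact m) \<partial>M)"
    using exa by (intro sums_integral i summ AE_I2) (auto simp: sums_iff)
  also have "(\<lambda>x. \<Sum>m. \<phi> x * \<psi> x ^ m / fact m) = (\<lambda>x. \<phi> x * exp (\<psi> x))"
    using ex by (auto simp: sums_iff)
  finally show "(\<lambda>m. (\<integral>x. \<phi> x * \<psi> x ^ m \<partial>M) / fact m) sums (\<integral>x. \<phi> x * exp (\<psi> x) \<partial>M)"
    by simp
qed

lemma nn_integral_std_gauss_exp_square:
  fixes \<theta> \<mu> :: real
  assumes "\<theta> < 1 / 2"
  shows "(\<integral>\<^sup>+t. ennreal (exp (\<theta> * (t + \<mu>)\<^sup>2)) \<partial>std_gauss)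
    = ennreal ((1 - 2 * \<theta>) powr (- 1 / 2) * exp (\<theta> / (1 - 2 * \<theta>) * \<mu>\<^sup>2))"
proof -
  \<comment> \<open>completing the square turns the integrand into a multiple of a normal density with variance \<open>\<sigma>\<^sup>2 = 1 / (1 - 2 * \<theta>)\<close>\<close>
  define s where "s = 1 - 2 * \<theta>"
  define \<sigma> where "\<sigma> = 1 / sqrt s"
  define m where "m = 2 * \<theta> * \<mu> / s"
  define K where "K = \<sigma> * exp (\<theta> / s * \<mu>\<^sup>2)"
  have s: "s > 0" and th: "\<theta> = (1 - s) / 2" using assms by (simp_all add: s_def)
  have \<sigma>: "\<sigma> > 0" "\<sigma>\<^sup>2 = 1 / s" using s by (simp_all add: \<sigma>_def power_divide)
  have sq: "sqrt (2 * pi * \<sigma>\<^sup>2) = sqrt (2 * pi) * \<sigma>" using \<sigma>(1) by (simp add: real_sqrt_mult)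
  have ex: "\<theta> * (t + \<mu>)\<^sup>2 - t\<^sup>2 / 2 = \<theta> / s * \<mu>\<^sup>2 - (t - m)\<^sup>2 / (2 * \<sigma>\<^sup>2)" for t
    using s unfolding \<sigma>(2) m_def th by (simp add: field_simps power2_eq_square)
  have d: "std_normal_density t * exp (\<theta> * (t + \<mu>)\<^sup>2) = K * normal_density m \<sigma> t" for t
  proof -
    have "exp (- t\<^sup>2 / 2) * exp (\<theta> * (t + \<mu>)\<^sup>2) = exp (\<theta> / s * \<mu>\<^sup>2) * exp (- (t - m)\<^sup>2 / (2 * \<sigma>\<^sup>2))"
      using ex[of t] by (simp add: mult_exp_exp)
    then show ?thesis
      using \<sigma>(1) unfolding std_normal_density_def normal_density_def sq K_def by (simp add: field_simps)
  qed
  have "(\<integral>\<^sup>+t. ennreal (exp (\<theta> * (t + \<mu>)\<^sup>2)) \<partial>std_gauss)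
      = (\<integral>\<^sup>+t. ennreal (std_normal_density t * exp (\<theta> * (t + \<mu>)\<^sup>2)) \<partial>lborel)"
    by (simp add: std_gauss_real nn_integral_density ennreal_mult)
  also have "\<dots> = ennreal K * (\<integral>\<^sup>+t. ennreal (normal_density m \<sigma> t) \<partial>lborel)"
    using \<sigma>(1) by (simp add: d K_def ennreal_mult nn_integral_cmult)
  also have "(\<integral>\<^sup>+t. ennreal (normal_density m \<sigma> t) \<partial>lborel) = 1"
    using \<sigma>(1) by (subst nn_integral_eq_integral) simp_all
  also have "K = s powr (- 1 / 2) * exp (\<theta> / s * \<mu>\<^sup>2)"
    using s by (simp add: K_def \<sigma>_def powr_minus_divide powr_half_sqrt)
  finally show ?thesis by (simp add: s_def)
qed

text \<open>
  The Laplace transform of the noncentral chi-square distribution. The sum over \<open>B\<close> is the squared length of the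
  projection of \<open>x + \<mu>\<close> onto the span of \<open>B\<close>.
\<close>

lemma nn_integral_std_gauss_exp_quadratic:
  fixes B :: "'a::euclidean_space set"
  assumes B: "pairwise orthogonal B" "\<And>b. b \<in> B \<Longrightarrow> norm b = 1" and \<theta>: "\<theta> < 1 / 2"
  shows "(\<integral>\<^sup>+x. ennreal (exp (\<theta> * (\<Sum>b\<in>B. (b \<bullet> (x + \<mu>))\<^sup>2))) \<partial>std_gauss)
    = ennreal ((1 - 2 * \<theta>) powr (- real (card B) / 2) * exp (\<theta> / (1 - 2 * \<theta>) * (\<Sum>b\<in>B. (b \<bullet> \<mu>)\<^sup>2)))"
proof -
  have fin: "finite B" using orthonormal_basis_extension[OF B] finite_subset by metis
  have "(\<integral>\<^sup>+x. ennreal (exp (\<theta> * (\<Sum>b\<in>B. (b \<bullet> (x + \<mu>))\<^sup>2))) \<partial>std_gauss)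
      = (\<integral>\<^sup>+x. (\<Prod>b\<in>B. ennreal (exp (\<theta> * (b \<bullet> x + b \<bullet> \<mu>)\<^sup>2))) \<partial>std_gauss)"
    using fin by (simp add: sum_distrib_left exp_sum inner_add_right prod_ennreal)
  also have "\<dots> = (\<Prod>b\<in>B. ennreal ((1 - 2 * \<theta>) powr (- 1 / 2) * exp (\<theta> / (1 - 2 * \<theta>) * (b \<bullet> \<mu>)\<^sup>2)))"
    using nn_integral_std_gauss_orthonormal[OF B, where h="\<lambda>b t. ennreal (exp (\<theta> * (t + b \<bullet> \<mu>)\<^sup>2))"]
    by (simp add: nn_integral_std_gauss_exp_square[OF \<theta>])
  also have "\<dots> = ennreal (((1 - 2 * \<theta>) powr (- 1 / 2)) ^ card B * exp (\<theta> / (1 - 2 * \<theta>) * (\<Sum>b\<in>B. (b \<bullet> \<mu>)\<^sup>2)))"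
    using fin by (simp add: prod_ennreal prod.distrib sum_distrib_left exp_sum)
  also have "((1 - 2 * \<theta>) powr (- 1 / 2)) ^ card B = (1 - 2 * \<theta>) powr (- real (card B) / 2)"
    using \<theta> by (simp add: powr_power mult.commute)
  finally show ?thesis .
qed

lemma integrable_exp_quadratic:
  fixes B :: "'a::euclidean_space set"
  assumes B: "pairwise orthogonal B" "\<And>b. b \<in> B \<Longrightarrow> norm b = 1" and \<theta>: "\<theta> < 1 / 2"
  shows "integrable std_gauss (\<lambda>x. exp (\<theta> * (\<Sum>b\<in>B. (b \<bullet> x)\<^sup>2)))"
    and "(\<integral>x. exp (\<theta> * (\<Sum>b\<in>B. (b \<bullet> x)\<^sup>2)) \<partial>std_gauss) = (1 - 2 * \<theta>) powr (- real (card B) / 2)"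
  using nn_integral_std_gauss_exp_quadratic[OF B \<theta>, of 0] \<theta>
  by (auto simp: integrable_iff_bounded integral_eq_nn_integral)

text \<open>
  The moments of the central chi-square distribution with \<open>card B\<close> degrees of freedom, obtained by comparing its
  Laplace transform with the binomial series.
\<close>

lemma
  fixes B :: "'a::euclidean_space set"
  assumes B: "pairwise orthogonal B" "\<And>b. b \<in> B \<Longrightarrow> norm b = 1"
  shows integrable_quadratic_power: "integrable std_gauss (\<lambda>x. (\<Sum>b\<in>B. (b \<bullet> x)\<^sup>2) ^ j)"
    and integral_quadratic_power:
      "(\<integral>x. (\<Sum>b\<in>B. (b \<bullet> x)\<^sup>2) ^ j \<partial>std_gauss) = 2 ^ j * pochhammer (real (card B) / 2) j"
proof -
  let ?q = "\<lambda>x. \<Sum>b\<in>B. (b \<bullet> x)\<^sup>2"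
  have nn: "0 \<le> ?q x" for x by (simp add: sum_nonneg)
  have [measurable]: "?q \<in> borel_measurable borel" by measurable
  have int: "integrable std_gauss (\<lambda>x. 1 * exp \<bar>t * ?q x\<bar>)" if "\<bar>t\<bar> < 1 / 2" for t
    using integrable_exp_quadratic(1)[OF B, of "\<bar>t\<bar>"] that nn by (simp add: abs_mult)
  \<comment> \<open>any exponent \<open>t\<close> with \<open>0 < t < 1 / 2\<close> will do for integrability, here \<open>1 / 4\<close>\<close>
  show "integrable std_gauss (\<lambda>x. ?q x ^ j)"
    using integrable_mult_power_of_exp[OF _ _ int[of "1/4"], of j]
      integrable_mult_right[of "4 ^ j" std_gauss "\<lambda>x. (1/4 * ?q x) ^ j"]
    by (simp add: power_mult_distrib power_divide)
  have "(\<integral>x. ?q x ^ j \<partial>std_gauss) / fact j = 2 ^ j * pochhammer (real (card B) / 2) j / fact j"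
  proof (rule powser_coeff_unique[where r="1/2" and f="\<lambda>t. (1 - 2 * t) powr (- real (card B) / 2)"])
    fix t :: real assume t: "\<bar>t\<bar> < 1 / 2"
    have "(\<lambda>m. (\<integral>x. 1 * (t * ?q x) ^ m \<partial>std_gauss) / fact m) sums (\<integral>x. 1 * exp (t * ?q x) \<partial>std_gauss)"
      by (rule integral_mult_exp_sums[OF _ _ int[OF t]]) simp_all
    then show "(\<lambda>m. (\<integral>x. ?q x ^ m \<partial>std_gauss) / fact m * t ^ m) sums (1 - 2 * t) powr (- real (card B) / 2)"
      using t integrable_exp_quadratic(2)[OF B, of t] by (simp add: power_mult_distrib mult.commute)
    have "(\<lambda>n. (- real (card B) / 2 gchoose n) * (- 2 * t) ^ n) sums (1 + - 2 * t) powr (- real (card B) / 2)"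
      using t by (intro gen_binomial_real) simp
    moreover have "(- real (card B) / 2 gchoose n) * (- 2 * t) ^ n
        = 2 ^ n * pochhammer (real (card B) / 2) n / fact n * t ^ n" for n
    proof -
      have "(- 2 * t) ^ n = ((- 1) * (2 * t)) ^ n" by simp
      also have "\<dots> = (- 1) ^ n * (2 ^ n * t ^ n)" by (simp only: power_mult_distrib)
      finally have "(- real (card B) / 2 gchoose n) * (- 2 * t) ^ n
          = ((- 1) ^ n * (- 1) ^ n) * (pochhammer (real (card B) / 2) n / fact n * (2 ^ n * t ^ n))"
        by (simp add: gbinomial_pochhammer)
      also have "(- 1 :: real) ^ n * (- 1) ^ n = 1" by (simp flip: power_mult_distrib)
      finally show ?thesis by simp
    qed
    ultimately show "(\<lambda>m. 2 ^ m * pochhammer (real (card B) / 2) m / fact m * t ^ m)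
        sums (1 - 2 * t) powr (- real (card B) / 2)" by simp
  qed simp
  then show "(\<integral>x. ?q x ^ j \<partial>std_gauss) = 2 ^ j * pochhammer (real (card B) / 2) j" by simp
qed

lemma exp_square_powser:
  fixes a t :: real
  shows "(\<lambda>m. (if even m then a ^ (m div 2) / fact (m div 2) else 0) * t ^ m) sums exp (t\<^sup>2 * a)"
proof -
  have "(\<lambda>k. a ^ k / fact k * t ^ (2 * k)) sums exp (t\<^sup>2 * a)"
    using exp_converges[of "t\<^sup>2 * a"] by (simp add: power_mult_distrib field_simps flip: power_mult)
  then show ?thesis
    by (subst sums_mono_reindex[of "\<lambda>k. 2 * k", symmetric])
       (auto simp: strict_mono_def image_iff elim!: evenE)
qed

text \<open>
  A shift in the direction \<open>v\<close> does not change the quadratic form, since \<open>v\<close> is orthogonal to \<open>B\<close>.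
  Hence, by the shift formula, \<open>E [q\<^sup>j exp (t (v \<bullet> x))] = exp (t\<^sup>2 (v \<bullet> v) / 2) E [q\<^sup>j]\<close> for all \<open>t\<close>,
  and the coefficients of the powers of \<open>t\<close> give the mixed moments.
\<close>

lemma
  fixes B :: "'a::euclidean_space set"
  assumes B: "pairwise orthogonal B" "\<And>b. b \<in> B \<Longrightarrow> norm b = 1"
    and v: "\<And>b. b \<in> B \<Longrightarrow> b \<bullet> v = 0"
  shows integrable_quadratic_linear_power:
      "integrable std_gauss (\<lambda>x. (\<Sum>b\<in>B. (b \<bullet> x)\<^sup>2) ^ j * (v \<bullet> x) ^ m)"
    and integral_quadratic_linear_power:
      "(\<integral>x. (\<Sum>b\<in>B. (b \<bullet> x)\<^sup>2) ^ j * (v \<bullet> x) ^ (2 * k) \<partial>std_gauss)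
        = 2 ^ j * pochhammer (real (card B) / 2) j * (fact (2 * k) / (2 ^ k * fact k) * (v \<bullet> v) ^ k)"
proof -
  let ?q = "\<lambda>x. \<Sum>b\<in>B. (b \<bullet> x)\<^sup>2"
  let ?E = "2 ^ j * pochhammer (real (card B) / 2) j :: real"
  have nn: "0 \<le> ?q x" for x by (simp add: sum_nonneg)
  have [measurable]: "?q \<in> borel_measurable borel" by measurable
  have E0: "?E \<ge> 0" by (subst integral_quadratic_power[OF B, symmetric]) (simp_all add: nn)
  have EE: "(\<integral>\<^sup>+x. ennreal (?q x ^ j) \<partial>std_gauss) = ennreal ?E"
    using integrable_quadratic_power[OF B, of j] integral_quadratic_power[OF B, of j] nn
    by (subst nn_integral_eq_integral) auto
  have nne: "(\<integral>\<^sup>+x. ennreal (?q x ^ j * exp (t * (v \<bullet> x))) \<partial>std_gauss) = ennreal (?E * exp (t\<^sup>2 * ((v \<bullet> v) / 2)))" for t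
  proof -
    have qs: "?q (x + t *\<^sub>R v) = ?q x" for x
      by (rule sum.cong) (simp_all add: inner_add_right v)
    have "ennreal ?E = (\<integral>\<^sup>+x. ennreal (?q (x + t *\<^sub>R v) ^ j) \<partial>std_gauss)"
      by (simp only: EE qs)
    also have "\<dots> = (\<integral>\<^sup>+x. ennreal (?q x ^ j) * ennreal (exp (t *\<^sub>R v \<bullet> x - t *\<^sub>R v \<bullet> t *\<^sub>R v / 2)) \<partial>std_gauss)"
      by (rule nn_integral_std_gauss_shift) simp
    also have "\<dots> = (\<integral>\<^sup>+x. ennreal (?q x ^ j * exp (t * (v \<bullet> x))) * ennreal (exp (- (t\<^sup>2 * ((v \<bullet> v) / 2)))) \<partial>std_gauss)"
      using nn by (intro nn_integral_cong)
        (simp add: mult.assoc mult_exp_exp power2_eq_square flip: ennreal_mult)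
    also have "\<dots> = (\<integral>\<^sup>+x. ennreal (?q x ^ j * exp (t * (v \<bullet> x))) \<partial>std_gauss) * ennreal (exp (- (t\<^sup>2 * ((v \<bullet> v) / 2))))"
      by (rule nn_integral_multc) simp
    finally have "ennreal ?E * ennreal (exp (t\<^sup>2 * ((v \<bullet> v) / 2)))
      = (\<integral>\<^sup>+x. ennreal (?q x ^ j * exp (t * (v \<bullet> x))) \<partial>std_gauss) *
          (ennreal (exp (- (t\<^sup>2 * ((v \<bullet> v) / 2)))) * ennreal (exp (t\<^sup>2 * ((v \<bullet> v) / 2))))"
      by (simp add: mult.assoc)
    also have "ennreal (exp (- (t\<^sup>2 * ((v \<bullet> v) / 2)))) * ennreal (exp (t\<^sup>2 * ((v \<bullet> v) / 2))) = 1"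
      by (simp add: mult_exp_exp flip: ennreal_mult)
    finally show ?thesis using E0 by (simp add: ennreal_mult)
  qed
  have inte: "integrable std_gauss (\<lambda>x. ?q x ^ j * exp (t * (v \<bullet> x)))"
    and inteq: "(\<integral>x. ?q x ^ j * exp (t * (v \<bullet> x)) \<partial>std_gauss) = ?E * exp (t\<^sup>2 * ((v \<bullet> v) / 2))" for t
    using nne[of t] nn E0 by (auto simp: integrable_iff_bounded integral_eq_nn_integral abs_mult)
  have int: "integrable std_gauss (\<lambda>x. ?q x ^ j * exp \<bar>t * (v \<bullet> x)\<bar>)" for t
  proof (rule Bochner_Integration.integrable_bound[OF Bochner_Integration.integrable_add[OF inte[of t] inte[of "-t"]]])
    have e: "exp \<bar>y\<bar> \<le> exp y + exp (- y)" for y :: real by (simp add: abs_if)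
    have "norm (?q x ^ j * exp \<bar>t * (v \<bullet> x)\<bar>)
        \<le> norm (?q x ^ j * exp (t * (v \<bullet> x)) + ?q x ^ j * exp (- t * (v \<bullet> x)))" for x
    proof -
      have 0: "0 \<le> ?q x ^ j" using nn by simp
      have "?q x ^ j * exp \<bar>t * (v \<bullet> x)\<bar> \<le> ?q x ^ j * exp (t * (v \<bullet> x)) + ?q x ^ j * exp (- t * (v \<bullet> x))"
        using mult_left_mono[OF e[of "t * (v \<bullet> x)"] 0] by (simp add: distrib_left)
      moreover have "0 \<le> ?q x ^ j * exp \<bar>t * (v \<bullet> x)\<bar>" using 0 by simp
      ultimately show ?thesis by (simp only: real_norm_def)
    qed
    then show "AE x in std_gauss. norm (?q x ^ j * exp \<bar>t * (v \<bullet> x)\<bar>)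
        \<le> norm (?q x ^ j * exp (t * (v \<bullet> x)) + ?q x ^ j * exp (- t * (v \<bullet> x)))"
      by (intro AE_I2)
  qed simp
  show "integrable std_gauss (\<lambda>x. ?q x ^ j * (v \<bullet> x) ^ m)"
    using integrable_mult_power_of_exp[OF _ _ int[of 1], of m] by simp
  have "(\<integral>x. ?q x ^ j * (v \<bullet> x) ^ m \<partial>std_gauss) / fact m
      = ?E * (if even m then ((v \<bullet> v) / 2) ^ (m div 2) / fact (m div 2) else 0)" for m
  proof (rule powser_coeff_unique[where r=1 and m=m
        and a="\<lambda>m. (\<integral>x. ?q x ^ j * (v \<bullet> x) ^ m \<partial>std_gauss) / fact m" and f="\<lambda>t. ?E * exp (t\<^sup>2 * ((v \<bullet> v) / 2))"])
    fix t :: real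
    have "(\<lambda>m. (\<integral>x. ?q x ^ j * (t * (v \<bullet> x)) ^ m \<partial>std_gauss) / fact m) sums
        (\<integral>x. ?q x ^ j * exp (t * (v \<bullet> x)) \<partial>std_gauss)"
      by (rule integral_mult_exp_sums[OF _ _ int]) simp_all
    moreover have "(\<integral>x. ?q x ^ j * (t * (v \<bullet> x)) ^ m \<partial>std_gauss) = (\<integral>x. ?q x ^ j * (v \<bullet> x) ^ m \<partial>std_gauss) * t ^ m" for m
      by (subst integral_mult_left_zero[symmetric]) (simp add: power_mult_distrib mult_ac)
    ultimately show "(\<lambda>m. (\<integral>x. ?q x ^ j * (v \<bullet> x) ^ m \<partial>std_gauss) / fact m * t ^ m)
        sums (?E * exp (t\<^sup>2 * ((v \<bullet> v) / 2)))"
      by (simp add: inteq)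
    show "(\<lambda>m. ?E * (if even m then ((v \<bullet> v) / 2) ^ (m div 2) / fact (m div 2) else 0) * t ^ m)
        sums (?E * exp (t\<^sup>2 * ((v \<bullet> v) / 2)))"
      using sums_mult[OF exp_square_powser[of "(v \<bullet> v) / 2" t], of ?E] by (simp add: mult.assoc)
  qed simp
  from this[of "2 * k"] show "(\<integral>x. ?q x ^ j * (v \<bullet> x) ^ (2 * k) \<partial>std_gauss)
      = ?E * (fact (2 * k) / (2 ^ k * fact k) * (v \<bullet> v) ^ k)"
    by (simp add: field_simps power_divide)
qed

section \<open>Measurability of matrix expressions\<close>

lemma borel_measurable_vec_iff:
  fixes f :: "'w \<Rightarrow> 'b::euclidean_space^'n"
  shows "f \<in> borel_measurable M \<longleftrightarrow> (\<forall>i. (\<lambda>x. f x $ i) \<in> borel_measurable M)"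
proof
  assume f: "f \<in> borel_measurable M"
  have "continuous_on UNIV (\<lambda>x::'b^'n. x $ i)" for i by (intro continuous_intros)
  then have "(\<lambda>x::'b^'n. x $ i) \<in> borel_measurable borel" for i
    by (rule borel_measurable_continuous_onI)
  from measurable_compose[OF f this] show "\<forall>i. (\<lambda>x. f x $ i) \<in> borel_measurable M" by simp
next
  assume f: "\<forall>i. (\<lambda>x. f x $ i) \<in> borel_measurable M"
  have "(\<lambda>x. f x \<bullet> b) \<in> borel_measurable M" if b: "b \<in> Basis" for b
  proof -
    obtain i u where "b = axis i u" using b unfolding Basis_vec_def by blast
    then have "(\<lambda>x. f x \<bullet> b) = (\<lambda>x. f x $ i \<bullet> u)" by (simp add: inner_axis)
    then show ?thesis using borel_measurable_inner[OF f[rule_format, of i] borel_measurable_const[of u]] by simp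
  qed
  then show "f \<in> borel_measurable M" by (rule borel_measurable_euclidean_space[THEN iffD2, rule_format])
qed

lemma borel_measurable_vec_component [measurable (raw)]:
  fixes f :: "'w \<Rightarrow> 'b::euclidean_space^'n"
  shows "f \<in> borel_measurable M \<Longrightarrow> (\<lambda>x. f x $ i) \<in> borel_measurable M"
  using borel_measurable_vec_iff by blast

lemma borel_measurable_vec_lambda [measurable (raw)]:
  fixes f :: "'w \<Rightarrow> 'n::finite \<Rightarrow> 'b::euclidean_space"
  shows "(\<And>i. (\<lambda>x. f x i) \<in> borel_measurable M) \<Longrightarrow> (\<lambda>x. \<chi> i. f x i) \<in> borel_measurable M"
  by (simp add: borel_measurable_vec_iff)

lemma borel_measurable_matrix_vector [measurable (raw)]:
  fixes A :: "'w \<Rightarrow> real^'m^'n"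
  assumes [measurable]: "A \<in> borel_measurable M" "x \<in> borel_measurable M"
  shows "(\<lambda>w. A w *v x w) \<in> borel_measurable M"
  unfolding matrix_vector_mult_def by measurable

lemma borel_measurable_vector_matrix [measurable (raw)]:
  fixes A :: "'w \<Rightarrow> real^'m^'n"
  assumes [measurable]: "A \<in> borel_measurable M" "x \<in> borel_measurable M"
  shows "(\<lambda>w. x w v* A w) \<in> borel_measurable M"
  unfolding vector_matrix_mult_def by measurable

lemma borel_measurable_matrix_matrix [measurable (raw)]:
  fixes A :: "'w \<Rightarrow> real^'m^'n" and B :: "'w \<Rightarrow> real^'k^'m"
  assumes [measurable]: "A \<in> borel_measurable M" "B \<in> borel_measurable M"
  shows "(\<lambda>w. A w ** B w) \<in> borel_measurable M"
  unfolding matrix_matrix_mult_def by measurable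

lemma borel_measurable_transpose [measurable (raw)]:
  fixes A :: "'w \<Rightarrow> real^'m^'n"
  assumes [measurable]: "A \<in> borel_measurable M"
  shows "(\<lambda>w. transpose (A w)) \<in> borel_measurable M"
  unfolding transpose_def by measurable

lemma borel_measurable_det [measurable (raw)]:
  fixes A :: "'w \<Rightarrow> real^'n^'n"
  assumes [measurable]: "A \<in> borel_measurable M"
  shows "(\<lambda>w. det (A w)) \<in> borel_measurable M"
  unfolding det_def by measurable

lemma matrix_inv_inverse:
  fixes A :: "real^'n^'n"
  assumes "invertible A"
  shows "A ** matrix_inv A = mat 1" "matrix_inv A ** A = mat 1"
  using assms someI_ex[of "\<lambda>A'. A ** A' = mat 1 \<and> A' ** A = mat 1"]
  unfolding invertible_def matrix_inv_def by auto

lemma matrix_inv_unique: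
  fixes A B :: "real^'n^'n"
  assumes "A ** B = mat 1"
  shows "matrix_inv A = B"
proof -
  have "B ** A = mat 1" using assms by (simp add: matrix_left_right_inverse)
  then have "invertible A" using assms unfolding invertible_def by blast
  from matrix_inv_inverse(2)[OF this] assms show ?thesis
    by (metis matrix_mul_assoc matrix_mul_lid matrix_mul_rid)
qed

text \<open>
  On invertible matrices this is Cramer's rule. On a singular matrix the inverse is a choice from an empty set, which is
  one constant matrix \<open>C\<close>.
\<close>

lemma borel_measurable_matrix_inv_vector [measurable (raw)]:
  fixes A :: "'w \<Rightarrow> real^'n^'n"
  assumes [measurable]: "A \<in> borel_measurable M" "b \<in> borel_measurable M"
  shows "(\<lambda>w. matrix_inv (A w) *v b w) \<in> borel_measurable M"
proof -
  define C where "C = (SOME C::real^'n^'n. False)"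
  have "matrix_inv (A w) *v b w
    = (if det (A w) = 0 then C *v b w
       else (\<chi> k. det (\<chi> i j. if j = k then b w $ i else A w $ i $ j) / det (A w)))" for w
  proof (cases "det (A w) = 0")
    case True
    then have "\<not> invertible (A w)" by (simp add: invertible_det_nz)
    then have "matrix_inv (A w) = C" unfolding matrix_inv_def C_def invertible_def
      by (intro arg_cong[where f=Eps]) auto
    with True show ?thesis by simp
  next
    case False
    then have "A w *v (matrix_inv (A w) *v b w) = b w"
      using matrix_inv_inverse(1)[of "A w"] by (simp add: invertible_det_nz matrix_vector_mul_assoc)
    with False show ?thesis by (simp add: cramer)
  qed
  moreover have "(\<lambda>w. \<chi> k. det (\<chi> i j. if j = k then b w $ i else A w $ i $ j) / det (A w)) \<in> borel_measurable M"
  proof (intro borel_measurable_vec_lambda borel_measurable_divide borel_measurable_det)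
    show "(\<lambda>w. if j = k then b w $ i else A w $ i $ j) \<in> borel_measurable M" for i j k
      by (cases "j = k") simp_all
  qed simp
  ultimately show ?thesis by simp
qed

section \<open>The residual projection\<close>

lemma residual_projection_vector:
  "residual_projection A *v x = x - A *v (matrix_inv (transpose A ** A) *v (x v* A))"
  unfolding residual_projection_def
  by (simp add: matrix_vector_mult_diff_rdistrib flip: matrix_vector_mul_assoc)

lemma borel_measurable_residual_projection [measurable (raw)]:
  fixes A :: "'w \<Rightarrow> real^'m^'n"
  assumes [measurable]: "A \<in> borel_measurable M" "x \<in> borel_measurable M"
  shows "(\<lambda>w. residual_projection (A w) *v x w) \<in> borel_measurable M"
  unfolding residual_projection_vector by measurable

lemma residual_projection_annihilates:
  fixes A :: "real^'q^'n"
  assumes "invertible (transpose A ** A)"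
  shows "residual_projection A *v (A *v w) = 0" and "(residual_projection A *v x) v* A = 0"
proof -
  note inv = matrix_inv_inverse[OF assms]
  have "matrix_inv (transpose A ** A) *v ((A *v w) v* A) = w"
  proof -
    have "(A *v w) v* A = (transpose A ** A) *v w"
      by (simp flip: transpose_matrix_vector matrix_vector_mul_assoc)
    then show ?thesis using inv(2) by (simp add: matrix_vector_mul_assoc)
  qed
  then show "residual_projection A *v (A *v w) = 0"
    by (simp add: residual_projection_vector)
  have "(A *v y) v* A = (transpose A ** A) *v y" for y
    by (simp flip: transpose_matrix_vector matrix_vector_mul_assoc)
  from this[of "matrix_inv (transpose A ** A) *v (x v* A)"]
  have "(A *v (matrix_inv (transpose A ** A) *v (x v* A))) v* A = x v* A"
    by (simp only: matrix_vector_mul_assoc[of "transpose A ** A"] inv(1) matrix_vector_mul_lid)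
  moreover have "(x - y) v* A = x v* A - y v* A" for y
    by (simp add: matrix_vector_mult_diff_distrib flip: transpose_matrix_vector)
  ultimately show "(residual_projection A *v x) v* A = 0"
    by (simp add: residual_projection_vector)
qed

text \<open>
  For a matrix of full column rank, \<open>residual_projection A\<close> is the orthogonal projection onto the complement of the
  column space; \<open>B\<close> is an orthonormal basis of that complement.
\<close>

lemma residual_projection_orthonormal_basis:
  fixes A :: "real^'q^'n"
  assumes inv: "invertible (transpose A ** A)"
  obtains B where "pairwise orthogonal B" "\<And>b. b \<in> B \<Longrightarrow> norm b = 1" "card B + CARD('q) = CARD('n)"
    "\<And>b w. b \<in> B \<Longrightarrow> b \<bullet> (A *v w) = 0"
    "\<And>x. residual_projection A *v x = (\<Sum>b\<in>B. (b \<bullet> x) *\<^sub>R b)"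
proof -
  have inj: "inj ((*v) A)"
  proof (rule injI)
    fix x y assume "A *v x = A *v y"
    then have "matrix_inv (transpose A ** A) *v ((transpose A ** A) *v x)
       = matrix_inv (transpose A ** A) *v ((transpose A ** A) *v y)"
      by (simp flip: matrix_vector_mul_assoc del: transpose_matrix_vector)
    then show "x = y" by (simp add: matrix_vector_mul_assoc matrix_inv_inverse[OF inv])
  qed
  define R where "R = range ((*v) A)"
  have subR: "subspace R" unfolding R_def
    by (intro linear_subspace_image subspace_UNIV) simp
  have dimR: "dim R = CARD('q)"
    unfolding R_def using dim_image_eq[of "(*v) A" UNIV] inj by (simp add: inj_on_subset)
  define S where "S = {y \<in> UNIV. \<forall>x \<in> R. orthogonal x y}"
  have "dim S + dim R = dim (UNIV :: (real^'n) set)"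
    unfolding S_def using subR by (intro dim_subspace_orthogonal_to_vectors) auto
  then have dimS: "dim S + CARD('q) = CARD('n)" by (simp add: dimR)
  have "subspace S" unfolding S_def by (auto simp: subspace_def orthogonal_clauses)
  then obtain B where B: "B \<subseteq> S" "pairwise orthogonal B" "\<And>x. x \<in> B \<Longrightarrow> norm x = 1"
    "independent B" "card B = dim S" "span B = S"
    using orthonormal_basis_subspace by metis
  have bA: "b \<bullet> (A *v w) = 0" if "b \<in> B" for b w
    using that B(1) by (auto simp: S_def R_def orthogonal_def inner_commute)
  have "residual_projection A *v x = (\<Sum>b\<in>B. (b \<bullet> x) *\<^sub>R b)" for x
  proof -
    let ?r = "residual_projection A *v x"
    have "(A *v w) \<bullet> ?r = 0" for w
      using residual_projection_annihilates(2)[OF inv, of x]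
      by (subst inner_commute) (simp flip: dot_lmul_matrix)
    then have "?r \<in> span B" by (auto simp: B(6) S_def R_def orthogonal_def)
    then have "?r = (\<Sum>b\<in>B. (?r \<bullet> b) *\<^sub>R b)"
      using orthonormal_basis_expand[OF B(2,3), of ?r] B(4) by (simp add: independent_imp_finite)
    also have "\<dots> = (\<Sum>b\<in>B. (b \<bullet> x) *\<^sub>R b)"
      by (intro sum.cong refl)
        (simp add: residual_projection_vector inner_diff_left inner_commute[of _ "_ :: real^'n"] inner_diff_right bA)
    finally show ?thesis .
  qed
  with that[OF B(2,3)] B(5) dimS bA show ?thesis by simp
qed

lemma residual_quadratic_form_sum:
  fixes B :: "(real^'n) set"
  assumes "\<And>x. residual_projection A *v x = (\<Sum>b\<in>B. (b \<bullet> x) *\<^sub>R b)"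
  shows "x \<bullet> (residual_projection A *v x) = (\<Sum>b\<in>B. (b \<bullet> x)\<^sup>2)"
  by (simp add: assms inner_sum_right power2_eq_square inner_commute[of x])

lemma residual_quadratic_form_bounds:
  fixes A :: "real^'q^'n"
  assumes inv: "invertible (transpose A ** A)"
  shows "(residual_projection A *v x) \<bullet> (residual_projection A *v x) = x \<bullet> (residual_projection A *v x)"
    and "0 \<le> x \<bullet> (residual_projection A *v x)"
    and "x \<bullet> (residual_projection A *v x) \<le> x \<bullet> x"
proof -
  define r where "r = residual_projection A *v x"
  define a where "a = A *v (matrix_inv (transpose A ** A) *v (x v* A))"
  have x: "x = r + a" by (simp add: residual_projection_vector r_def a_def)
  have o: "r \<bullet> a = 0"
    using residual_projection_annihilates(2)[OF inv, of x] by (simp add: r_def a_def flip: dot_lmul_matrix)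
  have eq: "r \<bullet> r = x \<bullet> r" "x \<bullet> x = r \<bullet> r + a \<bullet> a"
    using o inner_commute[of a r] by (simp_all add: x inner_add_left inner_add_right)
  then have "r \<bullet> r = x \<bullet> r" "0 \<le> x \<bullet> r" "x \<bullet> r \<le> x \<bullet> x"
    using inner_ge_zero[of r] inner_ge_zero[of a] by linarith+
  then show "(residual_projection A *v x) \<bullet> (residual_projection A *v x) = x \<bullet> (residual_projection A *v x)"
    and "0 \<le> x \<bullet> (residual_projection A *v x)"
    and "x \<bullet> (residual_projection A *v x) \<le> x \<bullet> x"
    by (simp_all only: r_def)
qed

lemma residual_projection_orthogonal_image:
  fixes A :: "real^'q^'n"
  assumes U: "orthogonal_matrix U"
  shows "residual_projection (U ** A) *v (U *v x) = U *v (residual_projection A *v x)"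
proof -
  have UU: "transpose U ** U = mat 1" using U by (simp add: orthogonal_matrix)
  have "transpose (U ** A) ** (U ** A) = transpose A ** ((transpose U ** U) ** A)"
    by (simp add: matrix_transpose_mul matrix_mul_assoc)
  then have 1: "transpose (U ** A) ** (U ** A) = transpose A ** A" by (simp add: UU)
  have "(U *v x) v* (U ** A) = (transpose A ** (transpose U ** U)) *v x"
    by (simp only: transpose_matrix_vector[symmetric] matrix_transpose_mul matrix_vector_mul_assoc matrix_mul_assoc)
  then have 2: "(U *v x) v* (U ** A) = x v* A" by (simp add: UU)
  show ?thesis unfolding residual_projection_vector 1 2
    by (simp add: matrix_vector_mult_diff_distrib matrix_vector_mul_assoc matrix_mul_assoc)
qed

text \<open>
  Passing to \<open>A ** T\<close> changes the basis of the column space, not the space itself.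
\<close>

lemma residual_projection_right_mult:
  fixes A :: "real^'q^'n" and T :: "real^'q^'q"
  assumes T: "invertible T" and inv: "invertible (transpose A ** A)"
  shows "residual_projection (A ** T) = residual_projection A"
proof -
  let ?G = "transpose A ** A" and ?H = "matrix_inv (transpose A ** A)" and ?S = "matrix_inv T"
  note G = matrix_inv_inverse[OF inv] and TS = matrix_inv_inverse[OF T]
  have TS': "transpose T ** transpose ?S = mat 1" "transpose ?S ** transpose T = mat 1"
    using TS by (simp_all flip: matrix_transpose_mul add: transpose_mat)
  have "(transpose (A ** T) ** (A ** T)) ** (?S ** ?H ** transpose ?S)
    = transpose T ** (?G ** ((T ** ?S) ** ?H)) ** transpose ?S"
    by (simp add: matrix_transpose_mul matrix_mul_assoc)
  also have "\<dots> = mat 1" using G TS TS' by simp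
  finally have "matrix_inv (transpose (A ** T) ** (A ** T)) = ?S ** ?H ** transpose ?S"
    by (rule matrix_inv_unique)
  then have "(A ** T) ** matrix_inv (transpose (A ** T) ** (A ** T)) ** transpose (A ** T)
      = A ** ((T ** ?S) ** ?H ** (transpose ?S ** transpose T)) ** transpose A"
    by (simp add: matrix_transpose_mul matrix_mul_assoc)
  also have "\<dots> = A ** ?H ** transpose A" using TS TS' by simp
  finally show ?thesis by (simp add: residual_projection_def)
qed

text \<open>
  The Schur complement of a Gram matrix is the squared distance of the first column from the span of the other ones.
\<close>

lemma schur_complement_gram:
  fixes X :: "real^('q::finite) option^'n"
  assumes inv: "invertible (transpose (rest_cols X) ** rest_cols X)"
  shows "schur_complement (transpose X ** X)
    = first_col X \<bullet> (residual_projection (rest_cols X) *v first_col X)"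
proof -
  have b22: "block22 (transpose X ** X) = transpose (rest_cols X) ** rest_cols X"
    by (simp add: block22_def rest_cols_def vec_eq_iff matrix_matrix_mult_def transpose_def)
  have b21: "block21 (transpose X ** X) = first_col X v* rest_cols X"
    by (simp add: block21_def rest_cols_def first_col_def column_def vec_eq_iff matrix_matrix_mult_def
        transpose_def vector_matrix_mult_def mult.commute)
  have b11: "block11 (transpose X ** X) = first_col X \<bullet> first_col X"
    by (simp add: block11_def first_col_def column_def matrix_matrix_mult_def
        transpose_def inner_vec_def)
  show ?thesis
    unfolding schur_complement_def residual_projection_vector b22 b21 b11
    by (simp add: inner_diff_right dot_lmul_matrix)
qed

lemma borel_measurable_schur_complement [measurable (raw)]:
  fixes A :: "'w \<Rightarrow> real^('q::finite) option^'q option"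
  assumes [measurable]: "A \<in> borel_measurable M"
  shows "(\<lambda>w. schur_complement (A w)) \<in> borel_measurable M"
  unfolding schur_complement_def block11_def block21_def block22_def by measurable

section \<open>Full column rank almost everywhere\<close>

text \<open>
  The determinant is a polynomial in \<open>t\<close>. It is not the zero polynomial: for \<open>s\<close> above a bound for the
  operator norm of \<open>A\<close>, the matrix \<open>A + s\<close> is injective.
\<close>

lemma finite_singular_shifts:
  fixes A :: "real^'q^'q"
  shows "finite {t. det (A + t *\<^sub>R mat 1) = 0}"
proof -
  define p where "p = (\<Sum>\<sigma> | \<sigma> permutes (UNIV::'q set).
    smult (of_int (sign \<sigma>)) (\<Prod>i\<in>UNIV. [:A $ i $ \<sigma> i, if i = \<sigma> i then 1 else 0:]))"
  have p: "poly p t = det (A + t *\<^sub>R mat 1)" for t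
    unfolding p_def det_def by (auto simp: poly_sum poly_prod mat_def intro!: sum.cong prod.cong)
  obtain K where K: "\<And>x. norm (A *v x) \<le> norm x * K"
    using linear_conv_bounded_linear[of "(*v) A"] bounded_linear.bounded[of "(*v) A"] by auto
  define s where "s = \<bar>K\<bar> + 1"
  have "inj ((*v) (A + s *\<^sub>R mat 1))"
  proof (subst linear_injective_0, simp, intro allI impI)
    fix x assume "(A + s *\<^sub>R mat 1) *v x = 0"
    then have "A *v x = - (s *\<^sub>R x)"
      by (simp add: matrix_vector_mult_add_rdistrib scaleR_matrix_vector_assoc[symmetric] eq_neg_iff_add_eq_0)
    then have "s * norm x \<le> norm x * K" using K[of x] by (simp add: s_def)
    then have "norm x * (s - K) \<le> 0" by (simp add: algebra_simps)
    moreover have "s - K > 0" by (simp add: s_def)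
    ultimately show "x = 0" by (simp add: mult_le_0_iff)
  qed
  then have "invertible (A + s *\<^sub>R mat 1)"
    by (simp add: invertible_left_inverse matrix_left_invertible_injective)
  then have "poly p s \<noteq> 0" by (simp add: p invertible_det_nz)
  then have "p \<noteq> 0" by auto
  then have "finite {t. poly p t = 0}" by (rule poly_roots_finite)
  then show ?thesis by (simp add: p)
qed

text \<open>
  Let \<open>N\<close> be the set of matrices without full column rank, and let \<open>E\<close> have the unit vectors of \<open>q\<close> of the
  rows as its columns. On each line \<open>Z + t E\<close> only finitely many points lie in \<open>N\<close>, because the square submatrix
  of these rows is shifted by \<open>t\<close> times the identity. By translation invariance and Fubini, \<open>N\<close> is a null set.
\<close>

lemma AE_full_column_rank:
  assumes "CARD('q::finite) \<le> CARD('n::finite)"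
  shows "AE Z in (lborel :: (real^'q^'n) measure). invertible (transpose Z ** Z)"
proof -
  define N where "N = {Z :: real^'q^'n. det (transpose Z ** Z) = 0}"
  have N[measurable]: "N \<in> sets borel" unfolding N_def by measurable
  obtain f :: "'q \<Rightarrow> 'n" where f: "inj f"
    using assms card_le_inj[of "UNIV::'q set" "UNIV::'n set"] by auto
  define E :: "real^'q^'n" where "E = (\<chi> i j. if i = f j then 1 else 0)"
  have bad: "det ((\<chi> i j. Z $ f i $ j) + t *\<^sub>R mat 1) = 0" if "Z + t *\<^sub>R E \<in> N" for Z t
  proof -
    let ?Y = "Z + t *\<^sub>R E"
    have "\<not> invertible (transpose ?Y ** ?Y)" using that by (simp add: N_def invertible_det_nz)
    then have "\<not> inj ((*v) (transpose ?Y ** ?Y))"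
      by (simp add: invertible_left_inverse matrix_left_invertible_injective)
    then obtain x where x: "x \<noteq> 0" "(transpose ?Y ** ?Y) *v x = 0"
      by (subst (asm) linear_injective_0) auto
    have "(?Y *v x) \<bullet> (?Y *v x) = x \<bullet> ((transpose ?Y ** ?Y) *v x)"
      by (metis dot_lmul_matrix inner_commute transpose_matrix_vector matrix_vector_mul_assoc)
    then have "?Y *v x = 0" using x(2) by simp
    then have "(\<Sum>j\<in>UNIV. ?Y $ f i $ j * x $ j) = 0" for i
      by (simp add: matrix_vector_mult_def vec_eq_iff)
    then have "((\<chi> i j. Z $ f i $ j) + t *\<^sub>R mat 1) *v x = 0"
      using f by (simp add: matrix_vector_mult_def vec_eq_iff E_def mat_def inj_eq)
    then have "\<not> inj ((*v) ((\<chi> i j. Z $ f i $ j) + t *\<^sub>R mat 1))"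
      using x(1) by (subst linear_injective_0) auto
    then have "\<not> invertible ((\<chi> i j. Z $ f i $ j) + t *\<^sub>R mat 1)"
      by (simp add: invertible_left_inverse matrix_left_invertible_injective)
    then show ?thesis by (simp add: invertible_det_nz)
  qed
  have tr: "(\<integral>\<^sup>+Z. indicator N Z \<partial>lborel) = (\<integral>\<^sup>+Z. indicator N (Z + t *\<^sub>R E) \<partial>lborel)" for t
    using nn_integral_distr[of "(+) (t *\<^sub>R E)" lborel borel "indicator N"]
    by (simp add: lborel_distr_plus add.commute del: nn_integral_indicator)
  have null: "(\<integral>\<^sup>+t. indicator N (Z + t *\<^sub>R E) \<partial>lborel) = 0" for Z
  proof -
    have "finite {t. Z + t *\<^sub>R E \<in> N}"
      by (rule finite_subset[OF _ finite_singular_shifts[of "\<chi> i j. Z $ f i $ j"]]) (use bad in auto)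
    then have "emeasure lborel {t. Z + t *\<^sub>R E \<in> N} = 0"
      by (simp add: emeasure_lborel_countable countable_finite)
    moreover have "(\<lambda>t. indicator N (Z + t *\<^sub>R E) :: ennreal) = indicator {t. Z + t *\<^sub>R E \<in> N}"
      by (auto simp: indicator_def)
    ultimately show ?thesis using \<open>finite {t. Z + t *\<^sub>R E \<in> N}\<close> by (simp add: finite_imp_closed borel_closed)
  qed
  have "emeasure lborel N = (\<integral>\<^sup>+t. indicator {0..1::real} t * (\<integral>\<^sup>+Z. indicator N Z \<partial>lborel) \<partial>lborel)"
    by (simp add: nn_integral_multc)
  also have "\<dots> = (\<integral>\<^sup>+t. (\<integral>\<^sup>+Z. indicator {0..1::real} t * indicator N (Z + t *\<^sub>R E) \<partial>lborel) \<partial>lborel)"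
    by (simp add: nn_integral_cmult flip: tr)
  also have "\<dots> \<le> (\<integral>\<^sup>+t. (\<integral>\<^sup>+Z. indicator N (Z + t *\<^sub>R E) \<partial>lborel) \<partial>lborel)"
    by (intro nn_integral_mono) (simp add: indicator_def)
  also have "\<dots> = (\<integral>\<^sup>+Z. (\<integral>\<^sup>+t. indicator N (Z + t *\<^sub>R E) \<partial>lborel) \<partial>lborel)"
    by (rule lborel_pair.Fubini'[symmetric]) measurable
  also have "\<dots> = 0" by (simp add: null)
  finally have "emeasure lborel N = 0" by simp
  then have "AE Z in lborel. Z \<notin> N" by (intro AE_not_in) (simp add: null_sets_def)
  then show ?thesis by eventually_elim (simp add: N_def invertible_det_nz)
qed

section \<open>Moments of the residual quadratic form of a Gaussian matrix\<close>

lemma inner_matrix_columns: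
  fixes A B :: "real^'q^'n"
  shows "A \<bullet> B = (\<Sum>j\<in>UNIV. column j A \<bullet> column j B)"
  by (simp add: inner_vec_def column_def) (rule sum.swap)

lemma nn_integral_std_gauss_left_orthogonal:
  fixes U :: "real^'n^'n" and f :: "real^'q^'n \<Rightarrow> ennreal"
  assumes U: "orthogonal_matrix U" and f: "f \<in> borel_measurable borel"
  shows "(\<integral>\<^sup>+Z. f (U ** Z) \<partial>std_gauss) = (\<integral>\<^sup>+Z. f Z \<partial>std_gauss)"
proof (rule nn_integral_std_gauss_isometry[OF _ _ _ f])
  show lin: "linear ((**) U :: real^'q^'n \<Rightarrow> _)"
    by (rule linearI) (simp_all add: vec_eq_iff matrix_matrix_mult_def sum.distrib sum_distrib_left algebra_simps)
  have "(U *v v) \<bullet> (U *v v) = v \<bullet> v" for v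
    using U by (simp add: matrix_vector_mul_assoc orthogonal_matrix flip: transpose_matrix_vector dot_lmul_matrix)
  moreover have "column j (U ** Z) = U *v column j Z" for j and Z :: "real^'q^'n"
    by (simp add: vec_eq_iff column_def matrix_matrix_mult_def matrix_vector_mult_def)
  ultimately show nrm: "norm (U ** Z) = norm Z" for Z :: "real^'q^'n"
    by (simp add: norm_eq_sqrt_inner inner_matrix_columns)
  show "bij ((**) U :: real^'q^'n \<Rightarrow> _)" by (rule linear_isometry_bij[OF lin nrm])
qed

text \<open>
  This is \<open>E [\<xi>\<^sup>2\<^sup>k] = 1 * 3 * \<dots> * (2 * k - 1)\<close> for a standard normal variable \<open>\<xi>\<close>.
\<close>

definition std_normal_even_moment :: "nat \<Rightarrow> real" where
  "std_normal_even_moment k = fact (2 * k) / (2 ^ k * fact k)"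

lemma std_normal_even_moment_pos: "0 < std_normal_even_moment k"
  by (simp add: std_normal_even_moment_def)

lemma nn_integral_quadratic_power:
  fixes j :: nat
  shows "(\<integral>\<^sup>+x. ennreal (((x::real^'n) \<bullet> x) ^ j) \<partial>std_gauss) = ennreal (2 ^ j * pochhammer (real CARD('n) / 2) j)"
proof -
  have B: "pairwise orthogonal (Basis :: (real^'n) set)" "\<And>b. b \<in> (Basis :: (real^'n) set) \<Longrightarrow> norm b = 1"
    by (auto simp: pairwise_def orthogonal_def inner_Basis)
  have *: "(\<Sum>b\<in>Basis. (b \<bullet> x)\<^sup>2) = x \<bullet> x" for x :: "real^'n"
    using euclidean_inner[of x x] by (simp add: power2_eq_square inner_commute)
  show ?thesis
    using integrable_quadratic_power[OF B, of j] integral_quadratic_power[OF B, of j]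
    by (subst nn_integral_eq_integral) (simp_all add: *)
qed

lemma nn_integral_linear_power:
  fixes v :: "'a::euclidean_space"
  shows "(\<integral>\<^sup>+x. ennreal ((v \<bullet> x) ^ (2 * k)) \<partial>std_gauss) = ennreal (std_normal_even_moment k * (v \<bullet> v) ^ k)"
  using integrable_quadratic_linear_power[of "{}::'a set" v 0 "2 * k"]
    integral_quadratic_linear_power[of "{}::'a set" v 0 k]
  by (subst nn_integral_eq_integral) (simp_all add: std_normal_even_moment_def)

lemma std_gauss_Fubini:
  fixes f :: "'a::euclidean_space \<Rightarrow> 'b::euclidean_space \<Rightarrow> ennreal"
  assumes "case_prod f \<in> borel_measurable borel"
  shows "(\<integral>\<^sup>+x. (\<integral>\<^sup>+y. f x y \<partial>std_gauss) \<partial>std_gauss) = (\<integral>\<^sup>+y. (\<integral>\<^sup>+x. f x y \<partial>std_gauss) \<partial>std_gauss)"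
proof -
  interpret A: prob_space "std_gauss :: 'a measure" by (rule prob_space_std_gauss)
  interpret B: prob_space "std_gauss :: 'b measure" by (rule prob_space_std_gauss)
  interpret pair_sigma_finite "std_gauss :: 'a measure" "std_gauss :: 'b measure" ..
  show ?thesis
    by (rule Fubini'[symmetric]) (use assms in \<open>simp add: std_gauss_pair\<close>)
qed

definition outer :: "real^'n \<Rightarrow> real^'q \<Rightarrow> real^'q^'n" where
  "outer a c = (\<chi> i j. a $ i * c $ j)"

lemma outer_inner: "outer a c \<bullet> Z = a \<bullet> (Z *v c)"
  by (simp add: outer_def inner_vec_def matrix_vector_mult_def sum_distrib_left mult_ac)

lemma outer_inner_outer: "outer a c \<bullet> outer a c = (a \<bullet> a) * (c \<bullet> c)"
  by (simp add: outer_def inner_vec_def sum_product mult_ac) (rule sum.swap)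

text \<open>
  For a Gaussian vector \<open>g\<close> independent of \<open>Z\<close>, the moment of \<open>g \<bullet> Z c\<close> is computed in two ways:
  given \<open>Z\<close> it is a linear function of \<open>g\<close>, given \<open>g\<close> it is a linear function of \<open>Z\<close>. So
  \<open>|Z c|\<^sup>2\<^sup>k\<close> has \<open>|c|\<^sup>2\<^sup>k\<close> times the moment of \<open>|g|\<^sup>2\<^sup>k\<close>.
\<close>

lemma nn_integral_norm_image_power:
  fixes c :: "real^'q"
  shows "(\<integral>\<^sup>+Z. ennreal (((Z *v c) \<bullet> ((Z::real^'q^'n) *v c)) ^ k) \<partial>std_gauss)
    = ennreal ((c \<bullet> c) ^ k * (2 ^ k * pochhammer (real CARD('n) / 2) k))"
proof -
  let ?\<mu> = "std_normal_even_moment k"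
  note pos = std_normal_even_moment_pos[of k]
  have m: "case_prod (\<lambda>(Z::real^'q^'n) (g::real^'n). ennreal ((outer g c \<bullet> Z) ^ (2 * k))) \<in> borel_measurable borel"
    unfolding outer_inner borel_prod[symmetric] by measurable
  have "ennreal ?\<mu> * (\<integral>\<^sup>+Z. ennreal (((Z *v c) \<bullet> ((Z::real^'q^'n) *v c)) ^ k) \<partial>std_gauss)
      = (\<integral>\<^sup>+Z. (\<integral>\<^sup>+g. ennreal ((((Z::real^'q^'n) *v c) \<bullet> g) ^ (2 * k)) \<partial>std_gauss) \<partial>std_gauss)"
    using pos by (simp add: nn_integral_linear_power ennreal_mult nn_integral_cmult)
  also have "\<dots> = (\<integral>\<^sup>+Z. (\<integral>\<^sup>+g. ennreal ((outer g c \<bullet> (Z::real^'q^'n)) ^ (2 * k)) \<partial>std_gauss) \<partial>std_gauss)"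
    unfolding outer_inner by (subst inner_commute) (rule refl)
  also have "\<dots> = (\<integral>\<^sup>+g. (\<integral>\<^sup>+Z. ennreal ((outer g c \<bullet> (Z::real^'q^'n)) ^ (2 * k)) \<partial>std_gauss) \<partial>std_gauss)"
    by (rule std_gauss_Fubini[OF m])
  also have "\<dots> = (\<integral>\<^sup>+g. ennreal (?\<mu> * (c \<bullet> c) ^ k) * ennreal (((g::real^'n) \<bullet> g) ^ k) \<partial>std_gauss)"
    using pos by (simp only: nn_integral_linear_power outer_inner_outer)
      (simp add: power_mult_distrib mult_ac flip: ennreal_mult)
  also have "\<dots> = ennreal (?\<mu> * (c \<bullet> c) ^ k) * ennreal (2 ^ k * pochhammer (real CARD('n) / 2) k)"
    by (simp add: nn_integral_cmult nn_integral_quadratic_power)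
  also have "\<dots> = ennreal ?\<mu> * ennreal ((c \<bullet> c) ^ k * (2 ^ k * pochhammer (real CARD('n) / 2) k))"
    using pos by (simp add: mult.assoc pochhammer_pos less_imp_le flip: ennreal_mult)
  finally show ?thesis
    using pos by (simp add: ennreal_mult_cancel_left)
qed

text \<open>
  Let \<open>J g\<close> be the integral with \<open>g\<close> in place of \<open>a\<close>. By homogeneity and rotation invariance
  \<open>J g = |g|\<^sup>2\<^sup>j\<^sup>+\<^sup>2\<^sup>k J a\<close>. Integrating over a Gaussian \<open>g\<close> gives \<open>J a\<close> times a moment of
  \<open>|g|\<close>; in the other order, the integral over \<open>g\<close> for fixed \<open>Z\<close> factors into a chi-square moment and a
  normal moment, since \<open>Z c\<close> is orthogonal to the range of the residual projection.
\<close>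

lemma nn_integral_residual_mixed_moment:
  fixes a :: "real^'n" and c :: "real^'q"
  assumes qn: "CARD('q) < CARD('n)" and a: "norm a = 1"
  shows "(\<integral>\<^sup>+Z. ennreal ((a \<bullet> (residual_projection Z *v a)) ^ j * (a \<bullet> (Z *v c)) ^ (2 * k)) \<partial>std_gauss)
    = ennreal (std_normal_even_moment k * (c \<bullet> c) ^ k * pochhammer (real CARD('n) / 2) k
        * pochhammer (real (CARD('n) - CARD('q)) / 2) j / pochhammer (real CARD('n) / 2) (j + k))"
proof -
  let ?\<mu> = "std_normal_even_moment k"
  let ?N = "\<lambda>i. 2 ^ i * pochhammer (real CARD('n) / 2) i :: real"
  let ?V = "2 ^ j * pochhammer (real (CARD('n) - CARD('q)) / 2) j :: real"
  define F where "F g Z = (g \<bullet> (residual_projection Z *v g)) ^ j * (g \<bullet> (Z *v c)) ^ (2 * k)"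
    for g :: "real^'n" and Z :: "real^'q^'n"
  define J where "J g = (\<integral>\<^sup>+Z. ennreal (F g Z) \<partial>std_gauss)" for g
  have [measurable]: "(\<lambda>Z. F g Z) \<in> borel_measurable borel" for g
    unfolding F_def by measurable
  have Fm: "case_prod (\<lambda>Z g. ennreal (F g Z)) \<in> borel_measurable borel"
    unfolding F_def by (simp add: case_prod_beta borel_prod[symmetric])
  note pos = std_normal_even_moment_pos[of k]
  have rot: "J g = ennreal ((g \<bullet> g) ^ (j + k)) * J a" for g
  proof -
    obtain f where f: "orthogonal_transformation f" "f (norm g *\<^sub>R a) = g"
      using orthogonal_transformation_exists[of "norm g *\<^sub>R a" g] a by auto
    define U where "U = matrix f"
    have U: "orthogonal_matrix U" "\<And>x. U *v x = f x"
      using f(1) by (auto simp: U_def orthogonal_transformation_matrix)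
    have "F g (U ** Z) = (g \<bullet> g) ^ (j + k) * F a Z" for Z
    proof -
      have g: "g = U *v (norm g *\<^sub>R a)" using f(2) U(2) by simp
      have UU: "(U *v x) \<bullet> (U *v y) = x \<bullet> y" for x y
        using f(1) by (simp add: U(2) orthogonal_transformation_def)
      have "g \<bullet> (residual_projection (U ** Z) *v g) = (g \<bullet> g) * (a \<bullet> (residual_projection Z *v a))"
        by (subst (1 2) g)
          (simp only: residual_projection_orthogonal_image[OF U(1)] UU,
            simp add: matrix_vector_mult_scaleR power2_eq_square[symmetric] power2_norm_eq_inner)
      moreover have "g \<bullet> ((U ** Z) *v c) = norm g * (a \<bullet> (Z *v c))"
        by (subst (1) g) (simp only: matrix_vector_mul_assoc[symmetric] UU, simp)
      moreover have "norm g ^ (2 * k) = (g \<bullet> g) ^ k"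
        by (simp add: power_mult power2_norm_eq_inner)
      ultimately show ?thesis by (simp add: F_def power_mult_distrib power_add)
    qed
    then have "J g = (\<integral>\<^sup>+Z. ennreal ((g \<bullet> g) ^ (j + k)) * ennreal (F a Z) \<partial>std_gauss)"
      unfolding J_def using nn_integral_std_gauss_left_orthogonal[OF U(1), of "\<lambda>Z. ennreal (F g Z)"]
      by (simp add: ennreal_mult')
    then show ?thesis by (simp add: nn_integral_cmult J_def)
  qed
  have "AE Z in (std_gauss :: (real^'q^'n) measure). invertible (transpose Z ** Z)"
    using qn by (intro std_gauss_absolutely_continuous AE_full_column_rank) simp
  then have "AE Z in std_gauss. (\<integral>\<^sup>+g. ennreal (F g Z) \<partial>std_gauss)
      = ennreal (?V * ?\<mu>) * ennreal (((Z *v c) \<bullet> (Z *v c)) ^ k)"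
  proof (eventually_elim)
    case (elim Z)
    obtain B where B: "pairwise orthogonal B" "\<And>b. b \<in> B \<Longrightarrow> norm b = 1" "card B + CARD('q) = CARD('n)"
        "\<And>b w. b \<in> B \<Longrightarrow> b \<bullet> (Z *v w) = 0"
        "\<And>x. residual_projection Z *v x = (\<Sum>b\<in>B. (b \<bullet> x) *\<^sub>R b)"
      by (rule residual_projection_orthonormal_basis[OF elim]) (rule that, assumption+)
    have card: "card B = CARD('n) - CARD('q)" using B(3) by simp
    have F: "F g Z = (\<Sum>b\<in>B. (b \<bullet> g)\<^sup>2) ^ j * ((Z *v c) \<bullet> g) ^ (2 * k)" for g
      by (simp only: F_def residual_quadratic_form_sum[OF B(5)] inner_commute[of g "Z *v c"])
    have "(\<integral>\<^sup>+g. ennreal (F g Z) \<partial>std_gauss) = ennreal (?V * (?\<mu> * ((Z *v c) \<bullet> (Z *v c)) ^ k))"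
      unfolding F
      using integrable_quadratic_linear_power[OF B(1,2), of "Z *v c" j "2 * k"]
        integral_quadratic_linear_power[OF B(1,2), of "Z *v c" j k] B(4)
      by (subst nn_integral_eq_integral)
        (simp_all add: sum_nonneg card std_normal_even_moment_def zero_le_even_power)
    also have "\<dots> = ennreal (?V * ?\<mu>) * ennreal (((Z *v c) \<bullet> (Z *v c)) ^ k)"
      by (subst mult.assoc[symmetric], rule ennreal_mult'') simp
    finally show ?case .
  qed
  then have "(\<integral>\<^sup>+Z. (\<integral>\<^sup>+g. ennreal (F g Z) \<partial>std_gauss) \<partial>std_gauss)
      = (\<integral>\<^sup>+Z. ennreal (?V * ?\<mu>) * ennreal (((Z *v c) \<bullet> ((Z::real^'q^'n) *v c)) ^ k) \<partial>std_gauss)"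
    by (rule nn_integral_cong_AE)
  also have "\<dots> = ennreal (?V * ?\<mu>) * ennreal ((c \<bullet> c) ^ k * ?N k)"
    by (simp add: nn_integral_cmult nn_integral_norm_image_power)
  also have "(\<integral>\<^sup>+Z. (\<integral>\<^sup>+g. ennreal (F g Z) \<partial>std_gauss) \<partial>std_gauss)
      = (\<integral>\<^sup>+g. J g \<partial>std_gauss)"
    unfolding J_def by (rule std_gauss_Fubini[OF Fm])
  also have "\<dots> = (\<integral>\<^sup>+g. ennreal (((g::real^'n) \<bullet> g) ^ (j + k)) * J a \<partial>std_gauss)"
    by (rule nn_integral_cong) (rule rot)
  also have "\<dots> = J a * ennreal (?N (j + k))"
    by (subst nn_integral_multc) (simp_all add: nn_integral_quadratic_power mult.commute)
  finally have eq: "J a * ennreal (?N (j + k)) = ennreal (?V * ?\<mu> * ((c \<bullet> c) ^ k * ?N k))"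
    using pos by (simp add: pochhammer_nonneg qn ennreal_mult')
  have N: "?N (j + k) > 0" by (simp add: pochhammer_pos)
  then have "J a = J a * ennreal (?N (j + k)) / ennreal (?N (j + k))"
    by (intro mult_divide_eq_ennreal[symmetric]) auto
  also have "\<dots> = ennreal (?V * ?\<mu> * ((c \<bullet> c) ^ k * ?N k) / ?N (j + k))"
    unfolding eq using N pos qn by (intro divide_ennreal) (simp_all add: pochhammer_nonneg)
  also have "?V * ?\<mu> * ((c \<bullet> c) ^ k * ?N k) / ?N (j + k) = ?\<mu> * (c \<bullet> c) ^ k * pochhammer (real CARD('n) / 2) k
        * pochhammer (real (CARD('n) - CARD('q)) / 2) j / pochhammer (real CARD('n) / 2) (j + k)"
    by (simp add: power_add)
  finally show ?thesis by (simp add: J_def F_def)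
qed

section \<open>Moments of the noncentral beta distribution\<close>

lemma pochhammer_ratio_bounds:
  fixes a s :: real
  assumes "0 < a" "a \<le> s"
  shows "0 \<le> pochhammer a j / pochhammer s j" "pochhammer a j / pochhammer s j \<le> 1"
proof -
  have "0 < pochhammer a j \<and> pochhammer a j \<le> pochhammer s j"
  proof (induction j)
    case (Suc j)
    then have "pochhammer a j * (a + real j) \<le> pochhammer s j * (s + real j)"
      using assms by (intro mult_mono) auto
    then show ?case using Suc assms by (simp add: pochhammer_Suc)
  qed simp
  then show "0 \<le> pochhammer a j / pochhammer s j" "pochhammer a j / pochhammer s j \<le> 1"
    by (simp_all add: divide_le_eq_1)
qed

lemma pochhammer_ratio_swap:
  fixes s :: real
  assumes "0 < s"
  shows "pochhammer s m / pochhammer s (m + j) = 1 / pochhammer (s + real m) j"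
  using assms pochhammer_pos[of s m] by (simp add: pochhammer_product')

lemma summable_exp_weight:
  fixes x :: real and r :: "nat \<Rightarrow> real"
  assumes "\<And>l. \<bar>r l\<bar> \<le> K"
  shows "summable (\<lambda>l. x ^ l / fact l * r l)"
proof (rule summable_comparison_test')
  show "summable (\<lambda>l. \<bar>x\<bar> ^ l / fact l * K)"
    using summable_mult2[OF summable_exp[of "\<bar>x\<bar>"], of K] by (simp add: field_simps)
  show "norm (x ^ l / fact l * r l) \<le> \<bar>x\<bar> ^ l / fact l * K" for l
    using mult_left_mono[OF assms[of l], of "\<bar>x\<bar> ^ l / fact l"] by (simp add: abs_mult power_abs)
qed

text \<open>
  The \<open>j\<close>-th moment of the density \<open>noncentral_beta_density a b t\<close>: the Poisson mixture of the moments
  \<open>pochhammer a j / pochhammer (a + b + l) j\<close> of the Beta\<open>(a, b + l)\<close> distributions.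
\<close>

definition noncentral_beta_moment :: "real \<Rightarrow> real \<Rightarrow> real \<Rightarrow> nat \<Rightarrow> real" where
  "noncentral_beta_moment a b t j
    = exp (- t / 2) * (\<Sum>l. (t / 2) ^ l / fact l * (pochhammer a j / pochhammer (a + b + real l) j))"

lemma noncentral_beta_moment_sums:
  assumes "0 < a" "0 < b"
  shows "(\<lambda>l. exp (- t / 2) * ((t / 2) ^ l / fact l * (pochhammer a j / pochhammer (a + b + real l) j)))
    sums noncentral_beta_moment a b t j"
proof -
  have "\<bar>pochhammer a j / pochhammer (a + b + real l) j\<bar> \<le> 1" for l
    using pochhammer_ratio_bounds[of a "a + b + real l" j] assms by simp
  from summable_exp_weight[OF this] show ?thesis
    unfolding noncentral_beta_moment_def by (intro sums_mult summable_sums)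
qed

lemma residual_projection_minus:
  "residual_projection (- A) *v x = residual_projection A *v (x :: real^'n)" for A :: "real^'q^'n"
proof -
  have "transpose (- A) ** (- A) = transpose A ** A"
    by (simp add: transpose_def matrix_matrix_mult_def vec_eq_iff)
  moreover have "(- A) *v y = - (A *v y)" for y
    by (simp add: matrix_vector_mult_def vec_eq_iff sum_negf)
  moreover have "x v* (- A) = - (x v* A)"
    by (simp add: vector_matrix_mult_def vec_eq_iff sum_negf)
  moreover have "C *v (- y) = - (C *v y)" for C :: "real^'q^'q" and y
    by (simp add: matrix_vector_mult_def vec_eq_iff sum_negf)
  moreover have "A *v (- y) = - (A *v y)" for y
    by (simp add: matrix_vector_mult_def vec_eq_iff sum_negf)
  ultimately show ?thesis by (simp add: residual_projection_vector)
qed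

text \<open>
  The mean \<open>outer a c\<close> is removed by the shift formula, which brings in the factor \<open>exp (L Z)\<close>. The central
  law is symmetric under \<open>Z \<mapsto> - Z\<close>, so the factor may be replaced by \<open>cosh (L Z)\<close>, whose series has
  nonnegative terms and may be integrated termwise.
\<close>

lemma nn_integral_residual_moment:
  fixes a :: "real^'n" and c :: "real^'q"
  assumes qn: "CARD('q) < CARD('n)" and a: "norm a = 1"
  shows "(\<integral>\<^sup>+Z. ennreal ((a \<bullet> (residual_projection (Z + outer a c) *v a)) ^ j) \<partial>std_gauss)
    = ennreal (noncentral_beta_moment (real (CARD('n) - CARD('q)) / 2) (real CARD('q) / 2) (c \<bullet> c) j)"
proof -
  let ?\<nu> = "real (CARD('n) - CARD('q)) / 2" and ?b = "real CARD('q) / 2" and ?\<tau> = "c \<bullet> c"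
  define V where "V Z = (a \<bullet> (residual_projection Z *v a)) ^ j" for Z :: "real^'q^'n"
  define L where "L Z = a \<bullet> (Z *v c)" for Z :: "real^'q^'n"
  have [measurable]: "V \<in> borel_measurable borel" "L \<in> borel_measurable borel"
    unfolding V_def[abs_def] L_def[abs_def] by measurable
  have ab: "?\<nu> + ?b = real CARD('n) / 2" using qn by (simp add: of_nat_diff field_simps)
  have 1: "outer a c \<bullet> outer a c = ?\<tau>"
    using a by (simp add: outer_inner_outer norm_eq_1)
  have "(\<integral>\<^sup>+Z. ennreal (V (Z + outer a c)) \<partial>std_gauss)
      = (\<integral>\<^sup>+Z. ennreal (V Z) * ennreal (exp (L Z - ?\<tau> / 2)) \<partial>std_gauss)"
    unfolding 1[symmetric] L_def outer_inner[symmetric] by (rule nn_integral_std_gauss_shift) simp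
  also have "\<dots> = (\<integral>\<^sup>+Z. ennreal (V Z * exp (L Z)) * ennreal (exp (- ?\<tau> / 2)) \<partial>std_gauss)"
    by (intro nn_integral_cong)
      (simp only: diff_conv_add_uminus exp_add ennreal_mult''[OF exp_ge_zero] mult.assoc minus_divide_left)
  also have "\<dots> = (\<integral>\<^sup>+Z. ennreal (V Z * exp (L Z)) \<partial>std_gauss) * ennreal (exp (- ?\<tau> / 2))"
    by (rule nn_integral_multc) simp
  also have "(\<integral>\<^sup>+Z. ennreal (V Z * exp (L Z)) \<partial>std_gauss) = (\<integral>\<^sup>+Z. ennreal (V Z * cosh (L Z)) \<partial>std_gauss)"
  proof -
    have m: "linear (uminus :: real^'q^'n \<Rightarrow> _)" "bij (uminus :: real^'q^'n \<Rightarrow> _)"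
      by (auto simp: bij_uminus intro!: linear_uminus)
    have VL: "V (- Z) = V Z" "L (- Z) = - L Z" for Z
      by (simp_all add: V_def L_def residual_projection_minus,
          simp add: matrix_vector_mult_def inner_vec_def sum_negf)
    have e: "(\<integral>\<^sup>+Z. ennreal (V Z * exp (L Z)) \<partial>std_gauss) = (\<integral>\<^sup>+Z. ennreal (V Z * exp (- L Z)) \<partial>std_gauss)"
      using nn_integral_std_gauss_isometry[OF m, of "\<lambda>Z. ennreal (V Z * exp (L Z))"] by (simp add: VL)
    have c: "ennreal (V Z * cosh (L Z)) = ennreal (1/2) * (ennreal (V Z * exp (L Z)) + ennreal (V Z * exp (- L Z)))" for Z
    proof -
      have "ennreal (V Z * cosh (L Z)) = ennreal (V Z) * ennreal (1/2 * (exp (L Z) + exp (- L Z)))"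
        by (subst ennreal_mult''[symmetric]) (simp_all add: cosh_def)
      also have "ennreal (1/2 * (exp (L Z) + exp (- L Z))) = ennreal (1/2) * (ennreal (exp (L Z)) + ennreal (exp (- L Z)))"
        by (subst ennreal_mult) (simp_all add: ennreal_plus)
      finally show ?thesis by (simp add: ennreal_mult'' distrib_left mult_ac)
    qed
    have "(\<integral>\<^sup>+Z. ennreal (V Z * cosh (L Z)) \<partial>std_gauss) = ennreal (1/2) *
        ((\<integral>\<^sup>+Z. ennreal (V Z * exp (L Z)) \<partial>std_gauss) + (\<integral>\<^sup>+Z. ennreal (V Z * exp (- L Z)) \<partial>std_gauss))"
      by (simp add: c nn_integral_cmult nn_integral_add)
    also have "\<dots> = (ennreal (1/2) * 2) * (\<integral>\<^sup>+Z. ennreal (V Z * exp (L Z)) \<partial>std_gauss)"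
      by (simp only: e[symmetric] mult_2[symmetric] mult.assoc)
    also have "ennreal (1/2) * 2 = 1"
      using ennreal_mult[of "1/2" 2] by simp
    finally show ?thesis by simp
  qed
  also have "\<dots> = (\<integral>\<^sup>+Z. (\<Sum>k. ennreal (1 / fact (2 * k)) * ennreal (V Z * L Z ^ (2 * k))) \<partial>std_gauss)"
  proof (rule nn_integral_cong)
    fix Z
    have "(\<lambda>n. if even n then L Z ^ n /\<^sub>R fact n else 0) sums cosh (L Z)" by (rule cosh_converges)
    then have "(\<lambda>k. L Z ^ (2 * k) / fact (2 * k)) sums cosh (L Z)"
      by (subst (asm) sums_mono_reindex[of "\<lambda>k. 2 * k", symmetric])
        (auto simp: strict_mono_def image_iff field_simps elim!: evenE)
    then have "(\<Sum>k. ennreal (L Z ^ (2 * k) / fact (2 * k))) = ennreal (cosh (L Z))"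
      by (intro suminf_ennreal_eq) (simp_all add: zero_le_even_power)
    then have "ennreal (V Z * cosh (L Z)) = ennreal (V Z) * (\<Sum>k. ennreal (L Z ^ (2 * k) / fact (2 * k)))"
      by (simp add: ennreal_mult'' cosh_real_nonneg)
    also have "\<dots> = (\<Sum>k. ennreal (V Z) * ennreal (L Z ^ (2 * k) / fact (2 * k)))"
      by (rule ennreal_suminf_cmult[symmetric])
    also have "\<dots> = (\<Sum>k. ennreal (1 / fact (2 * k)) * ennreal (V Z * L Z ^ (2 * k)))"
    proof (rule arg_cong[where f=suminf], rule ext)
      fix k
      have "ennreal (V Z) * ennreal (L Z ^ (2 * k) / fact (2 * k)) = ennreal (V Z * (L Z ^ (2 * k) / fact (2 * k)))"
        by (rule ennreal_mult''[symmetric]) (simp add: zero_le_even_power)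
      also have "\<dots> = ennreal (1 / fact (2 * k)) * ennreal (V Z * L Z ^ (2 * k))"
        by (subst ennreal_mult'[symmetric]) simp_all
      finally show "ennreal (V Z) * ennreal (L Z ^ (2 * k) / fact (2 * k))
          = ennreal (1 / fact (2 * k)) * ennreal (V Z * L Z ^ (2 * k))" .
    qed
    finally show "ennreal (V Z * cosh (L Z)) = (\<Sum>k. ennreal (1 / fact (2 * k)) * ennreal (V Z * L Z ^ (2 * k)))" .
  qed
  also have "\<dots> = (\<Sum>k. ennreal (1 / fact (2 * k)) * (\<integral>\<^sup>+Z. ennreal (V Z * L Z ^ (2 * k)) \<partial>std_gauss))"
    by (subst nn_integral_suminf) (simp_all add: nn_integral_cmult)
  also have "\<dots> = (\<Sum>k. ennreal ((?\<tau> / 2) ^ k / fact k * (pochhammer ?\<nu> j / pochhammer (?\<nu> + ?b + real k) j)))"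
  proof (rule arg_cong[where f=suminf], rule ext)
    fix k
    have s: "0 < real CARD('n) / 2" by simp
    have "1 / fact (2 * k) * (std_normal_even_moment k * ?\<tau> ^ k * pochhammer (real CARD('n) / 2) k
        * pochhammer ?\<nu> j / pochhammer (real CARD('n) / 2) (j + k))
      = ?\<tau> ^ k / 2 ^ k / fact k * pochhammer ?\<nu> j
        * (pochhammer (real CARD('n) / 2) k / pochhammer (real CARD('n) / 2) (k + j))"
      by (simp add: std_normal_even_moment_def add.commute)
    also have "\<dots> = (?\<tau> / 2) ^ k / fact k * (pochhammer ?\<nu> j / pochhammer (?\<nu> + ?b + real k) j)"
      unfolding pochhammer_ratio_swap[OF s] ab by (simp add: power_divide)
    finally have eq: "1 / fact (2 * k) * (std_normal_even_moment k * ?\<tau> ^ k * pochhammer (real CARD('n) / 2) k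
        * pochhammer ?\<nu> j / pochhammer (real CARD('n) / 2) (j + k))
      = (?\<tau> / 2) ^ k / fact k * (pochhammer ?\<nu> j / pochhammer (?\<nu> + ?b + real k) j)" .
    show "ennreal (1 / fact (2 * k)) * (\<integral>\<^sup>+Z. ennreal (V Z * L Z ^ (2 * k)) \<partial>std_gauss)
      = ennreal ((?\<tau> / 2) ^ k / fact k * (pochhammer ?\<nu> j / pochhammer (?\<nu> + ?b + real k) j))"
      unfolding V_def L_def nn_integral_residual_mixed_moment[OF qn a] eq[symmetric]
      by (rule ennreal_mult'[symmetric]) simp
  qed
  also have "\<dots> * ennreal (exp (- ?\<tau> / 2))
      = (\<Sum>k. ennreal (exp (- ?\<tau> / 2) * ((?\<tau> / 2) ^ k / fact k * (pochhammer ?\<nu> j / pochhammer (?\<nu> + ?b + real k) j))))"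
    by (simp only: ennreal_mult'[OF exp_ge_zero] ennreal_suminf_cmult) (rule mult.commute)
  also have "\<dots> = ennreal (noncentral_beta_moment ?\<nu> ?b ?\<tau> j)"
    using qn by (intro suminf_ennreal_eq noncentral_beta_moment_sums) (auto simp: pochhammer_nonneg add_pos_nonneg)
  finally show ?thesis by (simp add: V_def)
qed

lemma nn_integral_beta_kernel:
  fixes a b :: real
  assumes "0 < a" "0 < b"
  shows "(\<integral>\<^sup>+x. ennreal (indicator {0<..<1} x * (x ^ j * (x powr (a - 1) * (1 - x) powr (b - 1)))) \<partial>lborel)
    = ennreal (Beta (a + real j) b)"
proof -
  have "((\<lambda>x. x powr (a + real j - 1) * (1 - x) powr (b - 1)) has_integral Beta (a + real j) b) {0<..<1}"
    using has_integral_Beta_real[of "a + real j" b] assms by (simp add: has_integral_Icc_iff_Ioo)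
  then have "(\<integral>\<^sup>+x. ennreal (indicator {0<..<1} x * (x powr (a + real j - 1) * (1 - x) powr (b - 1))) \<partial>lborel)
      = ennreal (Beta (a + real j) b)"
    by (intro nn_integral_has_integral_lebesgue) auto
  moreover have "x ^ j * x powr (a - 1) = x powr (a + real j - 1)" if "0 < x" for x :: real
    using that by (simp flip: powr_realpow powr_add add: algebra_simps)
  then have "indicator {0<..<1} x * (x ^ j * (x powr (a - 1) * (1 - x) powr (b - 1)))
      = indicator {0<..<1} x * (x powr (a + real j - 1) * (1 - x) powr (b - 1))" for x :: real
    by (auto simp: indicator_def simp flip: mult.assoc)
  ultimately show ?thesis by (simp only:)
qed

lemma Beta_real_positive:
  fixes a b :: real
  assumes "0 < a" "0 < b"
  shows "0 < Beta a b"
  using assms by (simp add: Beta_def Gamma_real_pos)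

text \<open>
  The left-hand side is the \<open>j\<close>-th moment of the Beta\<open>(a, b)\<close> distribution; both beta values are quotients of
  Gamma values.
\<close>

lemma Beta_shift_ratio:
  fixes a b :: real
  assumes "0 < a" "0 < b"
  shows "Beta (a + real j) b / Beta a b = pochhammer a j / pochhammer (a + b) j"
proof -
  have P: "pochhammer a j = Gamma (a + real j) / Gamma a" "pochhammer (a + b) j = Gamma (a + b + real j) / Gamma (a + b)"
    using assms by (auto intro!: pochhammer_Gamma)
  have "Gamma x \<noteq> 0" if "0 < x" for x :: real
    using Gamma_real_pos[OF that] by linarith
  then have "Gamma a \<noteq> 0" "Gamma b \<noteq> 0" "Gamma (a + b) \<noteq> 0" "Gamma (a + b + real j) \<noteq> 0"
    using assms by (simp_all add: add_pos_nonneg)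
  then show ?thesis unfolding P Beta_def by (simp add: field_simps)
qed

text \<open>
  The reciprocal beta values grow at most like \<open>K\<^sup>l\<close> with \<open>K = 1 + a / b\<close>, since each factor
  \<open>(a + b + i) / (b + i)\<close> of their Pochhammer quotient is at most \<open>K\<close>.
\<close>

lemma summable_noncentral_beta_terms:
  fixes a b t x :: real
  assumes ab: "0 < a" "0 < b" and x: "0 < x" "x < 1"
  shows "summable (\<lambda>l. (t / 2) ^ l / fact l *
             (x powr (a - 1) * (1 - x) powr (b + real l - 1) / Beta a (b + real l)))"
proof -
  define K where "K = 1 + a / b"
  have K: "0 < K" using ab by (simp add: K_def add_pos_pos)
  define C where "C = x powr (a - 1) * (1 - x) powr (b - 1) / Beta a b"
  have C: "0 \<le> C" using ab Beta_real_positive[of a b] by (simp add: C_def)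
  define r where "r l = C * (pochhammer (a + b) l / (pochhammer b l * K ^ l))" for l
  have p: "0 \<le> pochhammer (a + b) l \<and> pochhammer (a + b) l \<le> pochhammer b l * K ^ l" for l
  proof (induction l)
    case (Suc l)
    have "a + b + real l \<le> (b + real l) * K"
      using ab by (simp add: K_def field_simps)
    then have "pochhammer (a + b) l * (a + b + real l) \<le> pochhammer b l * K ^ l * ((b + real l) * K)"
      using Suc ab by (intro mult_mono) auto
    then show ?case using Suc ab by (simp add: pochhammer_Suc mult_ac)
  qed simp
  have "\<bar>r l\<bar> \<le> C" for l
  proof -
    have "pochhammer (a + b) l / (pochhammer b l * K ^ l) \<le> 1"
      using p[of l] K pochhammer_pos[OF ab(2), of l] by (simp add: divide_le_eq_1)
    moreover have "0 \<le> pochhammer (a + b) l / (pochhammer b l * K ^ l)"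
      using p[of l] K pochhammer_pos[OF ab(2), of l] by (intro divide_nonneg_pos mult_pos_pos) auto
    ultimately have "0 \<le> r l" "r l \<le> C"
      unfolding r_def using C by (blast intro: mult_nonneg_nonneg mult_left_le)+
    then show ?thesis by simp
  qed
  from summable_exp_weight[OF this, of "t / 2 * (1 - x) * K"]
  have "summable (\<lambda>l. (t / 2 * (1 - x) * K) ^ l / fact l * r l)" .
  moreover have "(t / 2 * (1 - x) * K) ^ l / fact l * r l
      = (t / 2) ^ l / fact l * (x powr (a - 1) * (1 - x) powr (b + real l - 1) / Beta a (b + real l))" for l
  proof -
    have "(1 - x) powr (b + real l - 1) = (1 - x) powr (b - 1) * (1 - x) ^ l"
      using x by (simp flip: powr_realpow powr_add add: algebra_simps)
    moreover have "pochhammer (a + b) l / pochhammer b l / Beta a b = 1 / Beta a (b + real l)"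
      using Beta_shift_ratio[OF ab(2,1), of l] ab Beta_real_positive[of a b] Beta_real_positive[of a "b + real l"]
        pochhammer_pos[OF ab(2), of l] pochhammer_pos[of "a + b" l]
      by (simp add: Beta_commute[of b] Beta_commute[of "b + real l"] add.commute field_simps)
    moreover have "(t / 2 * (1 - x) * K) ^ l / fact l * r l
      = (t / 2) ^ l / fact l * (x powr (a - 1) * ((1 - x) powr (b - 1) * (1 - x) ^ l)
          * (pochhammer (a + b) l / pochhammer b l / Beta a b))"
      using K by (simp only: power_mult_distrib) (simp add: r_def C_def mult_ac)
    ultimately show ?thesis by simp
  qed
  ultimately show ?thesis by simp
qed

lemma noncentral_beta_density_nonneg:
  assumes "0 < a" "0 < b" "0 \<le> t"
  shows "0 \<le> noncentral_beta_density a b t x"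
proof (cases "0 < x \<and> x < 1")
  case True
  have "0 \<le> (\<Sum>l. (t / 2) ^ l / fact l *
      (x powr (a - 1) * (1 - x) powr (b + real l - 1) / Beta a (b + real l)))"
  proof (rule suminf_nonneg)
    show "0 \<le> (t / 2) ^ l / fact l * (x powr (a - 1) * (1 - x) powr (b + real l - 1) / Beta a (b + real l))" for l
      using assms Beta_real_positive[of a "b + real l"] by simp
  qed (use assms True in \<open>intro summable_noncentral_beta_terms\<close>, simp_all)
  then show ?thesis using True unfolding noncentral_beta_density_def by (simp only: if_True simp_thms) simp
next
  case False
  then show ?thesis unfolding noncentral_beta_density_def by (simp only: if_False)
qed

lemma borel_measurable_noncentral_beta_density [measurable]:
  "noncentral_beta_density a b t \<in> borel_measurable borel"
  unfolding noncentral_beta_density_def[abs_def] by measurable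

lemma nn_integral_noncentral_beta_moment:
  fixes a b t :: real
  assumes ab: "0 < a" "0 < b" and t: "0 \<le> t"
  shows "(\<integral>\<^sup>+x. ennreal (noncentral_beta_density a b t x) * ennreal (x ^ j) \<partial>lborel)
    = ennreal (noncentral_beta_moment a b t j)"
proof -
  let ?k = "\<lambda>l x. indicator {0<..<1} x * (x ^ j * (x powr (a - 1) * (1 - x) powr (b + real l - 1)))"
  let ?c = "\<lambda>l. exp (- t / 2) * ((t / 2) ^ l / fact l) / Beta a (b + real l)"
  have B: "0 < Beta a (b + real l)" for l using ab by (intro Beta_real_positive) auto
  have c: "0 \<le> ?c l" for l using t less_imp_le[OF B[of l]] by simp
  have "(\<integral>\<^sup>+x. ennreal (noncentral_beta_density a b t x) * ennreal (x ^ j) \<partial>lborel)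
      = (\<integral>\<^sup>+x. (\<Sum>l. ennreal (?c l) * ennreal (?k l x)) \<partial>lborel)"
  proof (rule nn_integral_cong)
    fix x :: real
    show "ennreal (noncentral_beta_density a b t x) * ennreal (x ^ j) = (\<Sum>l. ennreal (?c l) * ennreal (?k l x))"
    proof (cases "0 < x \<and> x < 1")
      case False
      then show ?thesis by (auto simp: noncentral_beta_density_def)
    next
      case True
      let ?T = "\<lambda>l. (t / 2) ^ l / fact l *
             (x powr (a - 1) * (1 - x) powr (b + real l - 1) / Beta a (b + real l))"
      have dens: "noncentral_beta_density a b t x = exp (- t / 2) * (\<Sum>l. ?T l)"
        using True by (simp add: noncentral_beta_density_def)
      have "?T sums (\<Sum>l. ?T l)"
        using summable_noncentral_beta_terms[OF ab, of x t] True by (intro summable_sums) auto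
      then have "(\<lambda>l. exp (- t / 2) * ?T l * x ^ j) sums (noncentral_beta_density a b t x * x ^ j)"
        unfolding dens by (intro sums_mult sums_mult2)
      moreover have "exp (- t / 2) * ?T l * x ^ j = ?c l * ?k l x" for l
        using True by simp
      ultimately have "(\<lambda>l. ?c l * ?k l x) sums (noncentral_beta_density a b t x * x ^ j)" by (simp only:)
      then have "(\<Sum>l. ennreal (?c l * ?k l x)) = ennreal (noncentral_beta_density a b t x * x ^ j)"
        using c True by (intro suminf_ennreal_eq mult_nonneg_nonneg) auto
      then show ?thesis
        using True c noncentral_beta_density_nonneg[OF ab t, of x] by (simp add: ennreal_mult' del: times_divide_eq_right times_divide_eq_left)
    qed
  qed
  also have "\<dots> = (\<Sum>l. ennreal (?c l) * (\<integral>\<^sup>+x. ennreal (?k l x) \<partial>lborel))"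
    by (subst nn_integral_suminf) (simp_all add: nn_integral_cmult)
  also have "\<dots> = (\<Sum>l. ennreal (exp (- t / 2) * ((t / 2) ^ l / fact l * (pochhammer a j / pochhammer (a + b + real l) j))))"
  proof (rule arg_cong[where f=suminf], rule ext)
    fix l
    have "(\<integral>\<^sup>+x. ennreal (?k l x) \<partial>lborel) = ennreal (Beta (a + real j) (b + real l))"
      using ab by (intro nn_integral_beta_kernel) auto
    then have "ennreal (?c l) * (\<integral>\<^sup>+x. ennreal (?k l x) \<partial>lborel) = ennreal (?c l * Beta (a + real j) (b + real l))"
      by (simp only: ennreal_mult'[OF c])
    also have "?c l * Beta (a + real j) (b + real l)
        = exp (- t / 2) * ((t / 2) ^ l / fact l * (Beta (a + real j) (b + real l) / Beta a (b + real l)))"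
      by simp
    also have "Beta (a + real j) (b + real l) / Beta a (b + real l) = pochhammer a j / pochhammer (a + b + real l) j"
      using Beta_shift_ratio[of a "b + real l" j] ab by (simp add: add.assoc)
    finally show "ennreal (?c l) * (\<integral>\<^sup>+x. ennreal (?k l x) \<partial>lborel)
      = ennreal (exp (- t / 2) * ((t / 2) ^ l / fact l * (pochhammer a j / pochhammer (a + b + real l) j)))" .
  qed
  also have "\<dots> = ennreal (noncentral_beta_moment a b t j)"
    using ab t by (intro suminf_ennreal_eq noncentral_beta_moment_sums) (auto simp: pochhammer_nonneg add_pos_nonneg)
  finally show ?thesis .
qed

lemma noncentral_beta_moment_nonneg:
  assumes "0 < a" "0 < b" "0 \<le> t"
  shows "0 \<le> noncentral_beta_moment a b t j"
  using assms by (intro sums_le[OF _ sums_zero noncentral_beta_moment_sums])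
    (auto simp: pochhammer_nonneg add_pos_nonneg)

lemma noncentral_beta_moment_0:
  "noncentral_beta_moment a b t 0 = 1"
proof -
  have "(\<Sum>l. (t / 2) ^ l / fact l) = exp (t / 2)"
    using exp_converges[of "t / 2"] by (simp add: sums_iff field_simps)
  then show ?thesis by (simp add: noncentral_beta_moment_def mult_exp_exp)
qed

text \<open>
  Fubini for double series, as termwise integration with respect to counting measure.
\<close>

lemma suminf_swap:
  fixes f :: "nat \<Rightarrow> nat \<Rightarrow> real"
  assumes g: "summable g" and h: "summable h" and bd: "\<And>i l. \<bar>f i l\<bar> \<le> g i * h l"
  shows "(\<Sum>i. \<Sum>l. f i l) = (\<Sum>l. \<Sum>i. f i l)"
proof -
  let ?M = "count_space (UNIV :: nat set)"
  have sl: "summable (\<lambda>l. \<bar>f i l\<bar>)" for i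
    by (rule summable_comparison_test'[OF summable_mult[OF h, of "g i"]]) (simp add: bd)
  have si: "summable (\<lambda>i. \<bar>f i l\<bar>)" for l
    by (rule summable_comparison_test'[OF summable_mult2[OF g, of "h l"]]) (simp add: bd)
  have int: "integrable ?M (f i)" for i
    using sl[of i] by (simp add: integrable_count_space_nat_iff)
  have sn: "summable (\<lambda>i. \<integral>l. norm (f i l) \<partial>?M)"
  proof (rule summable_comparison_test'[OF summable_mult2[OF g, of "\<Sum>l. h l"]])
    fix i
    have "(\<integral>l. norm (f i l) \<partial>?M) = (\<Sum>l. \<bar>f i l\<bar>)"
      using sl[of i] by (subst integral_count_space_nat) (simp_all add: integrable_count_space_nat_iff)
    also have "\<dots> \<le> (\<Sum>l. g i * h l)"
      by (intro suminf_le bd sl summable_mult h)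
    finally show "norm (\<integral>l. norm (f i l) \<partial>?M) \<le> g i * (\<Sum>l. h l)"
      by (simp add: suminf_mult[OF h])
  qed
  have "(\<Sum>i. \<integral>l. f i l \<partial>?M) = (\<integral>l. (\<Sum>i. f i l) \<partial>?M)"
    using si by (intro integral_suminf[symmetric] int sn AE_I2) simp
  also have "\<dots> = (\<Sum>l. \<Sum>i. f i l)"
    using si by (intro integral_count_space_nat integrable_suminf int sn AE_I2) simp
  also have "(\<Sum>i. \<integral>l. f i l \<partial>?M) = (\<Sum>i. \<Sum>l. f i l)"
    using int by (simp add: integral_count_space_nat)
  finally show ?thesis .
qed

section \<open>A distribution on the unit interval is determined by its moments\<close>

text \<open>
  The Taylor polynomials of the characteristic function are determined by the moments, and for a bounded variable their
  error tends to 0.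
\<close>

lemma moments_determine_distribution:
  fixes M N :: "real measure"
  assumes M: "real_distribution M" and N: "real_distribution N"
    and bM: "AE x in M. \<bar>x\<bar> \<le> 1" and bN: "AE x in N. \<bar>x\<bar> \<le> 1"
    and eq: "\<And>k. (\<integral>x. x ^ k \<partial>M) = (\<integral>x. x ^ k \<partial>N)"
  shows "M = N"
proof (rule Levy_uniqueness[OF M N], rule ext)
  fix t :: real
  have *: "integrable K (\<lambda>x. x ^ k)"
      "cmod (char K t - (\<Sum>k \<le> n. ((\<i> * t) ^ k / fact k) * (\<integral>x. x ^ k \<partial>K))) \<le> 2 * (\<bar>t\<bar> ^ n / fact n)"
    if K: "real_distribution K" and b: "AE x in K. \<bar>x\<bar> \<le> 1" for K :: "real measure" and k n
  proof -
    interpret K: real_distribution K by (rule K)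
    have b': "AE x in K. norm (x ^ k) \<le> 1" for k
      using b by eventually_elim (simp add: power_abs power_le_one)
    have i: "integrable K (\<lambda>x. x ^ k)" for k
      by (rule K.integrable_const_bound[OF b']) simp
    then show "integrable K (\<lambda>x. x ^ k)" .
    have "(\<integral>x. \<bar>x\<bar> ^ n \<partial>K) \<le> (\<integral>x. 1 \<partial>K)"
      using b'[of n] i[of n, THEN integrable_abs] by (intro integral_mono_AE) (auto simp: power_abs)
    then have "2 * \<bar>t\<bar> ^ n / fact n * (\<integral>x. \<bar>x\<bar> ^ n \<partial>K) \<le> 2 * \<bar>t\<bar> ^ n / fact n * 1"
      using K.prob_space by (intro mult_left_mono) auto
    then show "cmod (char K t - (\<Sum>k \<le> n. ((\<i> * t) ^ k / fact k) * (\<integral>x. x ^ k \<partial>K))) \<le> 2 * (\<bar>t\<bar> ^ n / fact n)"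
      using K.char_approx1[of n t, OF i] by simp
  qed
  have "cmod (char M t - char N t) \<le> 4 * (\<bar>t\<bar> ^ n / fact n)" for n
  proof -
    let ?S = "\<Sum>k \<le> n. ((\<i> * t) ^ k / fact k) * (\<integral>x. x ^ k \<partial>M)"
    have "cmod (char M t - char N t) \<le> cmod (char M t - ?S) + cmod (char N t - ?S)"
      using norm_triangle_ineq4[of "char M t - ?S" "char N t - ?S"] by simp
    also have "\<dots> \<le> 2 * (\<bar>t\<bar> ^ n / fact n) + 2 * (\<bar>t\<bar> ^ n / fact n)"
      using *(2)[OF M bM, of n] *(2)[OF N bN, of n] by (intro add_mono) (simp_all add: eq)
    finally show ?thesis by simp
  qed
  moreover have "(\<lambda>n. 4 * (\<bar>t\<bar> ^ n / fact n)) \<longlonglongrightarrow> 4 * 0"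
    by (intro tendsto_mult tendsto_const) (use summable_LIMSEQ_zero[OF summable_exp[of "\<bar>t\<bar>"]] in \<open>simp add: field_simps\<close>)
  ultimately have "cmod (char M t - char N t) \<le> 0"
    by (intro LIMSEQ_le_const[where X="\<lambda>n. 4 * (\<bar>t\<bar> ^ n / fact n)"]) auto
  then show "char M t = char N t" by simp
qed

section \<open>Variables with the moments of a noncentral beta distribution\<close>

text \<open>
  Everything that the theorem says about \<open>u\<close> follows from its moments and its range; the locale separates this from the
  matrix computation that provides them.
\<close>

locale noncentral_beta_variable = prob_space P
  for P :: "'w measure" +
  fixes u :: "'w \<Rightarrow> real" and a b t :: real
  assumes u_measurable [measurable]: "u \<in> borel_measurable P"
    and u_bounds: "AE w in P. 0 \<le> u w \<and> u w \<le> 1"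
    and a_pos: "0 < a" and b_pos: "0 < b" and t_nonneg: "0 \<le> t"
    and u_moments: "\<And>j. (\<integral>w. u w ^ j \<partial>P) = noncentral_beta_moment a b t j"
begin

lemma has_noncentral_beta_pdf: "has_pdf P u (noncentral_beta_density a b t)"
proof -
  let ?h = "noncentral_beta_density a b t"
  let ?D = "density lborel (\<lambda>x. ennreal (?h x))"
  note nn = noncentral_beta_density_nonneg[OF a_pos b_pos t_nonneg]
  note mom = nn_integral_noncentral_beta_moment[OF a_pos b_pos t_nonneg]
  have "prob_space ?D"
    using mom[of 0] by (intro prob_spaceI) (simp add: emeasure_density noncentral_beta_moment_0)
  then have D: "real_distribution ?D"
    by (simp add: real_distribution_def real_distribution_axioms_def)
  have bD: "AE x in ?D. \<bar>x\<bar> \<le> 1"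
    by (subst AE_density) (auto simp: noncentral_beta_density_def)
  have M: "real_distribution (distr P borel u)" by simp
  have bM: "AE x in distr P borel u. \<bar>x\<bar> \<le> 1"
    using u_bounds by (subst AE_distr_iff) auto
  have "distr P borel u = ?D"
  proof (rule moments_determine_distribution[OF M D bM bD])
    fix k
    have nnk: "0 \<le> ?h x * x ^ k" for x
    proof (cases "0 < x \<and> x < 1")
      case True
      then show ?thesis using nn[of x] by simp
    next
      case False
      then have "?h x = 0" unfolding noncentral_beta_density_def by (simp only: if_False)
      then show ?thesis by simp
    qed
    have "(\<integral>x. x ^ k \<partial>?D) = (\<integral>x. ?h x * x ^ k \<partial>lborel)"
      using nn by (subst integral_density) auto
    also have "\<dots> = enn2real (\<integral>\<^sup>+x. ennreal (?h x * x ^ k) \<partial>lborel)"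
      using nnk by (intro integral_eq_nn_integral AE_I2) auto
    also have "\<dots> = noncentral_beta_moment a b t k"
      using nn noncentral_beta_moment_nonneg[OF a_pos b_pos t_nonneg] by (simp add: ennreal_mult' mom)
    finally show "(\<integral>x. x ^ k \<partial>distr P borel u) = (\<integral>x. x ^ k \<partial>?D)"
      by (simp add: integral_distr u_moments)
  qed
  then show ?thesis
    unfolding has_pdf_def distributed_def using nn distr_cong[of P P lborel borel u u] by simp
qed

lemma integrable_power_exp: "integrable P (\<lambda>x. u x ^ k * exp (w * u x))"
  and integrable_power_exp_abs: "integrable P (\<lambda>x. u x ^ k * exp \<bar>w * u x\<bar>)"
proof -
  have *: "AE x in P. norm (u x ^ k * exp \<bar>w * u x\<bar>) \<le> exp \<bar>w\<bar> \<and> norm (u x ^ k * exp (w * u x)) \<le> exp \<bar>w\<bar>"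
    using u_bounds
  proof eventually_elim
    case (elim x)
    have "\<bar>w * u x\<bar> \<le> \<bar>w\<bar>" using elim by (simp add: abs_mult mult_left_le)
    then have "exp \<bar>w * u x\<bar> \<le> exp \<bar>w\<bar>" "exp (w * u x) \<le> exp \<bar>w\<bar>" by auto
    moreover have "0 \<le> u x ^ k" "u x ^ k \<le> 1" using elim by (auto intro: power_le_one)
    ultimately have "u x ^ k * exp \<bar>w * u x\<bar> \<le> 1 * exp \<bar>w\<bar>" "u x ^ k * exp (w * u x) \<le> 1 * exp \<bar>w\<bar>"
      by (intro mult_mono; simp)+
    then show ?case using elim by simp
  qed
  show "integrable P (\<lambda>x. u x ^ k * exp (w * u x))"
    by (rule integrable_const_bound[of _ "exp \<bar>w\<bar>"]) (use * in auto)
  show "integrable P (\<lambda>x. u x ^ k * exp \<bar>w * u x\<bar>)"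
    by (rule integrable_const_bound[of _ "exp \<bar>w\<bar>"]) (use * in auto)
qed

lemma exp_moment_sums:
  "(\<lambda>j. w ^ j / fact j * noncentral_beta_moment a b t (k + j)) sums (\<integral>x. u x ^ k * exp (w * u x) \<partial>P)"
proof -
  have "(\<lambda>j. (\<integral>x. u x ^ k * (w * u x) ^ j \<partial>P) / fact j) sums (\<integral>x. u x ^ k * exp (w * u x) \<partial>P)"
    by (rule integral_mult_exp_sums[OF _ _ integrable_power_exp_abs]) simp_all
  moreover have "(\<integral>x. u x ^ k * (w * u x) ^ j \<partial>P) = w ^ j * noncentral_beta_moment a b t (k + j)" for j
    by (simp add: power_mult_distrib mult.left_commute flip: u_moments power_add)
  ultimately show ?thesis by simp
qed

text \<open>
  The double series \<open>d\<close> comes from expanding \<open>exp (w * u)\<close> and inserting the moments. With the index \<open>l\<close> of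
  the Poisson mixture outside, the inner sums are \<open>\<^sub>1F\<^sub>1\<close> values. With the power \<open>j\<close> of \<open>w\<close> outside it
  is, up to the factor \<open>c\<close>, the Appell series.
\<close>

lemma exp_moment_hyp1F1:
    "(\<integral>x. u x ^ k * exp (w * u x) \<partial>P) = exp (- t / 2) * (\<Sum>l. (t / 2) ^ l / fact l *
        (pochhammer a k / pochhammer (a + b + real l) k) * hyp1F1 (a + real k) (a + b + real k + real l) w)"
    (is "?I = ?H")
  and exp_moment_Phi2:
    "(\<integral>x. u x ^ k * exp (w * u x) \<partial>P) = exp (- t / 2) * (pochhammer a k / pochhammer (a + b) k) *
        appell_Phi2 (a + real k) (a + b) (a + b + real k) w (t / 2)" (is "_ = ?A")
proof -
  define s where "s = a + b"
  have s: "0 < s" "a \<le> s" using a_pos b_pos by (simp_all add: s_def)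
  define q where "q i l = pochhammer a i / pochhammer (s + real l) i" for i l
  have q: "0 \<le> q i l" "q i l \<le> 1" for i l
    using pochhammer_ratio_bounds[of a "s + real l" i] a_pos s by (simp_all add: q_def)
  define d where "d j l = w ^ j / fact j * ((t / 2) ^ l / fact l * q (k + j) l)" for j l
  have sq: "summable (\<lambda>l. (t / 2) ^ l / fact l * q i l)" for i
    using q by (intro summable_exp_weight[where K=1]) auto
  have mom: "noncentral_beta_moment a b t i = exp (- t / 2) * (\<Sum>l. (t / 2) ^ l / fact l * q i l)" for i
    by (simp add: noncentral_beta_moment_def q_def s_def)
  have dsum: "(\<Sum>l. d j l) = w ^ j / fact j * (\<Sum>l. (t / 2) ^ l / fact l * q (k + j) l)" for j
    unfolding d_def by (rule suminf_mult[OF sq])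
  have I: "(\<lambda>j. exp (- t / 2) * (\<Sum>l. d j l)) sums ?I"
    using exp_moment_sums[of w k] unfolding mom dsum by (simp add: mult.left_commute)
  \<comment> \<open>summability of the outer series is that of the moment series, up to the factor \<open>exp (- t / 2)\<close>\<close>
  then have "(\<lambda>j. exp (t / 2) * (exp (- t / 2) * (\<Sum>l. d j l))) sums (exp (t / 2) * ?I)"
    by (rule sums_mult)
  then have sumd: "summable (\<lambda>j. \<Sum>l. d j l)"
    by (simp add: mult_exp_exp sums_iff flip: mult.assoc)
  have I': "?I = exp (- t / 2) * (\<Sum>j. \<Sum>l. d j l)"
    using I sumd by (simp add: sums_iff suminf_mult)
  have "(\<Sum>j. \<Sum>l. d j l) = (\<Sum>l. \<Sum>j. d j l)"
  proof (rule suminf_swap)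
    show "summable (\<lambda>j. \<bar>w\<bar> ^ j / fact j)" "summable (\<lambda>l. (t / 2) ^ l / fact l)"
      using summable_exp[of "\<bar>w\<bar>"] summable_exp[of "t / 2"] by (simp_all add: field_simps)
    show "\<bar>d j l\<bar> \<le> \<bar>w\<bar> ^ j / fact j * ((t / 2) ^ l / fact l)" for j l
      using q[of "k + j" l] t_nonneg
      unfolding d_def abs_mult by (intro mult_mono) (auto simp: power_abs intro!: divide_right_mono mult_left_le)
  qed
  also have "(\<lambda>l. \<Sum>j. d j l) = (\<lambda>l. (t / 2) ^ l / fact l * q k l * hyp1F1 (a + real k) (s + real k + real l) w)"
  proof (rule ext)
    fix l
    have "summable (\<lambda>j. w ^ j / fact j * (pochhammer (a + real k) j / pochhammer (s + real k + real l) j))"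
      using pochhammer_ratio_bounds[of "a + real k" "s + real k + real l"] a_pos s
      by (intro summable_exp_weight[where K=1]) (subst abs_of_nonneg, simp_all)
    then have summ: "summable (\<lambda>j. pochhammer (a + real k) j / pochhammer (s + real k + real l) j * (w ^ j / fact j))"
      by (simp only: mult.commute)
    have sk: "s + real l + real k = s + real k + real l" by simp
    have deq: "d j l = (t / 2) ^ l / fact l * q k l *
        (pochhammer (a + real k) j / pochhammer (s + real k + real l) j * (w ^ j / fact j))" for j
      unfolding d_def q_def pochhammer_product'[of a k j] pochhammer_product'[of "s + real l" k j] sk
      by (simp add: mult_ac)
    from suminf_mult[OF summ, of "(t / 2) ^ l / fact l * q k l"]
    show "(\<Sum>j. d j l) = (t / 2) ^ l / fact l * q k l * hyp1F1 (a + real k) (s + real k + real l) w"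
      unfolding hyp1F1_def deq .
  qed
  finally show "?I = ?H" unfolding I' by (simp add: q_def s_def)
  define c where "c = pochhammer a k / pochhammer s k"
  have c: "c \<noteq> 0" using a_pos s pochhammer_pos[of a k] pochhammer_pos[of s k] by (simp add: c_def)
  have D: "pochhammer (a + real k) j * pochhammer s m / pochhammer (s + real k) (j + m) *
       (w ^ j * (t / 2) ^ m / (fact j * fact m)) = d j m / c" for j m
  proof -
    have "pochhammer s (m + (k + j)) = pochhammer s k * pochhammer (s + real k) (j + m)"
      using pochhammer_product'[of s k "j + m"] by (simp only: add_ac)
    then have "1 / pochhammer (s + real m) (k + j) = pochhammer s m / (pochhammer s k * pochhammer (s + real k) (j + m))"
      using pochhammer_ratio_swap[OF s(1), of m "k + j"] by (simp only:)
    from arg_cong[OF this, of "(*) (pochhammer a k * pochhammer (a + real k) j)"]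
    have "q (k + j) m = pochhammer a k * pochhammer (a + real k) j *
        (pochhammer s m / (pochhammer s k * pochhammer (s + real k) (j + m)))"
      unfolding q_def pochhammer_product'[of a k j] by (simp only: mult_1_right times_divide_eq_right)
    then have "d j m = w ^ j / fact j * ((t / 2) ^ m / fact m) * (pochhammer a k * pochhammer (a + real k) j) *
        (pochhammer s m / (pochhammer s k * pochhammer (s + real k) (j + m)))"
      unfolding d_def by (simp only: mult.assoc)
    then show ?thesis using c pochhammer_pos[of a k] a_pos by (simp add: c_def mult_ac)
  qed
  have "appell_Phi2 (a + real k) s (s + real k) w (t / 2) = (\<Sum>j. \<Sum>l. d j l / c)"
    by (simp only: appell_Phi2_def D)
  also have "\<dots> = (\<Sum>j. \<Sum>l. d j l) / c"
  proof -
    have "summable (d j)" for j unfolding d_def by (rule summable_mult[OF sq])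
    then show ?thesis using sumd by (simp add: suminf_divide)
  qed
  finally show "?I = ?A" unfolding I' using c by (simp add: c_def s_def)
qed

lemma mixture_weight_eq:
  assumes h: "has_pdf P u h"
  shows "mixture_weight lam h k = (lam / 2) ^ k / fact k * (\<integral>x. u x ^ k * exp (- lam / 2 * u x) \<partial>P)"
proof -
  let ?g = "\<lambda>x. indicator {0..1::real} x * (x ^ k * exp (- lam / 2 * x))"
  have "(\<integral>x. h x * ?g x \<partial>lborel) = (\<integral>w. ?g (u w) \<partial>P)"
    using h by (intro distributed_integral) (auto simp: has_pdf_def)
  also have "\<dots> = (\<integral>x. u x ^ k * exp (- lam / 2 * u x) \<partial>P)"
  proof (rule integral_cong_AE)
    show "AE w in P. ?g (u w) = u w ^ k * exp (- lam / 2 * u w)"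
      using u_bounds by eventually_elim simp
  qed simp_all
  finally have e: "(\<integral>x. h x * ?g x \<partial>lborel) = (\<integral>x. u x ^ k * exp (- lam / 2 * u x) \<partial>P)" .
  have "(LBINT x:{0..1}. x ^ k * exp (- lam * x / 2) * h x) = (\<integral>x. h x * ?g x \<partial>lborel)"
    unfolding set_lebesgue_integral_def by (rule Bochner_Integration.integral_cong) simp_all
  then show ?thesis unfolding mixture_weight_def e by simp
qed

text \<open>
  Summing \<open>(s * lam / 2 * u)\<^sup>k / k!\<close> under the expectation gives an exponential.
\<close>

lemma mixture_weight_generating_function:
  assumes h: "has_pdf P u h"
  shows "(\<lambda>k. s ^ k * mixture_weight lam h k) sums (\<integral>x. u x ^ 0 * exp (lam / 2 * (s - 1) * u x) \<partial>P)"
proof -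
  let ?\<phi> = "\<lambda>x. exp (- lam / 2 * u x)" and ?\<psi> = "\<lambda>x. s * lam / 2 * u x"
  have "integrable P (\<lambda>x. ?\<phi> x * exp \<bar>?\<psi> x\<bar>)"
  proof (rule Bochner_Integration.integrable_bound[OF integrable_power_exp[of 0 "\<bar>lam\<bar> / 2 + \<bar>s * lam\<bar> / 2"]])
    show "AE x in P. norm (?\<phi> x * exp \<bar>?\<psi> x\<bar>) \<le> norm (u x ^ 0 * exp ((\<bar>lam\<bar> / 2 + \<bar>s * lam\<bar> / 2) * u x))"
      using u_bounds
    proof eventually_elim
      case (elim x)
      have "- lam / 2 * u x \<le> \<bar>lam\<bar> / 2 * u x" "\<bar>?\<psi> x\<bar> = \<bar>s * lam\<bar> / 2 * u x"
        using elim mult_right_mono[of "- lam / 2" "\<bar>lam\<bar> / 2" "u x"] by (simp_all add: abs_mult)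
      then show ?case by (simp add: mult_exp_exp distrib_right)
    qed
  qed simp
  from integral_mult_exp_sums[OF _ _ this]
  have "(\<lambda>k. (\<integral>x. ?\<phi> x * ?\<psi> x ^ k \<partial>P) / fact k) sums (\<integral>x. ?\<phi> x * exp (?\<psi> x) \<partial>P)" by simp
  moreover have "(\<integral>x. ?\<phi> x * ?\<psi> x ^ k \<partial>P) / fact k = s ^ k * mixture_weight lam h k" for k
  proof -
    have "(\<integral>x. ?\<phi> x * ?\<psi> x ^ k \<partial>P) = (\<integral>x. (s * lam / 2) ^ k * (u x ^ k * ?\<phi> x) \<partial>P)"
      by (rule Bochner_Integration.integral_cong) (simp_all only: power_mult_distrib mult_ac)
    then show ?thesis unfolding mixture_weight_eq[OF h]
      by (simp add: power_mult_distrib power_divide)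
  qed
  moreover have "?\<phi> x * exp (?\<psi> x) = u x ^ 0 * exp (lam / 2 * (s - 1) * u x)" for x
    by (simp add: mult_exp_exp algebra_simps)
  ultimately show ?thesis by simp
qed

end

section \<open>Factorization of covariance matrices\<close>

lemma positive_definite_inner_commute:
  assumes "positive_definite A"
  shows "x \<bullet> (A *v y) = y \<bullet> (A *v x)"
proof -
  have "x \<bullet> (A *v y) = (x v* A) \<bullet> y" by (simp add: dot_lmul_matrix)
  also have "x v* A = A *v x"
    using assms by (metis positive_definite_def transpose_matrix_vector)
  finally show ?thesis by (simp add: inner_commute)
qed

text \<open>
  The Gram--Schmidt process for the inner product \<open>x \<bullet> A y\<close>.
\<close>

lemma positive_definite_orthonormal_family:
  fixes A :: "real^'k^'k"
  assumes A: "positive_definite A" and "finite S"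
  shows "\<exists>e :: 'k \<Rightarrow> real^'k. \<forall>i\<in>S. \<forall>j\<in>S. e i \<bullet> (A *v e j) = (if i = j then 1 else 0)"
  using \<open>finite S\<close>
proof (induction S)
  case (insert k S)
  then obtain e :: "'k \<Rightarrow> real^'k" where e: "\<And>i j. i \<in> S \<Longrightarrow> j \<in> S \<Longrightarrow> e i \<bullet> (A *v e j) = (if i = j then 1 else 0)"
    by auto
  have "card S < CARD('k)"
    using insert.hyps by (intro psubset_card_mono) auto
  then have "dim (e ` S) < CARD('k)"
    using dim_le_card'[of "e ` S"] card_image_le[of S e] insert.hyps by simp
  then have "span (e ` S) \<noteq> UNIV"
    by (metis dim_span dim_UNIV DIM_cart DIM_real mult.right_neutral less_irrefl)
  then obtain v where v: "v \<notin> span (e ` S)" by auto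
  define w where "w = v - (\<Sum>i\<in>S. (v \<bullet> (A *v e i)) *\<^sub>R e i)"
  have "w \<noteq> 0"
  proof
    assume "w = 0"
    then have "v = (\<Sum>i\<in>S. (v \<bullet> (A *v e i)) *\<^sub>R e i)" by (simp add: w_def)
    also have "\<dots> \<in> span (e ` S)" by (intro span_sum span_scale span_base) auto
    finally show False using v by simp
  qed
  then have pos: "0 < w \<bullet> (A *v w)" using A by (simp add: positive_definite_def)
  have we: "w \<bullet> (A *v e j) = 0" if "j \<in> S" for j
  proof -
    have "(\<Sum>i\<in>S. (v \<bullet> (A *v e i)) *\<^sub>R e i) \<bullet> (A *v e j) = (\<Sum>i\<in>S. if i = j then v \<bullet> (A *v e i) else 0)"
      unfolding inner_sum_left by (intro sum.cong) (use that in \<open>auto simp: e\<close>)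
    then show ?thesis using that insert.hyps by (simp add: w_def inner_diff_left)
  qed
  define e' where "e' = e(k := (1 / sqrt (w \<bullet> (A *v w))) *\<^sub>R w)"
  have "e' i \<bullet> (A *v e' j) = (if i = j then 1 else 0)" if "i \<in> insert k S" "j \<in> insert k S" for i j
  proof -
    have kk: "e' k \<bullet> (A *v e' k) = 1"
      using pos by (simp add: e'_def matrix_vector_mult_scaleR)
    have ks: "e' k \<bullet> (A *v e' j) = 0" if "j \<in> S" for j
      using that insert.hyps we[OF that] by (auto simp: e'_def)
    have sk: "e' j \<bullet> (A *v e' k) = 0" if "j \<in> S" for j
      using ks[OF that] positive_definite_inner_commute[OF A] by metis
    have ss: "e' i \<bullet> (A *v e' j) = (if i = j then 1 else 0)" if "i \<in> S" "j \<in> S" for i j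
      using that insert.hyps e[of i j] by (auto simp: e'_def)
    show ?thesis using that kk ks sk ss insert.hyps by auto
  qed
  then show ?case by blast
qed simp

lemma positive_definite_factorization:
  fixes A :: "real^'k^'k"
  assumes A: "positive_definite A"
  obtains L :: "real^'k^'k" where "invertible L" "L ** transpose L = A"
proof -
  obtain e :: "'k \<Rightarrow> real^'k" where e: "\<And>i j. e i \<bullet> (A *v e j) = (if i = j then 1 else 0)"
    using positive_definite_orthonormal_family[OF A, of UNIV] by auto
  define E :: "real^'k^'k" where "E = (\<chi> i j. e j $ i)"
  have E: "transpose E ** (A ** E) = mat 1"
  proof -
    have "(transpose E ** (A ** E)) $ i $ j = e i \<bullet> (A *v e j)" for i j
      by (simp add: E_def matrix_matrix_mult_def transpose_def inner_vec_def matrix_vector_mult_def)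
    then show ?thesis by (simp add: vec_eq_iff e mat_def)
  qed
  have E1: "(A ** E) ** transpose E = mat 1" using E by (simp add: matrix_left_right_inverse)
  have inv: "invertible (transpose E)"
    unfolding invertible_def using E E1 by blast
  define L where "L = matrix_inv (transpose E)"
  note L = matrix_inv_inverse[OF inv, folded L_def]
  have TL: "E ** transpose L = mat 1" "transpose L ** E = mat 1"
    using L by (metis matrix_transpose_mul transpose_mat transpose_transpose)+
  have "L ** transpose L = L ** ((transpose E ** (A ** E)) ** transpose L)" by (simp add: E)
  also have "\<dots> = (L ** transpose E) ** (A ** (E ** transpose L))" by (simp add: matrix_mul_assoc)
  also have "\<dots> = A" by (simp add: L TL)
  finally have "L ** transpose L = A" .
  moreover have "invertible L" unfolding invertible_def using L by blast
  ultimately show ?thesis using that by blast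
qed

lemma positive_definite_invertible:
  fixes A :: "real^'k^'k"
  assumes "positive_definite A"
  shows "invertible A"
proof -
  have "x = 0" if "A *v x = 0" for x
    using assms that unfolding positive_definite_def by (metis inner_zero_right less_irrefl)
  then have "inj ((*v) A)" by (simp add: linear_injective_0)
  then show ?thesis by (simp add: invertible_left_inverse matrix_left_invertible_injective)
qed

lemma sum_UNIV_option:
  fixes f :: "('q::finite) option \<Rightarrow> 'b::comm_monoid_add"
  shows "(\<Sum>i\<in>UNIV. f i) = f None + (\<Sum>j\<in>UNIV. f (Some j))"
  by (simp add: UNIV_option_conv sum.reindex)

lemma quadratic_form_blocks:
  fixes S :: "real^('q::finite) option^'q option" and y :: "real^'q" and c :: real
  assumes sym: "transpose S = S"
  defines "x \<equiv> (\<chi> i. case i of None \<Rightarrow> c | Some j \<Rightarrow> y $ j)"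
  shows "x \<bullet> (S *v x) = c * c * block11 S + 2 * c * (y \<bullet> block21 S) + y \<bullet> (block22 S *v y)"
proof -
  have s: "S $ None $ Some j = S $ Some j $ None" for j
    using sym by (metis (no_types) transpose_def vec_lambda_beta)
  show ?thesis
    unfolding x_def block11_def block21_def block22_def inner_vec_def matrix_vector_mult_def
    by (simp add: sum_UNIV_option s sum.distrib sum_distrib_left algebra_simps)
qed

lemma positive_definite_block22:
  fixes S :: "real^('q::finite) option^'q option"
  assumes "positive_definite S"
  shows "positive_definite (block22 S)"
  unfolding positive_definite_def
proof (intro conjI allI impI)
  have sym: "transpose S = S" using assms by (simp add: positive_definite_def)
  then have "S $ i $ j = S $ j $ i" for i j by (metis (no_types) transpose_def vec_lambda_beta)
  then show "transpose (block22 S) = block22 S"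
    by (simp add: transpose_def block22_def)
  fix y :: "real^'q" assume y: "y \<noteq> 0"
  define x :: "real^'q option" where "x = (\<chi> i. case i of None \<Rightarrow> 0 | Some j \<Rightarrow> y $ j)"
  have "x \<noteq> 0"
  proof
    assume "x = 0"
    then have "x $ Some j = 0" for j by simp
    then have "y = 0" by (simp add: x_def vec_eq_iff)
    then show False using y by simp
  qed
  then have "0 < x \<bullet> (S *v x)" using assms by (simp add: positive_definite_def)
  then show "0 < y \<bullet> (block22 S *v y)"
    unfolding x_def quadratic_form_blocks[OF sym] by simp
qed

lemma schur_complement_positive:
  fixes S :: "real^('q::finite) option^'q option"
  assumes pd: "positive_definite S"
  shows "0 < schur_complement S"
proof -
  have sym: "transpose S = S" using pd by (simp add: positive_definite_def)
  define g where "g = matrix_inv (block22 S) *v block21 S"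
  have g: "block22 S *v g = block21 S"
    using matrix_inv_inverse(1)[OF positive_definite_invertible[OF positive_definite_block22[OF pd]]]
    by (simp add: g_def matrix_vector_mul_assoc)
  define x :: "real^'q option" where "x = (\<chi> i. case i of None \<Rightarrow> 1 | Some j \<Rightarrow> (- g) $ j)"
  have "x $ None = 1" by (simp add: x_def)
  then have "x \<noteq> 0" by auto
  then have "0 < x \<bullet> (S *v x)" using pd by (simp add: positive_definite_def)
  moreover have "block22 S *v (- g) = - block21 S"
    using g by (metis matrix_vector_mult_scaleR scaleR_minus1_left)
  ultimately show ?thesis
    unfolding x_def quadratic_form_blocks[OF sym] schur_complement_def g_def[symmetric]
    by (simp add: inner_commute)
qed

text \<open>
  Centered rows with covariance \<open>S\<close> arise from standard normal coordinates by first forming the last \<open>q\<close> entries with the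
  factor \<open>L2\<close> and then the first entry as its regression \<open>g\<close> on them plus independent noise, whose variance is
  the Schur complement.
\<close>

lemma block_triangular_factorization:
  fixes S :: "real^('q::finite) option^'q option"
  assumes pd: "positive_definite S"
    and L2: "L2 ** transpose L2 = block22 S"
  defines "g \<equiv> matrix_inv (block22 S) *v block21 S"
  defines "L \<equiv> (\<chi> k l. case k of
      None \<Rightarrow> (case l of None \<Rightarrow> sqrt (schur_complement S) | Some j \<Rightarrow> (g v* L2) $ j)
    | Some i \<Rightarrow> (case l of None \<Rightarrow> 0 | Some j \<Rightarrow> L2 $ i $ j)) :: real^'q option^'q option"
  shows "L ** transpose L = S" and "invertible L"
proof -
  have sym: "transpose S = S" using pd by (simp add: positive_definite_def)
  have s: "S $ None $ Some j = S $ Some j $ None" for j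
    using sym by (metis (no_types) transpose_def vec_lambda_beta)
  have bg: "block22 S *v g = block21 S"
    using matrix_inv_inverse(1)[OF positive_definite_invertible[OF positive_definite_block22[OF pd]]]
    by (simp add: g_def matrix_vector_mul_assoc)
  have L2g: "L2 *v (g v* L2) = block21 S"
    using bg by (simp add: L2[symmetric] flip: matrix_vector_mul_assoc)
  have gg: "(g v* L2) \<bullet> (g v* L2) = block21 S \<bullet> g"
    by (simp add: dot_lmul_matrix L2g inner_commute)
  have "(L ** transpose L) $ k $ l = S $ k $ l" for k l
  proof (cases k; cases l)
    assume "k = None" "l = None"
    then have "(L ** transpose L) $ k $ l = schur_complement S + (g v* L2) \<bullet> (g v* L2)"
      using schur_complement_positive[OF pd]
      by (simp add: L_def matrix_matrix_mult_def transpose_def sum_UNIV_option inner_vec_def)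
    then show ?thesis
      using \<open>k = None\<close> \<open>l = None\<close> by (simp add: gg schur_complement_def block11_def flip: g_def)
  next
    fix j assume "k = None" "l = Some j"
    then have "(L ** transpose L) $ k $ l = (L2 *v (g v* L2)) $ j"
      by (simp add: L_def matrix_matrix_mult_def transpose_def sum_UNIV_option matrix_vector_mult_def mult.commute)
    then show ?thesis using \<open>k = None\<close> \<open>l = Some j\<close> by (simp add: L2g block21_def s)
  next
    fix i assume "k = Some i" "l = None"
    then have "(L ** transpose L) $ k $ l = (L2 *v (g v* L2)) $ i"
      by (simp add: L_def matrix_matrix_mult_def transpose_def sum_UNIV_option matrix_vector_mult_def)
    then show ?thesis using \<open>k = Some i\<close> \<open>l = None\<close> by (simp add: L2g block21_def)
  next
    fix i j assume "k = Some i" "l = Some j"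
    then have "(L ** transpose L) $ k $ l = (L2 ** transpose L2) $ i $ j"
      by (simp add: L_def matrix_matrix_mult_def transpose_def sum_UNIV_option)
    then show ?thesis using \<open>k = Some i\<close> \<open>l = Some j\<close> by (simp add: L2 block22_def)
  qed
  then show eq: "L ** transpose L = S" by (simp add: vec_eq_iff)
  have "L ** (transpose L ** matrix_inv S) = mat 1"
    using matrix_inv_inverse(1)[OF positive_definite_invertible[OF pd]] eq by (simp add: matrix_mul_assoc)
  then show "invertible L"
    unfolding invertible_def using matrix_left_right_inverse by blast
qed

section \<open>Standardization of Gaussian rows and matrices\<close>

lemma distr_lborel_linear:
  fixes T :: "'a::euclidean_space \<Rightarrow> 'b::euclidean_space"
  assumes T: "linear T" "bij T"
  obtains \<kappa> where "distr lborel borel T = density lborel (\<lambda>_. \<kappa>)"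
proof -
  let ?F = "box 0 One :: 'b set"
  have F: "emeasure lborel ?F = 1" by (subst emeasure_lborel_box) simp_all
  have "distr lborel borel T = density lborel (\<lambda>_. emeasure (distr lborel borel T) ?F)"
  proof (rule measure_eqI)
    fix E assume "E \<in> sets (distr lborel borel T)"
    then have "E \<in> sets borel" by simp
    from distr_lborel_linear_proportional[OF T this, of ?F]
    show "emeasure (distr lborel borel T) E = emeasure (density lborel (\<lambda>_. emeasure (distr lborel borel T) ?F)) E"
      using \<open>E \<in> sets borel\<close> F by (simp add: emeasure_density_const mult.commute)
  qed simp
  then show ?thesis by (rule that)
qed

text \<open>
  A linear bijection changes Lebesgue measure by a constant factor \<open>\<kappa>\<close>, so the image measure is a multiple of the
  standard Gaussian one. Both are probability measures; this determines the multiple without computing a determinant.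
\<close>

lemma distr_multivariate_normal_standardize:
  fixes S L :: "real^'k^'k" and m :: "real^'k"
  assumes L: "invertible L" "L ** transpose L = S"
    and prob: "prob_space (density lborel (\<lambda>x. ennreal (multivariate_normal_density m S x)))"
  shows "distr (density lborel (\<lambda>x. ennreal (multivariate_normal_density m S x))) borel
      (\<lambda>x. matrix_inv L *v (x - m)) = std_gauss"
proof -
  let ?f = "\<lambda>x. ennreal (multivariate_normal_density m S x)"
  let ?J = "matrix_inv L"
  let ?T = "\<lambda>x. ?J *v (x - m)"
  note J = matrix_inv_inverse[OF L(1)]
  have TJ: "transpose ?J ** transpose L = mat 1" "transpose L ** transpose ?J = mat 1"
    using J by (simp_all flip: matrix_transpose_mul add: transpose_mat)
  have "S ** (transpose ?J ** ?J) = L ** ((transpose L ** transpose ?J) ** ?J)"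
    by (simp add: L(2)[symmetric] matrix_mul_assoc)
  then have Sinv: "matrix_inv S = transpose ?J ** ?J"
    by (intro matrix_inv_unique) (simp add: TJ J)
  define K where "K = 1 / sqrt ((2 * pi) ^ CARD('k) * det S)"
  have f: "?f x = ennreal K * ennreal (exp (- (?T x \<bullet> ?T x) / 2))" for x
  proof -
    have "(x - m) \<bullet> (matrix_inv S *v (x - m)) = (?T x v* ?J) \<bullet> (x - m)"
      by (simp add: Sinv inner_commute flip: matrix_vector_mul_assoc)
    also have "\<dots> = ?T x \<bullet> ?T x" by (rule dot_lmul_matrix)
    finally have "multivariate_normal_density m S x = K * exp (- (?T x \<bullet> ?T x) / 2)"
      by (simp add: multivariate_normal_density_def K_def)
    then show ?thesis by (simp add: ennreal_mult'')
  qed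
  have bij: "bij ((*v) ?J)"
    by (rule o_bij[of "(*v) L"]) (simp_all add: fun_eq_iff matrix_vector_mul_assoc J)
  obtain \<kappa> where \<kappa>: "distr lborel borel ((*v) ?J) = density lborel (\<lambda>_. \<kappa>)"
    using distr_lborel_linear[OF _ bij] by auto
  have [measurable]: "?T \<in> borel_measurable borel" by measurable
  have [measurable]: "?f \<in> borel_measurable borel" unfolding f by measurable
  have sub: "(\<integral>\<^sup>+x. g (?T x) \<partial>lborel) = \<kappa> * (\<integral>\<^sup>+y. g y \<partial>lborel)"
    if [measurable]: "g \<in> borel_measurable borel" for g
  proof -
    have "(\<integral>\<^sup>+x. g (?T x) \<partial>lborel) = (\<integral>\<^sup>+x. g (?J *v x) \<partial>lborel)"
      using nn_integral_distr[of "(+) (- m)" lborel borel "\<lambda>x. g (?J *v x)"]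
      by (simp add: lborel_distr_plus)
    also have "\<dots> = (\<integral>\<^sup>+y. g y \<partial>distr lborel borel ((*v) ?J))"
      by (subst nn_integral_distr) simp_all
    also have "\<dots> = \<kappa> * (\<integral>\<^sup>+y. g y \<partial>lborel)"
      unfolding \<kappa> by (subst nn_integral_density) (simp_all add: nn_integral_cmult)
    finally show ?thesis .
  qed
  define c where "c = ennreal K * (\<kappa> * ennreal (sqrt (2 * pi) ^ DIM(real^'k)))"
  have N: "emeasure (distr (density lborel ?f) borel ?T) E = c * emeasure std_gauss E" if [measurable]: "E \<in> sets borel" for E
  proof -
    have "emeasure (distr (density lborel ?f) borel ?T) E = (\<integral>\<^sup>+x. indicator E (?T x) \<partial>density lborel ?f)"
      using nn_integral_distr[of ?T "density lborel ?f" borel "indicator E"] by simp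
    also have "\<dots> = (\<integral>\<^sup>+x. ennreal K * (ennreal (exp (- (?T x \<bullet> ?T x) / 2)) * indicator E (?T x)) \<partial>lborel)"
      by (subst nn_integral_density) (simp_all add: f mult.assoc)
    also have "\<dots> = ennreal K * (\<kappa> * (\<integral>\<^sup>+y. ennreal (exp (- (y \<bullet> y) / 2)) * indicator E y \<partial>lborel))"
      using sub[of "\<lambda>y. ennreal (exp (- (y \<bullet> y) / 2)) * indicator E y"]
      by (subst nn_integral_cmult) simp_all
    also have "(\<integral>\<^sup>+y. ennreal (exp (- (y \<bullet> y) / 2)) * indicator E (y :: real^'k) \<partial>lborel)
        = (\<integral>\<^sup>+y. ennreal (sqrt (2 * pi) ^ DIM(real^'k)) *
            (ennreal (exp (- (y \<bullet> y) / 2) / sqrt (2 * pi) ^ DIM(real^'k)) * indicator E y) \<partial>lborel)"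
      by (intro nn_integral_cong) (simp flip: mult.assoc ennreal_mult)
    also have "\<dots> = ennreal (sqrt (2 * pi) ^ DIM(real^'k)) * emeasure std_gauss E"
      using nn_integral_std_gauss[of "indicator E"] by (subst nn_integral_cmult) (simp_all del: DIM_cart)
    finally show ?thesis by (simp add: c_def mult.assoc)
  qed
  interpret D: prob_space "distr (density lborel ?f) borel ?T"
    by (rule prob_space.prob_space_distr[OF prob]) simp
  have "c = 1"
    using N[of UNIV] D.emeasure_space_1 prob_space.emeasure_space_1[OF prob_space_std_gauss[where 'a="real^'k"]] by simp
  with N show ?thesis by (intro measure_eqI) simp_all
qed

lemma prod_Basis_vec:
  fixes f :: "'a::euclidean_space^'n \<Rightarrow> 'b::comm_monoid_mult"
  shows "(\<Prod>b\<in>Basis. f b) = (\<Prod>i\<in>UNIV. \<Prod>b\<in>Basis. f (axis i b))"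
proof -
  have inj: "inj_on (\<lambda>(i, b). axis i b :: 'a^'n) (UNIV \<times> Basis)"
    by (auto simp: inj_on_def axis_eq_axis)
  have "(Basis :: ('a^'n) set) = (\<lambda>(i, b). axis i b) ` (UNIV \<times> Basis)"
    by (auto simp: Basis_vec_def)
  then have "(\<Prod>b\<in>Basis. f b) = (\<Prod>b\<in>(\<lambda>(i, b). axis i b) ` (UNIV \<times> Basis). f b)"
    by (rule arg_cong)
  also have "\<dots> = (\<Prod>p\<in>UNIV \<times> Basis. f (case p of (i, b) \<Rightarrow> axis i b))"
    by (rule prod.reindex[OF inj, unfolded o_def])
  finally have "(\<Prod>b\<in>Basis. f b) = (\<Prod>p\<in>UNIV \<times> Basis. f (case p of (i, b) \<Rightarrow> axis i b))" .
  then show ?thesis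
    by (simp add: prod.cartesian_product case_prod_unfold)
qed

lemma measurable_vec_lambda_PiM:
  assumes "\<And>i. sets (N i) = sets borel"
  shows "(\<lambda>f. \<chi> i. f i) \<in> (\<Pi>\<^sub>M i\<in>UNIV. N i) \<rightarrow>\<^sub>M (borel :: ('b::euclidean_space^'n) measure)"
proof -
  have "(\<lambda>f. \<chi> i. f i) \<in> (\<Pi>\<^sub>M i\<in>UNIV. borel) \<rightarrow>\<^sub>M (borel :: ('b^'n) measure)"
    by (intro borel_measurable_vec_lambda) simp
  moreover have "sets (\<Pi>\<^sub>M i\<in>UNIV. N i) = sets (\<Pi>\<^sub>M i\<in>UNIV. borel :: 'b measure)"
    using assms by (intro sets_PiM_cong) auto
  ultimately show ?thesis by (simp cong: measurable_cong_sets)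
qed

lemma lborel_vec:
  "distr (\<Pi>\<^sub>M i\<in>(UNIV::'n::finite set). lborel) borel (\<lambda>f. \<chi> i. f i) = (lborel :: ('a::euclidean_space^'n) measure)"
proof (rule lborel_eqI[symmetric])
  interpret product_sigma_finite "\<lambda>i::'n. lborel :: 'a measure" ..
  have [measurable]: "(\<lambda>f. \<chi> i. f i) \<in> (\<Pi>\<^sub>M i\<in>(UNIV::'n set). lborel) \<rightarrow>\<^sub>M (borel :: ('a^'n) measure)"
    by (rule measurable_vec_lambda_PiM) simp
  fix l u :: "'a^'n" assume lu: "\<And>b. b \<in> Basis \<Longrightarrow> l \<bullet> b \<le> u \<bullet> b"
  have lu': "l $ i \<bullet> b \<le> u $ i \<bullet> b" if "b \<in> Basis" for i b
    using lu[of "axis i b"] that by (auto simp: inner_axis Basis_vec_def)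
  have "(\<lambda>f. \<chi> i. f i) -` box l u \<inter> space (\<Pi>\<^sub>M i\<in>(UNIV::'n set). lborel) = (\<Pi>\<^sub>E i\<in>UNIV. box (l $ i) (u $ i))"
    by (auto simp: box_def Basis_vec_def inner_axis space_PiM PiE_def)
  then have "emeasure (distr (\<Pi>\<^sub>M i\<in>UNIV. lborel) borel (\<lambda>f. \<chi> i. f i)) (box l u)
      = (\<Prod>i\<in>UNIV. emeasure lborel (box (l $ i) (u $ i)))"
    by (simp add: emeasure_distr emeasure_PiM)
  also have "\<dots> = ennreal (\<Prod>b\<in>Basis. (u - l) \<bullet> b)"
    using lu' by (simp add: prod_Basis_vec inner_axis prod_ennreal prod_nonneg inner_diff_left)
  finally show "emeasure (distr (\<Pi>\<^sub>M i\<in>UNIV. lborel) borel (\<lambda>f. \<chi> i. f i)) (box l u) = ennreal (\<Prod>b\<in>Basis. (u - l) \<bullet> b)" .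
qed simp

lemma PiM_std_gauss_vec:
  "distr (\<Pi>\<^sub>M i\<in>(UNIV::'n::finite set). std_gauss) borel (\<lambda>f. \<chi> i. f i) = (std_gauss :: ('a::euclidean_space^'n) measure)"
proof -
  interpret prob_space "std_gauss :: 'a measure" by (rule prob_space_std_gauss)
  interpret product_sigma_finite "\<lambda>i::'n. std_gauss :: 'a measure" ..
  interpret L: product_sigma_finite "\<lambda>i::'n. lborel :: 'a measure" ..
  let ?dn = "\<lambda>x::'a. ennreal (exp (- (x \<bullet> x) / 2) / sqrt (2 * pi) ^ DIM('a))"
  let ?R = "distr (std_gauss :: ('a^'n) measure) (\<Pi>\<^sub>M i\<in>UNIV. std_gauss) (\<lambda>x. \<lambda>i\<in>UNIV. x $ i)"
  have m1[measurable]: "(\<lambda>x. \<lambda>i\<in>UNIV. x $ i) \<in> (borel :: ('a^'n) measure) \<rightarrow>\<^sub>M (\<Pi>\<^sub>M i\<in>UNIV. std_gauss)"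
    by (intro measurable_restrict) simp
  have m2[measurable]: "(\<lambda>f. \<chi> i. f i) \<in> (\<Pi>\<^sub>M i\<in>(UNIV::'n set). std_gauss) \<rightarrow>\<^sub>M (borel :: ('a^'n) measure)"
    by (rule measurable_vec_lambda_PiM) simp
  have "?R = (\<Pi>\<^sub>M i\<in>UNIV. std_gauss)"
  proof (rule PiM_eqI)
    fix A :: "'n \<Rightarrow> 'a set" assume "\<And>i. i \<in> UNIV \<Longrightarrow> A i \<in> sets std_gauss"
    then have A[measurable]: "A i \<in> sets borel" for i by simp
    have Am: "Pi\<^sub>E UNIV A \<in> sets (\<Pi>\<^sub>M i\<in>UNIV. std_gauss)" by (intro sets_PiM_I_finite) auto
    have "emeasure ?R (Pi\<^sub>E UNIV A) = (\<integral>\<^sup>+x. indicator (Pi\<^sub>E UNIV A) (\<lambda>i\<in>UNIV. x $ i) \<partial>std_gauss)"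
      using nn_integral_distr[of "\<lambda>x. \<lambda>i\<in>UNIV. x $ i" "std_gauss :: ('a^'n) measure" "\<Pi>\<^sub>M i\<in>UNIV. std_gauss" "indicator (Pi\<^sub>E UNIV A)"] Am
      by simp
    also have "\<dots> = (\<integral>\<^sup>+x. (\<Prod>i\<in>UNIV. indicator (A i) (x $ i)) \<partial>(std_gauss :: ('a^'n) measure))"
    proof (rule nn_integral_cong)
      fix x :: "'a^'n"
      show "indicator (Pi\<^sub>E UNIV A) (\<lambda>i\<in>UNIV. x $ i) = (\<Prod>i\<in>UNIV. indicator (A i) (x $ i) :: ennreal)"
      proof (cases "\<forall>i. x $ i \<in> A i")
        case False
        then obtain i where i: "x $ i \<notin> A i" by auto
        then have "(\<Prod>i\<in>UNIV. indicator (A i) (x $ i) :: ennreal) = 0"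
          by (intro prod_zero) (auto intro!: exI[of _ i])
        moreover have "(\<lambda>i\<in>UNIV. x $ i) \<notin> Pi\<^sub>E UNIV A" using i by (auto simp: PiE_def)
        ultimately show ?thesis by simp
      qed simp
    qed
    also have "\<dots> = (\<integral>\<^sup>+x. (\<Prod>i\<in>UNIV. ?dn (x $ i) * indicator (A i) (x $ i)) \<partial>lborel)"
      by (subst nn_integral_std_gauss)
        (simp_all add: prod.distrib prod_ennreal inner_vec_def sum_negf[symmetric] sum_divide_distrib
          exp_sum prod_dividef power_mult mult.commute[of "CARD('n)"])
    also have "\<dots> = (\<integral>\<^sup>+f. (\<Prod>i\<in>UNIV. ?dn (f i) * indicator (A i) (f i)) \<partial>(\<Pi>\<^sub>M i\<in>UNIV. lborel))"
      unfolding lborel_vec[symmetric] by (subst nn_integral_distr) (simp_all add: measurable_vec_lambda_PiM)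
    also have "\<dots> = (\<Prod>i\<in>UNIV. \<integral>\<^sup>+x. ?dn x * indicator (A i) x \<partial>lborel)"
      by (intro L.product_nn_integral_prod) simp_all
    also have "\<dots> = (\<Prod>i\<in>UNIV. emeasure std_gauss (A i))"
    proof (intro prod.cong refl)
      show "(\<integral>\<^sup>+x. ?dn x * indicator (A i) x \<partial>lborel) = emeasure std_gauss (A i)" for i
        using nn_integral_std_gauss[of "indicator (A i)"] by simp
    qed
    finally show "emeasure ?R (Pi\<^sub>E UNIV A) = (\<Prod>i\<in>UNIV. emeasure std_gauss (A i))" .
  qed simp_all
  then have "distr (\<Pi>\<^sub>M i\<in>UNIV. std_gauss) borel (\<lambda>f. \<chi> i. f i)
      = distr ?R borel (\<lambda>f. (\<chi> i. f i) :: 'a^'n)" by simp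
  also have "\<dots> = distr std_gauss borel (\<lambda>x. x)"
    using distr_distr[OF m2, of "\<lambda>x. \<lambda>i\<in>UNIV. x $ i" std_gauss] m1 by (simp add: o_def restrict_UNIV)
  also have "\<dots> = std_gauss" by (rule distr_id2) simp
  finally show ?thesis .
qed

lemma (in prob_space) gaussian_matrix_standardize:
  fixes X :: "'a \<Rightarrow> real^'k^'n" and L :: "real^'k^'k"
  assumes X: "gaussian_matrix M X C S" and L: "invertible L" "L ** transpose L = S"
  defines "W \<equiv> \<lambda>\<omega>. \<chi> i. matrix_inv L *v (row i (X \<omega>) - row i C)"
  shows "random_variable borel W" and "distr M borel W = std_gauss"
    and "X \<omega> = C + W \<omega> ** transpose L"
proof -
  have D: "distributed M lborel (\<lambda>\<omega>. row i (X \<omega>)) (\<lambda>x. ennreal (multivariate_normal_density (row i C) S x))" for i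
    using X by (auto simp: gaussian_matrix_def)
  have rv[measurable]: "random_variable borel (\<lambda>\<omega>. row i (X \<omega>))" for i
    using distributed_measurable[OF D[of i]] by simp
  define V where "V i x = matrix_inv L *v (x - row i C)" for i x
  have [measurable]: "V i \<in> borel_measurable borel" for i unfolding V_def by measurable
  have Wi: "distr M borel (\<lambda>\<omega>. V i (row i (X \<omega>))) = std_gauss" for i
  proof -
    let ?f = "\<lambda>x. ennreal (multivariate_normal_density (row i C) S x)"
    have d: "distr M lborel (\<lambda>\<omega>. row i (X \<omega>)) = density lborel ?f"
      using D[of i] by (simp add: distributed_def)
    have "prob_space (density lborel ?f)"
      unfolding d[symmetric] by (rule prob_space_distr) simp
    from distr_multivariate_normal_standardize[OF L this]
    have "distr (distr M lborel (\<lambda>\<omega>. row i (X \<omega>))) borel (V i) = std_gauss"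
      unfolding d V_def .
    then show ?thesis by (subst (asm) distr_distr) (simp_all add: o_def)
  qed
  have "indep_vars (\<lambda>_. borel) (\<lambda>i \<omega>. V i (row i (X \<omega>))) UNIV"
    using X by (intro indep_vars_compose2[where M'="\<lambda>_. borel" and N="\<lambda>_. borel" and Y=V
        and X="\<lambda>i \<omega>. row i (X \<omega>)"]) (simp_all add: gaussian_matrix_def)
  with iffD1[OF indep_vars_iff_distr_eq_PiM[of UNIV "\<lambda>i \<omega>. V i (row i (X \<omega>))" "\<lambda>_. borel"]]
  have "distr M (\<Pi>\<^sub>M i\<in>UNIV. borel) (\<lambda>\<omega>. \<lambda>i\<in>UNIV. V i (row i (X \<omega>)))
      = (\<Pi>\<^sub>M i\<in>UNIV. distr M borel (\<lambda>\<omega>. V i (row i (X \<omega>))))"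
    by simp
  then have P: "distr M (\<Pi>\<^sub>M i\<in>UNIV. borel) (\<lambda>\<omega>. \<lambda>i\<in>UNIV. V i (row i (X \<omega>))) = (\<Pi>\<^sub>M i\<in>UNIV. std_gauss)"
    by (simp only: Wi)
  show W: "random_variable borel W"
    unfolding W_def V_def[symmetric] by measurable
  have rvr: "random_variable (\<Pi>\<^sub>M i\<in>UNIV. borel) (\<lambda>\<omega>. \<lambda>i\<in>UNIV. V i (row i (X \<omega>)))"
    by (intro measurable_restrict) measurable
  have "distr M borel W = distr (distr M (\<Pi>\<^sub>M i\<in>UNIV. borel) (\<lambda>\<omega>. \<lambda>i\<in>UNIV. V i (row i (X \<omega>)))) borel (\<lambda>f. \<chi> i. f i)"
    by (subst distr_distr[OF measurable_vec_lambda_PiM rvr])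
      (simp_all add: o_def W_def V_def[symmetric] restrict_UNIV)
  then show "distr M borel W = std_gauss" by (simp add: P PiM_std_gauss_vec)
  show "X \<omega> = C + W \<omega> ** transpose L"
  proof -
    have "(W \<omega> ** transpose L) $ i = L *v (W \<omega> $ i)" for i
      by (simp add: vec_eq_iff matrix_matrix_mult_def matrix_vector_mult_def transpose_def mult.commute)
    then have "(W \<omega> ** transpose L) $ i = row i (X \<omega>) - row i C" for i
      by (simp add: W_def matrix_vector_mul_assoc matrix_inv_inverse[OF L(1)])
    then show ?thesis by (simp add: vec_eq_iff row_def)
  qed
qed

section \<open>The partitioned Gaussian matrix\<close>

text \<open>
  Splitting off the first column only regroups the entries of a matrix, hence is an isometry onto the product space;
  consequently the first column and the remaining ones are independent.
\<close>

lemma distr_std_gauss_columns: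
  "distr (std_gauss :: (real^('q::finite) option^'n) measure) borel (\<lambda>W. (first_col W, rest_cols W)) = std_gauss"
proof (rule distr_std_gauss_isometry)
  let ?T = "\<lambda>W :: real^'q option^'n. (first_col W, rest_cols W)"
  show "linear ?T"
    by (rule linearI) (simp_all add: first_col_def rest_cols_def column_def vec_eq_iff)
  show "norm (?T W) = norm W" for W
  proof -
    have "?T W \<bullet> ?T W = W \<bullet> W"
      by (simp add: inner_Pair first_col_def rest_cols_def column_def inner_vec_def sum_UNIV_option sum.distrib)
    then show ?thesis by (simp add: norm_eq_sqrt_inner)
  qed
  show "bij ?T"
  proof (rule o_bij)
    let ?S = "\<lambda>(z, Z). (\<chi> i k. case k of None \<Rightarrow> z $ i | Some j \<Rightarrow> Z $ i $ j) :: real^'q option^'n"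
    show "?S \<circ> ?T = id" "?T \<circ> ?S = id"
      by (auto simp: fun_eq_iff vec_eq_iff first_col_def rest_cols_def column_def split: option.split)
  qed
qed

lemma borel_measurable_first_col [measurable (raw)]:
  fixes X :: "'w \<Rightarrow> real^('q::finite) option^'n"
  assumes [measurable]: "X \<in> borel_measurable M"
  shows "(\<lambda>w. first_col (X w)) \<in> borel_measurable M"
  unfolding first_col_def column_def by measurable

lemma borel_measurable_rest_cols [measurable (raw)]:
  fixes X :: "'w \<Rightarrow> real^('q::finite) option^'n"
  assumes [measurable]: "X \<in> borel_measurable M"
  shows "(\<lambda>w. rest_cols (X w)) \<in> borel_measurable M"
  unfolding rest_cols_def by measurable

text \<open>
  The block triangular factor of \<open>S\<close> is applied to the standardized rows: the columns after the first one involve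
  \<open>Z\<close> only, and the first column is its regression on them plus a multiple of \<open>z\<close>. The independence of \<open>z\<close>
  and \<open>Z\<close> is expressed by an iterated integral.
\<close>

lemma (in prob_space) partitioned_gaussian_matrix:
  fixes X :: "'a \<Rightarrow> real^('q::finite) option^'n" and L2 :: "real^'q^'q"
  assumes S: "positive_definite S" and X: "gaussian_matrix M X C S"
    and L2: "L2 ** transpose L2 = block22 S"
  defines "g \<equiv> matrix_inv (block22 S) *v block21 S"
  obtains z :: "'a \<Rightarrow> real^'n" and Z :: "'a \<Rightarrow> real^'q^'n"
  where "random_variable borel z" "random_variable borel Z"
    "\<And>f. f \<in> borel_measurable borel \<Longrightarrow> (\<integral>\<^sup>+w. f (Z w) \<partial>M) = (\<integral>\<^sup>+Z. f Z \<partial>std_gauss)"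
    "\<And>f. case_prod f \<in> borel_measurable borel \<Longrightarrow>
      (\<integral>\<^sup>+w. f (z w) (Z w) \<partial>M) = (\<integral>\<^sup>+Z. (\<integral>\<^sup>+z. f z Z \<partial>std_gauss) \<partial>std_gauss)"
    "\<And>w. rest_cols (X w) = rest_cols C + Z w ** transpose L2"
    "\<And>w. first_col (X w) = first_col C - rest_cols C *v g + rest_cols (X w) *v g + sqrt (schur_complement S) *\<^sub>R z w"
    "random_variable borel X"
proof -
  define L where "L = ((\<chi> k l. case k of
      None \<Rightarrow> (case l of None \<Rightarrow> sqrt (schur_complement S) | Some j \<Rightarrow> (g v* L2) $ j)
    | Some i \<Rightarrow> (case l of None \<Rightarrow> 0 | Some j \<Rightarrow> L2 $ i $ j)) :: real^'q option^'q option)"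
  have L: "invertible L" "L ** transpose L = S"
    using block_triangular_factorization[OF S L2] unfolding L_def g_def by blast+
  define W where "W = (\<lambda>\<omega>. \<chi> i. matrix_inv L *v (row i (X \<omega>) - row i C))"
  note W = gaussian_matrix_standardize(1,2)[OF X L, folded W_def]
  have XW: "X w = C + W w ** transpose L" for w
    using gaussian_matrix_standardize(3)[OF X L, of w] by (simp only: W_def)
  define z where "z w = first_col (W w)" for w
  define Z where "Z w = rest_cols (W w)" for w
  have [measurable]: "random_variable borel W" by (rule W(1))
  have m[measurable]: "random_variable borel z" "random_variable borel Z"
    unfolding z_def Z_def by measurable
  have law: "distr M borel (\<lambda>w. (z w, Z w)) = std_gauss"
  proof -
    have "distr M borel (\<lambda>w. (z w, Z w)) = distr (distr M borel W) borel (\<lambda>W. (first_col W, rest_cols W))"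
      by (subst distr_distr) (simp_all add: o_def z_def Z_def borel_prod[symmetric])
    then show ?thesis by (simp add: W(2) distr_std_gauss_columns)
  qed
  interpret A: prob_space "std_gauss :: (real^'n) measure" by (rule prob_space_std_gauss)
  interpret B: prob_space "std_gauss :: (real^'q^'n) measure" by (rule prob_space_std_gauss)
  interpret AB: pair_sigma_finite "std_gauss :: (real^'n) measure" "std_gauss :: (real^'q^'n) measure" ..
  have joint: "(\<integral>\<^sup>+w. f (z w) (Z w) \<partial>M) = (\<integral>\<^sup>+Z. (\<integral>\<^sup>+z. f z Z \<partial>std_gauss) \<partial>std_gauss)"
    if f: "case_prod f \<in> borel_measurable borel" for f :: "real^'n \<Rightarrow> real^'q^'n \<Rightarrow> ennreal"
  proof -
    have "random_variable borel (\<lambda>w. (z w, Z w))"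
      unfolding borel_prod[symmetric] by measurable
    then have "(\<integral>\<^sup>+w. f (z w) (Z w) \<partial>M) = (\<integral>\<^sup>+p. case_prod f p \<partial>distr M borel (\<lambda>w. (z w, Z w)))"
      using f by (subst nn_integral_distr) simp_all
    also have "\<dots> = (\<integral>\<^sup>+p. case_prod f p \<partial>(std_gauss \<Otimes>\<^sub>M std_gauss))"
      by (simp add: law std_gauss_pair)
    also have "\<dots> = (\<integral>\<^sup>+Z. (\<integral>\<^sup>+z. f z Z \<partial>std_gauss) \<partial>std_gauss)"
      using f by (subst AB.nn_integral_snd[symmetric]) (simp_all add: std_gauss_pair)
    finally show ?thesis .
  qed
  have marg: "(\<integral>\<^sup>+w. f (Z w) \<partial>M) = (\<integral>\<^sup>+Z. f Z \<partial>std_gauss)"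
    if [measurable]: "f \<in> borel_measurable borel" for f :: "real^'q^'n \<Rightarrow> ennreal"
  proof -
    have "case_prod (\<lambda>(_::real^'n) Z. f Z) \<in> borel_measurable borel"
      unfolding borel_prod[symmetric] by measurable
    from joint[OF this] show ?thesis using A.emeasure_space_1 by simp
  qed
  have X_eq: "X w $ i $ k = C $ i $ k + (\<Sum>l\<in>UNIV. W w $ i $ l * L $ k $ l)" for w i k
    by (subst XW) (simp add: matrix_matrix_mult_def transpose_def)
  have rest: "rest_cols (X w) = rest_cols C + Z w ** transpose L2" for w
    by (simp add: vec_eq_iff rest_cols_def X_eq Z_def matrix_matrix_mult_def transpose_def sum_UNIV_option L_def)
  have "first_col (X w) = first_col C + (Z w ** transpose L2) *v g + sqrt (schur_complement S) *\<^sub>R z w" for w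
  proof -
    have "(Z w ** transpose L2) *v g = Z w *v (g v* L2)"
      by (simp flip: matrix_vector_mul_assoc)
    then show ?thesis
      by (simp add: vec_eq_iff first_col_def column_def X_eq Z_def z_def rest_cols_def
          matrix_vector_mult_def sum_UNIV_option L_def mult.commute)
  qed
  then have first: "first_col (X w) = first_col C - rest_cols C *v g + rest_cols (X w) *v g
      + sqrt (schur_complement S) *\<^sub>R z w" for w
    by (simp add: rest matrix_vector_mult_add_rdistrib)
  have "X = (\<lambda>w. C + W w ** transpose L)" using XW by blast
  then have "random_variable borel X" by simp
  with that[OF m marg joint rest first] show ?thesis by blast
qed

text \<open>
  The column space is a line, so it is spanned by any nonzero vector \<open>v\<close> in it.
\<close>

lemma rank_one_columns:
  fixes C :: "real^'k^'n"
  assumes rank: "rank C = 1" and v: "v \<in> range ((*v) C)" "v \<noteq> 0"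
  obtains d where "C = outer ((1 / norm v) *\<^sub>R v) d"
proof -
  let ?a = "(1 / norm v) *\<^sub>R v"
  have sub: "subspace (range ((*v) C))"
    by (intro linear_subspace_image subspace_UNIV) simp
  have dim: "dim (range ((*v) C)) = 1"
    using rank by (simp add: rank_dim_range)
  have "span {v} = span (range ((*v) C))"
  proof (rule dim_eq_span)
    show "{v} \<subseteq> range ((*v) C)" using v by simp
    show "dim (range ((*v) C)) \<le> dim {v}" using v(2) by (simp add: dim dim_singleton)
  qed
  then have R: "range ((*v) C) = span {v}" using sub by (simp add: span_eq_iff[THEN iffD2])
  have "\<exists>t. column j C = t *\<^sub>R ?a" for j
  proof -
    have "C *v axis j 1 \<in> span {v}" using R by blast
    then obtain t where "C *v axis j 1 = t *\<^sub>R v" by (auto simp: span_singleton)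
    then have "column j C = (t * norm v) *\<^sub>R ?a" using v(2) by (simp add: matrix_vector_mult_basis)
    then show ?thesis by blast
  qed
  then obtain d where d: "\<And>j. column j C = d j *\<^sub>R ?a" by metis
  have "C = outer ?a (\<chi> j. d j)"
    unfolding vec_eq_iff
  proof (intro allI)
    fix i j
    have "C $ i $ j = column j C $ i" by (simp add: column_def)
    then show "C $ i $ j = outer ?a (\<chi> j. d j) $ i $ j" by (simp add: d outer_def mult.commute)
  qed
  then show ?thesis by (rule that)
qed

lemma outer_mult_matrix:
  "outer a d ** transpose T = outer a (T *v d)"
  by (simp add: outer_def matrix_matrix_mult_def matrix_vector_mult_def transpose_def vec_eq_iff
      sum_distrib_left mult_ac)

text \<open>
  This identifies \<open>\<tau>\<close> as the squared length of the vector \<open>c = L\<^sup>-\<^sup>1 d\<close> that describes the mean of the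
  standardized matrix.
\<close>

lemma trace_inverse_gram_outer:
  fixes L :: "real^'q^'q" and a :: "real^'n"
  assumes L: "invertible L" and a: "norm a = 1"
  shows "trace (matrix_inv (L ** transpose L) ** (transpose (outer a d) ** outer a d))
    = (matrix_inv L *v d) \<bullet> (matrix_inv L *v d)"
proof -
  let ?J = "matrix_inv L"
  note J = matrix_inv_inverse[OF L]
  have TJ: "transpose ?J ** transpose L = mat 1" "transpose L ** transpose ?J = mat 1"
    using J by (simp_all flip: matrix_transpose_mul add: transpose_mat)
  have "(L ** transpose L) ** (transpose ?J ** ?J) = L ** ((transpose L ** transpose ?J) ** ?J)"
    by (simp add: matrix_mul_assoc)
  then have inv: "matrix_inv (L ** transpose L) = transpose ?J ** ?J"
    by (intro matrix_inv_unique) (simp add: TJ J)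
  have aa: "(\<Sum>i\<in>UNIV. a $ i * a $ i) = 1"
    using a by (simp add: norm_eq_1 inner_vec_def)
  have "transpose (outer a d) ** outer a d = outer d d"
  proof -
    have "(\<Sum>k\<in>UNIV. a $ k * d $ i * (a $ k * d $ j)) = (\<Sum>k\<in>UNIV. a $ k * a $ k) * (d $ i * d $ j)" for i j
      by (subst sum_distrib_right) (simp only: mult_ac)
    then show ?thesis by (simp add: outer_def matrix_matrix_mult_def transpose_def vec_eq_iff aa)
  qed
  moreover have "trace (A ** outer d d) = d \<bullet> (A *v d)" for A :: "real^'q^'q"
    by (simp add: trace_def outer_def matrix_matrix_mult_def matrix_vector_mult_def inner_vec_def
        sum_distrib_left mult_ac)
  moreover have "d \<bullet> ((transpose ?J ** ?J) *v d) = (?J *v d) \<bullet> (?J *v d)"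
    by (simp add: dot_lmul_matrix inner_commute[of d] flip: matrix_vector_mul_assoc)
  ultimately show ?thesis by (simp only: inv)
qed

lemma AE_std_gauss_shift_full_rank:
  fixes D :: "real^'q^'n"
  assumes "CARD('q) \<le> CARD('n)"
  shows "AE Z in std_gauss. invertible (transpose (Z + D) ** (Z + D))"
proof (rule std_gauss_absolutely_continuous)
  have "AE Z in distr lborel borel ((+) D). invertible (transpose Z ** Z)"
    unfolding lborel_distr_plus by (rule AE_full_column_rank[OF assms])
  then show "AE Z in lborel. invertible (transpose (Z + D) ** (Z + D))"
    by (subst (asm) AE_distr_iff) (simp_all add: add.commute invertible_det_nz)
qed

text \<open>
  The conditional Laplace transform of \<open>\<rho>\<close> given \<open>X\<^sub>2\<close>, which is noncentral chi-square with
  \<open>n - q\<close> degrees of freedom.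
\<close>

lemma nn_integral_exp_residual_form:
  fixes A :: "real^'q^'n"
  assumes inv: "invertible (transpose A ** A)" and \<theta>: "\<theta> < 1 / 2"
  shows "(\<integral>\<^sup>+z. ennreal (exp (\<theta> * ((z + \<mu>) \<bullet> (residual_projection A *v (z + \<mu>))))) \<partial>std_gauss)
    = ennreal ((1 - 2 * \<theta>) powr (- real (CARD('n) - CARD('q)) / 2) *
        exp (\<theta> / (1 - 2 * \<theta>) * (\<mu> \<bullet> (residual_projection A *v \<mu>))))"
proof -
  obtain B where B: "pairwise orthogonal B" "\<And>b. b \<in> B \<Longrightarrow> norm b = 1" "card B + CARD('q) = CARD('n)"
      "\<And>b w. b \<in> B \<Longrightarrow> b \<bullet> (A *v w) = 0"
      "\<And>x. residual_projection A *v x = (\<Sum>b\<in>B. (b \<bullet> x) *\<^sub>R b)"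
    by (rule residual_projection_orthonormal_basis[OF inv]) (rule that, assumption+)
  have "card B = CARD('n) - CARD('q)" using B(3) by simp
  then show ?thesis
    using nn_integral_std_gauss_exp_quadratic[OF B(1,2) \<theta>, of \<mu>]
    by (simp only: residual_quadratic_form_sum[OF B(5)])
qed

section \<open>The scaled Schur complement in the rank-one case\<close>

theorem proposition2:
  fixes P :: "'w measure"
    and X :: "'w \<Rightarrow> real^('q::finite) option^('n::finite)"
    and M :: "real^'q option^'n"
    and \<Sigma> \<Omega> :: "real^'q option^'q option"
    and n p :: nat
    and m1 mt1 :: "real^'n"
    and M2 :: "real^'q^'n"
    and u \<rho> :: "'w \<Rightarrow> real"
    and lam \<nu> \<tau> :: real
  assumes "prob_space P"
    and n: "n = CARD('n)" and p: "p = CARD('q option)"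
    and "2 \<le> p" and "p \<le> n"
    and "positive_definite \<Sigma>"
    and "gaussian_matrix P X M \<Sigma>"
    and m1: "m1 = first_col M" and M2: "M2 = rest_cols M"
    and mt1: "mt1 = m1 - M2 *v (matrix_inv (block22 \<Sigma>) *v block21 \<Sigma>)"
    and u: "u = (\<lambda>\<omega>. (mt1 \<bullet> (residual_projection (rest_cols (X \<omega>)) *v mt1)) / (norm mt1)\<^sup>2)"
    and lam: "lam = (norm mt1)\<^sup>2 / schur_complement \<Sigma>"
    and \<nu>: "\<nu> = real n - real p + 1"
    and \<rho>: "\<rho> = (\<lambda>\<omega>. schur_complement (transpose (X \<omega>) ** X \<omega>) / schur_complement \<Sigma>)"
    and \<Omega>: "\<Omega> = matrix_inv \<Sigma> ** (transpose M ** M)"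
    and \<tau>: "\<tau> = trace (matrix_inv (block22 \<Sigma>) ** (transpose M2 ** M2))"
    and "m1 \<noteq> 0" and "M2 \<noteq> 0" and "mt1 \<noteq> 0"
    and "rank M = 1" and "rank \<Omega> = 1"
  shows
    "has_pdf P u (noncentral_beta_density (\<nu> / 2) ((real p - 1) / 2) \<tau>) \<and>
     (\<forall>\<theta> < 1/2.
        integrable P (\<lambda>\<omega>. exp (\<theta> * \<rho> \<omega>)) \<and>
        mgf P \<rho> \<theta> = (1 - 2 * \<theta>) powr (- \<nu> / 2) * exp (- \<tau> / 2) *
          (\<Sum>l. (\<tau> / 2) ^ l / fact l *
             hyp1F1 (\<nu> / 2) (real n / 2 + real l) (lam * \<theta> / (1 - 2 * \<theta>))) \<and>
        mgf P \<rho> \<theta> = (1 - 2 * \<theta>) powr (- \<nu> / 2) * exp (- \<tau> / 2) *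
          appell_Phi2 (\<nu> / 2) (real n / 2) (real n / 2) (lam * \<theta> / (1 - 2 * \<theta>)) (\<tau> / 2)) \<and>
     (\<forall>h. has_pdf P u h \<longrightarrow>
        (\<forall>k.
          mixture_weight lam h k = exp (- \<tau> / 2) * ((lam / 2) ^ k / fact k) *
            (\<Sum>l. (\<tau> / 2) ^ l / fact l *
               (pochhammer (\<nu> / 2) k / pochhammer (real n / 2 + real l) k) *
               hyp1F1 (\<nu> / 2 + real k) (real n / 2 + real k + real l) (- lam / 2)) \<and>
          mixture_weight lam h k = exp (- \<tau> / 2) * ((lam / 2) ^ k / fact k) *
            (pochhammer (\<nu> / 2) k / pochhammer (real n / 2) k) *
            appell_Phi2 (\<nu> / 2 + real k) (real n / 2) (real n / 2 + real k) (- lam / 2) (\<tau> / 2)) \<and>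
        (\<forall>s::real.
          (\<lambda>k. s ^ k * mixture_weight lam h k) sums
            (exp (- \<tau> / 2) *
              (\<Sum>l. (\<tau> / 2) ^ l / fact l *
                 hyp1F1 (\<nu> / 2) (real n / 2 + real l) (lam / 2 * (s - 1)))) \<and>
          (\<lambda>k. s ^ k * mixture_weight lam h k) sums
            (exp (- \<tau> / 2) *
              appell_Phi2 (\<nu> / 2) (real n / 2) (real n / 2) (lam / 2 * (s - 1)) (\<tau> / 2))))"
proof -
  interpret prob_space P by fact
  define s where "s = sqrt (schur_complement \<Sigma>)"
  have sc: "0 < schur_complement \<Sigma>" by (rule schur_complement_positive) fact
  then have s: "0 < s" "s * s = schur_complement \<Sigma>" by (simp_all add: s_def)
  define g where "g = matrix_inv (block22 \<Sigma>) *v block21 \<Sigma>"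
  have mt1_eq: "mt1 = first_col M - rest_cols M *v g" by (simp add: mt1 m1 M2 g_def)
  obtain L2 :: "real^'q^'q" where L2: "invertible L2" "L2 ** transpose L2 = block22 \<Sigma>"
    using positive_definite_factorization[OF positive_definite_block22[OF \<open>positive_definite \<Sigma>\<close>]] by metis
  note J = matrix_inv_inverse[OF L2(1)]
  have L2T: "invertible (transpose L2)"
    using L2(1) by (simp add: invertible_det_nz det_transpose)
  obtain z Z where z[measurable]: "random_variable borel z" and Z[measurable]: "random_variable borel Z"
    and marginal: "\<And>f. f \<in> borel_measurable borel \<Longrightarrow> (\<integral>\<^sup>+w. f (Z w) \<partial>P) = (\<integral>\<^sup>+Z. f Z \<partial>std_gauss)"
    and joint: "\<And>f. case_prod f \<in> borel_measurable borel \<Longrightarrow>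
      (\<integral>\<^sup>+w. f (z w) (Z w) \<partial>P) = (\<integral>\<^sup>+Z. (\<integral>\<^sup>+z. f z Z \<partial>std_gauss) \<partial>std_gauss)"
    and X2: "\<And>w. rest_cols (X w) = rest_cols M + Z w ** transpose L2"
    and x1: "\<And>w. first_col (X w) = first_col M - rest_cols M *v g + rest_cols (X w) *v g
      + sqrt (schur_complement \<Sigma>) *\<^sub>R z w"
    and X[measurable]: "random_variable borel X"
    by (rule partitioned_gaussian_matrix[OF \<open>positive_definite \<Sigma>\<close> \<open>gaussian_matrix P X M \<Sigma>\<close> L2(2), folded g_def])
      (rule that, assumption+)

  have p1: "p = CARD('q) + 1" by (simp add: p)
  then have qn: "CARD('q) < CARD('n)" using \<open>p \<le> n\<close> n by simp
  define A where "A = real (CARD('n) - CARD('q)) / 2"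
  define B where "B = real CARD('q) / 2"
  have A: "0 < A" "\<nu> / 2 = A" using qn by (simp_all add: A_def \<nu> p1 n of_nat_diff)
  have B: "0 < B" "(real p - 1) / 2 = B" by (simp_all add: B_def p1)
  have AB: "real n / 2 = A + B" using qn by (simp add: A_def B_def n of_nat_diff field_simps)

  define a where "a = (1 / norm mt1) *\<^sub>R mt1"
  have a: "norm a = 1" "mt1 = norm mt1 *\<^sub>R a" using \<open>mt1 \<noteq> 0\<close> by (simp_all add: a_def)
  \<comment> \<open>the mean residual is a column combination of \<open>M\<close>, so all columns of \<open>M\<close> are multiples of \<open>a\<close>\<close>
  have "mt1 = M *v (\<chi> k. case k of None \<Rightarrow> 1 | Some j \<Rightarrow> - (g $ j))"
    by (simp add: mt1_eq first_col_def rest_cols_def column_def matrix_vector_mult_def vec_eq_iff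
        sum_UNIV_option sum_negf)
  then obtain d' where d': "M = outer a d'"
    using rank_one_columns[OF \<open>rank M = 1\<close> _ \<open>mt1 \<noteq> 0\<close>] unfolding a_def by blast
  define d where "d = (\<chi> j. d' $ Some j)"
  have M2d: "rest_cols M = outer a d"
    unfolding d' d_def by (simp add: rest_cols_def outer_def vec_eq_iff)
  define c where "c = matrix_inv L2 *v d"
  have \<tau>c: "\<tau> = c \<bullet> c"
    using trace_inverse_gram_outer[OF L2(1) a(1), of d] by (simp add: \<tau> M2 M2d L2(2) c_def)
  \<comment> \<open>\<open>Y\<close> is \<open>X\<^sub>2\<close> with standardized rows; it has the same column space\<close>
  define Y where "Y w = Z w + outer a c" for w
  have X2Y: "rest_cols (X w) = Y w ** transpose L2" for w
  proof -
    have "outer a c ** transpose L2 = outer a d"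
      by (simp add: outer_mult_matrix c_def matrix_vector_mul_assoc J)
    then show ?thesis by (simp add: X2 M2d Y_def matrix_matrix_mult_def vec_eq_iff sum.distrib distrib_right)
  qed
  have [measurable]: "random_variable borel Y" unfolding Y_def by measurable

  have full_rank: "AE w in P. invertible (transpose (Y w) ** Y w)"
  proof -
    \<comment> \<open>the law of \<open>Z\<close> is known through integrals, so the null set is transported by its indicator\<close>
    define N where "N = {V. det (transpose (V + outer a c) ** (V + outer a c)) = 0}"
    have N[measurable]: "N \<in> sets borel" unfolding N_def by measurable
    have "AE V in std_gauss. V \<notin> N"
      using AE_std_gauss_shift_full_rank[of "outer a c"] qn by (simp add: N_def invertible_det_nz)
    then have "(\<integral>\<^sup>+V. indicator N V \<partial>std_gauss) = 0"
      by (subst nn_integral_0_iff_AE) (auto elim!: eventually_mono)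
    then have "(\<integral>\<^sup>+w. indicator N (Z w) \<partial>P) = 0" by (subst marginal) simp_all
    then have "AE w in P. indicator N (Z w) = (0::ennreal)"
      by (subst (asm) nn_integral_0_iff_AE) simp_all
    then show ?thesis by eventually_elim (auto simp: N_def Y_def invertible_det_nz split: split_indicator_asm)
  qed

  define U where "U V = a \<bullet> (residual_projection V *v a)" for V :: "real^'q^'n"
  have [measurable]: "U \<in> borel_measurable borel" unfolding U_def[abs_def] by measurable
  have scaled: "(t *\<^sub>R a) \<bullet> (residual_projection V *v (t *\<^sub>R a)) = t\<^sup>2 * U V" for t V
    by (simp add: U_def matrix_vector_mult_scaleR power2_eq_square)
  have u_measurable: "u \<in> borel_measurable P" unfolding u by measurable
  have u_eq: "AE w in P. u w = U (Y w) \<and> 0 \<le> u w \<and> u w \<le> 1"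
    using full_rank
  proof eventually_elim
    case (elim w)
    have "residual_projection (rest_cols (X w)) = residual_projection (Y w)"
      unfolding X2Y by (rule residual_projection_right_mult[OF L2T elim])
    then have "u w = U (Y w)"
      unfolding u using \<open>mt1 \<noteq> 0\<close> scaled[of "norm mt1" "Y w"] by (simp flip: a(2))
    moreover have "0 \<le> U (Y w)" "U (Y w) \<le> 1"
      using residual_quadratic_form_bounds(2,3)[OF elim, of a] a(1) by (simp_all add: U_def norm_eq_1)
    ultimately show ?case by simp
  qed
  have u_moments: "(\<integral>w. u w ^ j \<partial>P) = noncentral_beta_moment A B \<tau> j" for j
  proof -
    have "(\<integral>\<^sup>+w. ennreal (u w ^ j) \<partial>P) = (\<integral>\<^sup>+w. ennreal (U (Z w + outer a c) ^ j) \<partial>P)"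
      by (rule nn_integral_cong_AE) (use u_eq in \<open>eventually_elim, simp add: Y_def\<close>)
    also have "\<dots> = (\<integral>\<^sup>+V. ennreal (U (V + outer a c) ^ j) \<partial>std_gauss)"
      by (rule marginal) measurable
    also have "\<dots> = ennreal (noncentral_beta_moment A B \<tau> j)"
      unfolding U_def A_def B_def \<tau>c by (rule nn_integral_residual_moment[OF qn a(1)])
    finally have "(\<integral>\<^sup>+w. ennreal (u w ^ j) \<partial>P) = ennreal (noncentral_beta_moment A B \<tau> j)" .
    moreover have "AE w in P. 0 \<le> u w ^ j" using u_eq by eventually_elim simp
    moreover have "0 \<le> noncentral_beta_moment A B \<tau> j"
      using A B by (intro noncentral_beta_moment_nonneg) (simp_all add: \<tau>c)
    ultimately show ?thesis
      using u_measurable by (subst integral_eq_nn_integral) simp_all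
  qed
  interpret V: noncentral_beta_variable P u A B \<tau>
  proof
    show "AE w in P. 0 \<le> u w \<and> u w \<le> 1" using u_eq by eventually_elim simp
  qed (use u_measurable u_moments A B in \<open>simp_all add: \<tau>c\<close>)

  have mgf_\<rho>: "integrable P (\<lambda>w. exp (\<theta> * \<rho> w))"
      "mgf P \<rho> \<theta> = (1 - 2 * \<theta>) powr (- \<nu> / 2) * (\<integral>w. u w ^ 0 * exp (lam * \<theta> / (1 - 2 * \<theta>) * u w) \<partial>P)"
    if \<theta>: "\<theta> < 1 / 2" for \<theta>
  proof -
    \<comment> \<open>\<open>\<rho>\<close> is a quadratic form in \<open>z + \<mu>\<close>, since the projection removes the regression of \<open>x\<^sub>1\<close> on \<open>X\<^sub>2\<close>\<close>
    define \<mu> where "\<mu> = (1 / s) *\<^sub>R mt1"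
    define K where "K = (1 - 2 * \<theta>) powr (- \<nu> / 2)"
    define v where "v = lam * \<theta> / (1 - 2 * \<theta>)"
    define F where "F y V = ennreal (exp (\<theta> * ((y + \<mu>) \<bullet> (residual_projection (V + outer a c) *v (y + \<mu>)))))"
      for y :: "real^'n" and V :: "real^'q^'n"
    have [measurable]: "random_variable borel \<rho>" unfolding \<rho> by measurable
    have Fm: "case_prod F \<in> borel_measurable borel"
      unfolding F_def borel_prod[symmetric] by measurable
    have \<rho>_eq: "AE w in P. \<rho> w = (z w + \<mu>) \<bullet> (residual_projection (Z w + outer a c) *v (z w + \<mu>))"
      using full_rank
    proof eventually_elim
      case (elim w)
      let ?X2 = "rest_cols (X w)"
      have R: "residual_projection ?X2 = residual_projection (Y w)"
        unfolding X2Y by (rule residual_projection_right_mult[OF L2T elim])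
      have inv: "invertible (transpose ?X2 ** ?X2)"
      proof -
        have "transpose ?X2 ** ?X2 = L2 ** (transpose (Y w) ** Y w) ** transpose L2"
          by (simp add: X2Y matrix_transpose_mul matrix_mul_assoc)
        then show ?thesis using elim L2(1) L2T by (simp add: invertible_mult)
      qed
      have "mt1 + s *\<^sub>R z w = s *\<^sub>R (z w + \<mu>)" using s(1) by (simp add: \<mu>_def scaleR_add_right)
      then have x1': "first_col (X w) = ?X2 *v g + s *\<^sub>R (z w + \<mu>)"
        unfolding x1[of w] mt1_eq[symmetric] s_def[symmetric] by (simp add: algebra_simps)
      let ?r = "residual_projection ?X2"
      have "?r *v first_col (X w) = s *\<^sub>R (?r *v (z w + \<mu>))"
        unfolding x1' by (simp add: matrix_vector_right_distrib residual_projection_annihilates(1)[OF inv] matrix_vector_mult_scaleR)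
      then have "schur_complement (transpose (X w) ** X w) = (s *\<^sub>R (?r *v (z w + \<mu>))) \<bullet> (s *\<^sub>R (?r *v (z w + \<mu>)))"
        unfolding schur_complement_gram[OF inv] residual_quadratic_form_bounds(1)[OF inv, symmetric] by simp
      also have "\<dots> = schur_complement \<Sigma> * ((z w + \<mu>) \<bullet> (?r *v (z w + \<mu>)))"
        using residual_quadratic_form_bounds(1)[OF inv, of "z w + \<mu>"] by (simp add: s(2) flip: mult.assoc)
      finally show ?case
        unfolding \<rho> using sc by (simp add: R Y_def)
    qed
    have "(\<integral>\<^sup>+w. ennreal (exp (\<theta> * \<rho> w)) \<partial>P) = (\<integral>\<^sup>+w. F (z w) (Z w) \<partial>P)"
      by (rule nn_integral_cong_AE) (use \<rho>_eq in \<open>eventually_elim, simp add: F_def\<close>)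
    also have "\<dots> = (\<integral>\<^sup>+V. (\<integral>\<^sup>+y. F y V \<partial>std_gauss) \<partial>std_gauss)"
      by (rule joint[OF Fm])
    also have "\<dots> = (\<integral>\<^sup>+V. ennreal (K * exp (v * U (V + outer a c))) \<partial>std_gauss)"
    proof (rule nn_integral_cong_AE)
      have "AE V in std_gauss. invertible (transpose (V + outer a c) ** (V + outer a c))"
        using qn by (intro AE_std_gauss_shift_full_rank) simp
      then show "AE V in std_gauss. (\<integral>\<^sup>+y. F y V \<partial>std_gauss) = ennreal (K * exp (v * U (V + outer a c)))"
      proof eventually_elim
        case (elim V)
        have "\<mu> = (norm mt1 / s) *\<^sub>R a" using \<open>mt1 \<noteq> 0\<close> by (simp add: \<mu>_def a_def)
        then have "\<mu> \<bullet> (residual_projection (V + outer a c) *v \<mu>) = lam * U (V + outer a c)"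
          by (simp only: scaled) (simp add: lam power_divide power2_eq_square[of s] s(2))
        moreover have "- real (CARD('n) - CARD('q)) / 2 = - \<nu> / 2"
          using A(2) by (simp add: A_def)
        ultimately show ?case
          unfolding F_def nn_integral_exp_residual_form[OF elim \<theta>] by (simp add: K_def v_def)
      qed
    qed
    also have "\<dots> = (\<integral>\<^sup>+w. ennreal (K * exp (v * U (Z w + outer a c))) \<partial>P)"
      by (rule marginal[symmetric]) measurable
    also have "\<dots> = (\<integral>\<^sup>+w. ennreal (K * (u w ^ 0 * exp (v * u w))) \<partial>P)"
      by (rule nn_integral_cong_AE) (use u_eq in \<open>eventually_elim, simp add: Y_def\<close>)
    also have "\<dots> = ennreal (\<integral>w. K * (u w ^ 0 * exp (v * u w)) \<partial>P)"
      using V.integrable_power_exp[of 0 v] by (intro nn_integral_eq_integral) (simp_all add: K_def)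
    finally have nn: "(\<integral>\<^sup>+w. ennreal (exp (\<theta> * \<rho> w)) \<partial>P) = ennreal (\<integral>w. K * (u w ^ 0 * exp (v * u w)) \<partial>P)" .
    then show "integrable P (\<lambda>w. exp (\<theta> * \<rho> w))"
      by (simp add: integrable_iff_bounded)
    have "mgf P \<rho> \<theta> = enn2real (\<integral>\<^sup>+w. ennreal (exp (\<theta> * \<rho> w)) \<partial>P)"
      unfolding mgf_def by (rule integral_eq_nn_integral) simp_all
    also have "\<dots> = (\<integral>w. K * (u w ^ 0 * exp (v * u w)) \<partial>P)"
      unfolding nn by (rule enn2real_ennreal) (simp add: K_def)
    finally show "mgf P \<rho> \<theta> = (1 - 2 * \<theta>) powr (- \<nu> / 2) * (\<integral>w. u w ^ 0 * exp (lam * \<theta> / (1 - 2 * \<theta>) * u w) \<partial>P)"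
      by (simp add: K_def v_def)
  qed

  have h1: "(\<integral>w. u w ^ k * exp (v * u w) \<partial>P) = exp (- \<tau> / 2) * (\<Sum>l. (\<tau> / 2) ^ l / fact l *
      (pochhammer (\<nu> / 2) k / pochhammer (real n / 2 + real l) k) *
      hyp1F1 (\<nu> / 2 + real k) (real n / 2 + real k + real l) v)" for k v
    unfolding A(2) AB by (rule V.exp_moment_hyp1F1)
  have h2: "(\<integral>w. u w ^ k * exp (v * u w) \<partial>P) = exp (- \<tau> / 2) * (pochhammer (\<nu> / 2) k / pochhammer (real n / 2) k) *
      appell_Phi2 (\<nu> / 2 + real k) (real n / 2) (real n / 2 + real k) v (\<tau> / 2)" for k v
    unfolding A(2) AB by (rule V.exp_moment_Phi2)
  have h10: "(\<integral>w. u w ^ 0 * exp (v * u w) \<partial>P) = exp (- \<tau> / 2) * (\<Sum>l. (\<tau> / 2) ^ l / fact l *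
      hyp1F1 (\<nu> / 2) (real n / 2 + real l) v)" for v
    using h1[of 0 v] by simp
  have h20: "(\<integral>w. u w ^ 0 * exp (v * u w) \<partial>P) = exp (- \<tau> / 2) *
      appell_Phi2 (\<nu> / 2) (real n / 2) (real n / 2) v (\<tau> / 2)" for v
    using h2[of 0 v] by simp

  show ?thesis
  proof (intro conjI allI impI)
    show "has_pdf P u (noncentral_beta_density (\<nu> / 2) ((real p - 1) / 2) \<tau>)"
      unfolding A(2) B(2) by (rule V.has_noncentral_beta_pdf)
  next
    fix \<theta> :: real assume \<theta>: "\<theta> < 1 / 2"
    show "integrable P (\<lambda>\<omega>. exp (\<theta> * \<rho> \<omega>))" by (rule mgf_\<rho>(1)[OF \<theta>])
    show "mgf P \<rho> \<theta> = (1 - 2 * \<theta>) powr (- \<nu> / 2) * exp (- \<tau> / 2) *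
          (\<Sum>l. (\<tau> / 2) ^ l / fact l *
             hyp1F1 (\<nu> / 2) (real n / 2 + real l) (lam * \<theta> / (1 - 2 * \<theta>)))"
      unfolding mgf_\<rho>(2)[OF \<theta>] h10 by (rule mult.assoc[symmetric])
    show "mgf P \<rho> \<theta> = (1 - 2 * \<theta>) powr (- \<nu> / 2) * exp (- \<tau> / 2) *
          appell_Phi2 (\<nu> / 2) (real n / 2) (real n / 2) (lam * \<theta> / (1 - 2 * \<theta>)) (\<tau> / 2)"
      unfolding mgf_\<rho>(2)[OF \<theta>] h20 by (rule mult.assoc[symmetric])
  next
    fix h k assume h: "has_pdf P u h"
    show "mixture_weight lam h k = exp (- \<tau> / 2) * ((lam / 2) ^ k / fact k) *
            (\<Sum>l. (\<tau> / 2) ^ l / fact l *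
               (pochhammer (\<nu> / 2) k / pochhammer (real n / 2 + real l) k) *
               hyp1F1 (\<nu> / 2 + real k) (real n / 2 + real k + real l) (- lam / 2))"
      unfolding V.mixture_weight_eq[OF h] h1 by (simp only: mult_ac)
    show "mixture_weight lam h k = exp (- \<tau> / 2) * ((lam / 2) ^ k / fact k) *
            (pochhammer (\<nu> / 2) k / pochhammer (real n / 2) k) *
            appell_Phi2 (\<nu> / 2 + real k) (real n / 2) (real n / 2 + real k) (- lam / 2) (\<tau> / 2)"
      unfolding V.mixture_weight_eq[OF h] h2 by (simp only: mult_ac)
  next
    fix h and r :: real assume h: "has_pdf P u h"
    show "(\<lambda>k. r ^ k * mixture_weight lam h k) sums
            (exp (- \<tau> / 2) *
              (\<Sum>l. (\<tau> / 2) ^ l / fact l *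
                 hyp1F1 (\<nu> / 2) (real n / 2 + real l) (lam / 2 * (r - 1))))"
      using V.mixture_weight_generating_function[OF h, of r lam] unfolding h10 .
    show "(\<lambda>k. r ^ k * mixture_weight lam h k) sums
            (exp (- \<tau> / 2) *
              appell_Phi2 (\<nu> / 2) (real n / 2) (real n / 2) (lam / 2 * (r - 1)) (\<tau> / 2))"
      using V.mixture_weight_generating_function[OF h, of r lam] unfolding h20 .
  qed
qed

end
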